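(* There exists a family of linear functionals $\gamma^{\lambda}$, $\lambda\in\Lambda=\mathbb{Z}\times\mathbb{Z}$, continuous on the space $H$, such that, together with the sharp Poisson functional $\gamma^{\sharp}$, every $f\in H$ is developed in the series $$f=\sum_{\lambda\in\Lambda^{\sharp}}\gamma^{\lambda}(f)\,\mathbf{e}_{\lambda}=\gamma^{\sharp}(f)\,\mathbf{e}_{\sharp}+\sum_{\lambda\in\Lambda}\gamma^{\lambda}(f)\,\mathbf{e}_{\lambda},$$ which converges in $L_2(\mathbb{R})$, and for any $\delta>1$ there exists a constant $C_\delta$ such that for all $f\in H^{\delta}$ $$\sum_{\lambda\in\Lambda^{\sharp}}|\gamma^{\lambda}(f)|^2\le C_\delta\|f\|_\delta^2 .$$
   Context: The phase plane is $\Phi=\mathbb{R}\times\mathbb{R}$ with points $\lambda=(p,\theta)$, Euclidean norm $|\lambda|^2=p^2+\theta^2$ and Lebesgue measure $d\lambda=dp\,d\theta$. For $\lambda=(p,\theta)\in\Phi$ the Gabor function (coherent state) is $\mathbf{e}_\lambda(x)=2^{1/4}\exp(-\pi(x-p)^2+2\pi i\theta x)$, $x\in\mathbb{R}$. $\langle f|g\rangle=\int f\bar g\,dx$ is the scalar product of $L_2=L_2(\mathbb{R})$. For $\delta>0$, $H^\delta$ is the space of $f\in L_2$ with $\|f\|_\delta:=\left(\int_\Phi(|\lambda|^{\delta}+1)|\langle f|\mathbf{e}_\lambda\rangle|^2d\lambda\right)^{1/2}<\infty$, and $H=\bigcup_{\delta>1}H^\delta$. A linear functional on $H$ is called continuous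 if its restriction to each $H^\delta$, $\delta>1$, is continuous. $\Lambda=\mathbb{Z}\times\mathbb{Z}\subset\Phi$, $\sharp=(1/2,1/2)\in\Phi$, $\Lambda^\sharp=\Lambda\cup\{\sharp\}$. Let $\Theta(z)=2^{1/4}\sum_{q\in\mathbb{Z}}\exp(2\pi i qz-\pi q^2)$ and let $Zf(y,\xi)=\sum_{q\in\mathbb{Z}}\exp(2\pi iq\xi)f(y+q)$ be the Zak transform. The sharp Poisson functional is $\gamma^\sharp(f)=\frac{1}{i\Theta(0)}\sum_{q\in\mathbb{Z}}(-1)^qf(q+1/2)=\frac{Zf(1/2,1/2)}{i\Theta(0)}$; it is taken as a well-defined continuous functional on $H$.
   Formalization: With the weight |λ|^δ+1 the sharp Poisson functional is not continuous on H^δ for 1<δ≤2, so the claim fails there; the bound δ>1 is replaced by δ>a, with continuity of γ^♯ on the union of H^δ, δ>a, as a hypothesis, which holds exactly for a≥2. *)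

theory Defs
  imports "HOL-Analysis.Analysis"
begin

text \<open>
  Elements of \<open>L\<^sub>2(\<real>)\<close> are represented by square-integrable Borel functions rather than by
  equivalence classes. A functional that is linear and continuous in the sense of
  \<open>continuous_functional\<close> below automatically takes the same value on almost everywhere equal
  functions, since their difference has norm 0.
\<close>

definition L2 :: "(real \<Rightarrow> complex) set" where
  "L2 = {f \<in> borel_measurable lborel. integrable lborel (\<lambda>x. (cmod (f x))\<^sup>2)}"

definition L2_norm :: "(real \<Rightarrow> complex) \<Rightarrow> real" where
  "L2_norm f = sqrt (LINT x|lborel. (cmod (f x))\<^sup>2)"

definition L2_inner :: "(real \<Rightarrow> complex) \<Rightarrow> (real \<Rightarrow> complex) \<Rightarrow> complex" where
  "L2_inner f g = (LINT x|lborel. f x * cnj (g x))"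

text \<open>The phase plane is \<open>real \<times> real\<close>; its product norm is the Euclidean one.\<close>

definition gabor :: "real \<times> real \<Rightarrow> real \<Rightarrow> complex" where
  "gabor = (\<lambda>(p, \<theta>) x. of_real (2 powr (1/4)) *
     exp (- of_real pi * (of_real x - of_real p)\<^sup>2 + 2 * of_real pi * \<i> * of_real \<theta> * of_real x))"

definition H_delta :: "real \<Rightarrow> (real \<Rightarrow> complex) set" where
  "H_delta \<delta> = {f \<in> L2. integrable lborel
     (\<lambda>l::real \<times> real. (norm l powr \<delta> + 1) * (cmod (L2_inner f (gabor l)))\<^sup>2)}"

definition H_norm :: "real \<Rightarrow> (real \<Rightarrow> complex) \<Rightarrow> real" where
  "H_norm \<delta> f = sqrt (LINT l|(lborel :: (real \<times> real) measure).
     (norm l powr \<delta> + 1) * (cmod (L2_inner f (gabor l)))\<^sup>2)"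

text \<open>
  The space \<open>H = \<Union>\<delta>>1. H\<^sup>\<delta>\<close> is \<open>H_space 1\<close>. The lower bound is a parameter because the sharp
  Poisson functional is bounded on \<open>H\<^sup>\<delta>\<close> (with the weight \<open>|\<lambda>|\<^sup>\<delta> + 1\<close> under the integral) only
  for \<open>\<delta> > 2\<close>; hence its continuity on \<open>H_space a\<close>, a hypothesis of the theorem, holds exactly
  for \<open>a \<ge> 2\<close>.
\<close>

definition H_space :: "real \<Rightarrow> (real \<Rightarrow> complex) set" where
  "H_space a = (\<Union>\<delta>\<in>{a<..}. H_delta \<delta>)"

definition linear_functional_on :: "(real \<Rightarrow> complex) set \<Rightarrow> ((real \<Rightarrow> complex) \<Rightarrow> complex) \<Rightarrow> bool" where
  "linear_functional_on V \<phi> \<longleftrightarrow>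
     (\<forall>f\<in>V. \<forall>g\<in>V. \<phi> (\<lambda>x. f x + g x) = \<phi> f + \<phi> g) \<and>
     (\<forall>c. \<forall>f\<in>V. \<phi> (\<lambda>x. c * f x) = c * \<phi> f)"

definition continuous_on_H_delta :: "real \<Rightarrow> ((real \<Rightarrow> complex) \<Rightarrow> complex) \<Rightarrow> bool" where
  "continuous_on_H_delta \<delta> \<phi> \<longleftrightarrow>
     (\<forall>f\<in>H_delta \<delta>. \<forall>\<epsilon>>0. \<exists>\<eta>>0. \<forall>g\<in>H_delta \<delta>.
        H_norm \<delta> (\<lambda>x. g x - f x) < \<eta> \<longrightarrow> cmod (\<phi> g - \<phi> f) < \<epsilon>)"

definition continuous_functional :: "real \<Rightarrow> ((real \<Rightarrow> complex) \<Rightarrow> complex) \<Rightarrow> bool" where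
  "continuous_functional a \<phi> \<longleftrightarrow>
     linear_functional_on (H_space a) \<phi> \<and> (\<forall>\<delta>>a. continuous_on_H_delta \<delta> \<phi>)"

definition Lambda :: "(real \<times> real) set" where
  "Lambda = {(of_int m, of_int n) | m n :: int. True}"

definition sharp :: "real \<times> real" where
  "sharp = (1/2, 1/2)"

definition Lambda_sharp :: "(real \<times> real) set" where
  "Lambda_sharp = insert sharp Lambda"

definition Theta :: "complex \<Rightarrow> complex" where
  "Theta z = of_real (2 powr (1/4)) *
     (\<Sum>\<^sub>\<infinity>q\<in>(UNIV::int set). exp (2 * of_real pi * \<i> * of_int q * z - of_real pi * (of_int q)\<^sup>2))"

text \<open>
  Point values of an element of \<open>L\<^sub>2\<close> are those of its continuous representative, which is
  unique when it exists.
\<close>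

definition continuous_rep :: "(real \<Rightarrow> complex) \<Rightarrow> (real \<Rightarrow> complex) \<Rightarrow> bool" where
  "continuous_rep f g \<longleftrightarrow> continuous_on UNIV g \<and> (AE x in lborel. g x = f x)"

definition cont_rep :: "(real \<Rightarrow> complex) \<Rightarrow> real \<Rightarrow> complex" where
  "cont_rep f = (THE g. continuous_rep f g)"

definition zak :: "(real \<Rightarrow> complex) \<Rightarrow> real \<Rightarrow> real \<Rightarrow> complex" where
  "zak f y \<xi> = (\<Sum>\<^sub>\<infinity>q\<in>(UNIV::int set).
     exp (2 * of_real pi * \<i> * of_int q * of_real \<xi>) * cont_rep f (y + of_int q))"

definition sharp_poisson :: "(real \<Rightarrow> complex) \<Rightarrow> complex" where
  "sharp_poisson f = zak f (1/2) (1/2) / (\<i> * Theta 0)"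

definition sharp_poisson_defined :: "(real \<Rightarrow> complex) \<Rightarrow> bool" where
  "sharp_poisson_defined f \<longleftrightarrow>
     (\<exists>g. continuous_rep f g) \<and>
     (\<lambda>q. (-1) powi q * cont_rep f (of_int q + 1/2)) summable_on (UNIV::int set)"

lemma sharp_poisson_eq:
  "sharp_poisson f =
     (\<Sum>\<^sub>\<infinity>q\<in>(UNIV::int set). (-1) powi q * cont_rep f (of_int q + 1/2)) / (\<i> * Theta 0)"
proof -
  have "exp (2 * of_real pi * \<i> * of_int q * of_real (1/2)) = (-1::complex) powi q" for q :: int
  proof -
    have "exp (of_int q * (of_real pi * \<i>)) = (exp (of_real pi * \<i>) :: complex) powi q"
      by (rule exp_power_int[symmetric])
    then show ?thesis by (simp add: mult_ac)
  qed
  then show ?thesis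
    unfolding sharp_poisson_def zak_def by (simp add: add.commute)
qed

text \<open>
  Unconditional convergence in \<open>L\<^sub>2\<close>, i.e. along the net of finite subsets of the index set
  (the library's \<open>has_sum\<close> is not available since functions carry no \<open>L\<^sub>2\<close> topology).
\<close>

definition L2_has_sum ::
    "('i \<Rightarrow> real \<Rightarrow> complex) \<Rightarrow> (real \<Rightarrow> complex) \<Rightarrow> 'i set \<Rightarrow> bool" where
  "L2_has_sum u f I \<longleftrightarrow>
     ((\<lambda>F. L2_norm (\<lambda>x. f x - (\<Sum>i\<in>F. u i x))) \<longlongrightarrow> 0) (finite_subsets_at_top I)"

end

theory Submission
  imports Defs "HOL-Probability.Probability"
begin

text \<open>
  For \<open>a < 2\<close> the sharp Poisson functional is not continuous, so that \<open>a \<ge> 2\<close>. Then the Gabor transform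
  of \<open>f \<in> H\<close> is integrable, and the inversion formula exhibits the Zak transform of \<open>f\<close> as a
  superposition of Zak transforms of Gabor functions; hence it is Hoelder continuous at \<open>(1/2, 1/2)\<close>,
  with exponent \<open>\<alpha> > 0\<close>. The Zak transform of the Gaussian has a simple zero there and no other zero in the
  unit square, and the Zak transforms of the other Gabor functions of the lattice are its products
  with the characters of the torus. The coefficient \<open>\<gamma>\<^sup>\<sharp>\<close> is chosen such that the Zak transform of
  \<open>f - \<gamma>\<^sup>\<sharp> e\<^sub>\<sharp>\<close> vanishes at \<open>(1/2, 1/2)\<close>; its quotient by the Zak transform of the Gaussian is
  \<open>O(r powr (\<alpha> - 1))\<close> at distance \<open>r\<close>, thus square integrable, and the remaining \<open>\<gamma>\<^sup>\<lambda>\<close> are its Fourier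
  coefficients. Convergence in \<open>L\<^sub>2\<close> is completeness of the characters together with isometry of the Zak
  transform.
\<close>

section \<open>Square-integrable functions and orthonormal systems\<close>

text \<open>The obstacle is the simple zero: \<open>1 / r\<close> just fails to be square integrable
  near a point of the plane, the divergence being logarithmic, so dividing by the Zak transform of
  the Gaussian is harmless once the numerator gains any power \<open>r powr \<alpha>\<close> with
  \<alpha> > 0. One additional coefficient suffices to make the numerator vanish there, and
  \<open>gabor sharp\<close> can serve since its own Zak transform takes the value
  \<open>\<i> * Theta 0\<close> at the zero; this is the origin of the normalisation of the sharp
  Poisson functional. The exponent \<alpha> is paid for by the surplus \<delta> - 2. The Zak
  transform of \<open>gabor \<mu>\<close> is Hoelder continuous at the zero with a constant of order
  \<open>(1 + norm \<mu>) powr \<alpha>\<close>, and Cauchy-Schwarz against the weight of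
  \<open>H_delta \<delta>\<close> makes the Gabor transform integrable against this constant when
  \<delta> - 2 \<alpha> > 2. The return to the real line costs only a constant factor, because the
  Zak transform of the Gaussian is bounded.\<close>

definition sq_integrable :: "'a measure \<Rightarrow> ('a \<Rightarrow> complex) \<Rightarrow> bool" where
  "sq_integrable M f \<longleftrightarrow> f \<in> borel_measurable M \<and> integrable M (\<lambda>x. (cmod (f x))\<^sup>2)"

lemma cnj_measurable [measurable (raw)]:
  "f \<in> borel_measurable M \<Longrightarrow> (\<lambda>x. cnj (f x)) \<in> borel_measurable M"
  by (rule measurable_compose[of f M borel]) (auto intro!: borel_measurable_continuous_onI continuous_intros)

lemma cmod_add_sq_le: "(cmod (a + b))\<^sup>2 \<le> 2 * (cmod a)\<^sup>2 + 2 * (cmod b)\<^sup>2"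
proof -
  have "(cmod (a + b))\<^sup>2 \<le> (cmod a + cmod b)\<^sup>2"
    by (intro power_mono norm_triangle_ineq) auto
  also have "\<dots> \<le> 2 * (cmod a)\<^sup>2 + 2 * (cmod b)\<^sup>2"
    using sum_squares_bound[of "cmod a" "cmod b"] by (simp add: power2_sum)
  finally show ?thesis .
qed

lemma cmod_diff_sq_le: "(cmod (a - b))\<^sup>2 \<le> 2 * (cmod a)\<^sup>2 + 2 * (cmod b)\<^sup>2"
  using cmod_add_sq_le[of a "-b"] by simp

lemma sq_integrable_measurable: "sq_integrable M f \<Longrightarrow> f \<in> borel_measurable M"
  by (simp add: sq_integrable_def)

lemma sq_integrable_integrable: "sq_integrable M f \<Longrightarrow> integrable M (\<lambda>x. (cmod (f x))\<^sup>2)"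
  by (simp add: sq_integrable_def)

lemma sq_integrable_cmult: "sq_integrable M f \<Longrightarrow> sq_integrable M (\<lambda>x. c * f x)"
  by (auto simp: sq_integrable_def norm_mult power_mult_distrib)

lemma sq_integrable_add:
  assumes "sq_integrable M f" "sq_integrable M g"
  shows "sq_integrable M (\<lambda>x. f x + g x)"
proof -
  have [measurable]: "f \<in> borel_measurable M" "g \<in> borel_measurable M"
    using assms by (auto simp: sq_integrable_def)
  have "integrable M (\<lambda>x. 2 * (cmod (f x))\<^sup>2 + 2 * (cmod (g x))\<^sup>2)"
    using assms by (auto simp: sq_integrable_def)
  then have "integrable M (\<lambda>x. (cmod (f x + g x))\<^sup>2)"
    by (rule Bochner_Integration.integrable_bound) (use cmod_add_sq_le in auto)
  then show ?thesis by (simp add: sq_integrable_def)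
qed

lemma sq_integrable_diff:
  assumes "sq_integrable M f" "sq_integrable M g"
  shows "sq_integrable M (\<lambda>x. f x - g x)"
  using sq_integrable_add[OF assms(1) sq_integrable_cmult[OF assms(2), of "-1"]] by simp

lemma sq_integrable_sum:
  assumes "\<And>i. i \<in> F \<Longrightarrow> sq_integrable M (f i)"
  shows "sq_integrable M (\<lambda>x. \<Sum>i\<in>F. f i x)"
  using assms
proof (induction F rule: infinite_finite_induct)
  case (insert i F)
  then show ?case by (auto intro!: sq_integrable_add)
qed (auto simp: sq_integrable_def)

lemma sq_integrable_mult_cnj:
  assumes "sq_integrable M f" "sq_integrable M g"
  shows "integrable M (\<lambda>x. f x * cnj (g x))"
proof -
  have [measurable]: "f \<in> borel_measurable M" "g \<in> borel_measurable M"
    using assms by (auto simp: sq_integrable_def)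
  have i: "integrable M (\<lambda>x. (cmod (f x))\<^sup>2 + (cmod (g x))\<^sup>2)"
    using assms by (auto simp: sq_integrable_def)
  have b: "norm (f x * cnj (g x)) \<le> norm ((cmod (f x))\<^sup>2 + (cmod (g x))\<^sup>2)" for x
  proof -
    have "cmod (f x) * cmod (g x) \<le> 2 * cmod (f x) * cmod (g x)" by simp
    also have "\<dots> \<le> (cmod (f x))\<^sup>2 + (cmod (g x))\<^sup>2"
      by (rule sum_squares_bound)
    finally show ?thesis by (simp add: norm_mult)
  qed
  show ?thesis
    by (rule Bochner_Integration.integrable_bound[OF i]) (use b in auto)
qed

lemma integral_sq_add_le:
  assumes "sq_integrable M f" "sq_integrable M g"
  shows "(LINT x|M. (cmod (f x + g x))\<^sup>2)
    \<le> 2 * (LINT x|M. (cmod (f x))\<^sup>2) + 2 * (LINT x|M. (cmod (g x))\<^sup>2)"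
proof -
  have i: "integrable M (\<lambda>x. (cmod (f x))\<^sup>2)" "integrable M (\<lambda>x. (cmod (g x))\<^sup>2)"
    using assms by (auto simp: sq_integrable_def)
  have "(LINT x|M. (cmod (f x + g x))\<^sup>2)
      \<le> (LINT x|M. 2 * (cmod (f x))\<^sup>2 + 2 * (cmod (g x))\<^sup>2)"
    using i sq_integrable_integrable[OF sq_integrable_add[OF assms]]
    by (intro integral_mono) (auto intro: cmod_add_sq_le)
  then show ?thesis using i by simp
qed

text \<open>Integrating \<open>2 * s * t * \<bar>f x * g x\<bar> \<le> s\<^sup>2 * (f x)\<^sup>2 +
  t\<^sup>2 * (g x)\<^sup>2\<close> and inserting \<open>s = sqrt B\<close>,
  \<open>t = sqrt A\<close> gives the inequality. If one of \<open>A\<close>, \<open>B\<close>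
  vanishes, letting its multiplier be large forces the left side to be 0.\<close>

lemma Cauchy_Schwarz_integral:
  fixes f g :: "'a \<Rightarrow> real"
  assumes [measurable]: "f \<in> borel_measurable M" "g \<in> borel_measurable M"
    and f: "integrable M (\<lambda>x. (f x)\<^sup>2)" and g: "integrable M (\<lambda>x. (g x)\<^sup>2)"
  shows "integrable M (\<lambda>x. f x * g x)"
    and "(LINT x|M. \<bar>f x * g x\<bar>)\<^sup>2 \<le> (LINT x|M. (f x)\<^sup>2) * (LINT x|M. (g x)\<^sup>2)"
proof -
  have b: "\<bar>f x * g x\<bar> \<le> (f x)\<^sup>2 + (g x)\<^sup>2" for x
    using sum_squares_bound[of "\<bar>f x\<bar>" "\<bar>g x\<bar>"] abs_ge_zero[of "f x * g x"]
    unfolding abs_mult power2_abs by linarith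
  show i: "integrable M (\<lambda>x. f x * g x)"
    by (rule Bochner_Integration.integrable_bound[OF Bochner_Integration.integrable_add[OF f g]])
       (use b in auto)
  define A B C where "A = (LINT x|M. (f x)\<^sup>2)" and "B = (LINT x|M. (g x)\<^sup>2)"
    and "C = (LINT x|M. \<bar>f x * g x\<bar>)"
  have A: "A \<ge> 0" and B: "B \<ge> 0" and C: "C \<ge> 0" unfolding A_def B_def C_def by auto
  have q: "2 * s * t * C \<le> s\<^sup>2 * A + t\<^sup>2 * B" if "s \<ge> 0" "t \<ge> 0" for s t
  proof -
    have "2 * s * t * C = (LINT x|M. 2 * s * t * \<bar>f x * g x\<bar>)"
      unfolding C_def by simp
    also have "\<dots> \<le> (LINT x|M. s\<^sup>2 * (f x)\<^sup>2 + t\<^sup>2 * (g x)\<^sup>2)"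
    proof (intro integral_mono)
      fix x show "2 * s * t * \<bar>f x * g x\<bar> \<le> s\<^sup>2 * (f x)\<^sup>2 + t\<^sup>2 * (g x)\<^sup>2"
        using sum_squares_bound[of "s * \<bar>f x\<bar>" "t * \<bar>g x\<bar>"]
        by (simp add: power_mult_distrib abs_mult mult_ac)
    qed (use f g i in auto)
    also have "\<dots> = s\<^sup>2 * A + t\<^sup>2 * B" unfolding A_def B_def using f g by simp
    finally show ?thesis .
  qed
  have "C\<^sup>2 \<le> A * B"
  proof (cases "A = 0 \<or> B = 0")
    case True
    have "C = 0"
    proof (rule ccontr)
      assume "C \<noteq> 0"
      then have c: "C > 0" using C by simp
      show False
      proof (cases "A = 0")
        case True
        have "2 * ((B + 1) / C) * 1 * C \<le> B" using q[of "(B+1)/C" 1] True c B by simp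
        then show False using c B by simp
      next
        case False
        then have "B = 0" using \<open>A = 0 \<or> B = 0\<close> by simp
        then have "2 * 1 * ((A + 1) / C) * C \<le> A" using q[of 1 "(A+1)/C"] c A by simp
        then show False using c A by simp
      qed
    qed
    then show ?thesis using A B by simp
  next
    case False
    then have ab: "A > 0" "B > 0" using A B by auto
    have "2 * sqrt B * sqrt A * C \<le> 2 * (A * B)" using q[of "sqrt B" "sqrt A"] ab by simp
    then have "sqrt (A * B) * C \<le> sqrt (A * B) * sqrt (A * B)"
      using ab by (simp add: real_sqrt_mult mult_ac)
    moreover have "sqrt (A * B) > 0" using ab by simp
    ultimately have "C \<le> sqrt (A * B)" by (rule mult_left_le_imp_le)
    then have "C\<^sup>2 \<le> (sqrt (A * B))\<^sup>2" using C by (intro power_mono) auto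
    then show ?thesis using ab by simp
  qed
  then show "(LINT x|M. \<bar>f x * g x\<bar>)\<^sup>2 \<le> (LINT x|M. (f x)\<^sup>2) * (LINT x|M. (g x)\<^sup>2)"
    unfolding A_def B_def C_def .
qed

section \<open>Bessel's inequality and the closed linear span of an orthonormal system\<close>

lemma (in finite_measure) sq_integrable_bounded:
  assumes [measurable]: "f \<in> borel_measurable M" and "\<And>x. cmod (f x) \<le> K"
  shows "sq_integrable M f"
  unfolding sq_integrable_def
proof (intro conjI assms integrable_const_bound[where B = "K\<^sup>2"])
  show "AE x in M. norm ((cmod (f x))\<^sup>2) \<le> K\<^sup>2"
    using assms(2) by (auto intro!: power_mono)
qed auto

text \<open>Instantiated by the characters of the interval and by those of the square. On a finite
  measure space the uniform bound already makes every \<open>\<phi> i\<close> square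
  integrable.\<close>

locale orthonormal_functions = finite_measure M for M :: "'a measure" +
  fixes \<phi> :: "'i \<Rightarrow> 'a \<Rightarrow> complex"
  assumes phi_measurable [measurable]: "\<And>i. \<phi> i \<in> borel_measurable M"
    and cmod_phi: "\<And>i x. cmod (\<phi> i x) \<le> 1"
    and phi_ortho: "\<And>i j. (LINT x|M. \<phi> i x * cnj (\<phi> j x)) = of_bool (i = j)"
begin

definition coef :: "('a \<Rightarrow> complex) \<Rightarrow> 'i \<Rightarrow> complex" where
  "coef u i = (LINT x|M. u x * cnj (\<phi> i x))"

text \<open>Membership in the closed linear span, in terms of functions and squared distances.
  Square integrability has to be demanded explicitly: the integral of a non-integrable function is 0
  by convention, so the distance condition alone would be satisfied by functions outside of the
  space.\<close>

definition approximable :: "('a \<Rightarrow> complex) \<Rightarrow> bool" where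
  "approximable u \<longleftrightarrow> sq_integrable M u \<and>
     (\<forall>\<epsilon>>0. \<exists>F c. finite F \<and> (LINT x|M. (cmod (u x - (\<Sum>i\<in>F. c i * \<phi> i x)))\<^sup>2) < \<epsilon>)"

lemma sq_integrable_phi: "sq_integrable M (\<phi> i)"
  by (rule sq_integrable_bounded[OF phi_measurable cmod_phi])

lemma sq_integrable_phi_sum: "sq_integrable M (\<lambda>x. \<Sum>i\<in>F. c i * \<phi> i x)"
  by (intro sq_integrable_sum sq_integrable_cmult sq_integrable_phi)

text \<open>Orthonormality reduces the expanded square to the coefficients, and completing the
  square in each \<open>c i\<close> does the rest. The identity yields Bessel's inequality
  (\<open>c\<close> the coefficients of \<open>u\<close>), the optimality of these coefficients
  (arbitrary \<open>c\<close>), and the finite Parseval formula (\<open>u\<close> zero).\<close>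

lemma integral_sq_diff_phi_sum:
  assumes u: "sq_integrable M u" and F: "finite F"
  shows "(LINT x|M. (cmod (u x - (\<Sum>i\<in>F. c i * \<phi> i x)))\<^sup>2) =
    (LINT x|M. (cmod (u x))\<^sup>2) - (\<Sum>i\<in>F. (cmod (coef u i))\<^sup>2) + (\<Sum>i\<in>F. (cmod (c i - coef u i))\<^sup>2)"
proof -
  define P where "P = (\<lambda>x. \<Sum>i\<in>F. c i * \<phi> i x)"
  have P: "sq_integrable M P" unfolding P_def by (rule sq_integrable_phi_sum)
  note I = sq_integrable_mult_cnj
  have e1: "(LINT x|M. v x * cnj (P x)) = (\<Sum>i\<in>F. cnj (c i) * coef v i)"
    if v: "sq_integrable M v" for v
  proof -
    have "(LINT x|M. v x * cnj (P x)) = (LINT x|M. (\<Sum>i\<in>F. cnj (c i) * (v x * cnj (\<phi> i x))))"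
      unfolding P_def by (simp add: sum_distrib_left mult_ac)
    also have "\<dots> = (\<Sum>i\<in>F. LINT x|M. cnj (c i) * (v x * cnj (\<phi> i x)))"
      by (intro Bochner_Integration.integral_sum integrable_mult_right I v sq_integrable_phi)
    finally show ?thesis by (simp add: coef_def)
  qed
  have e2: "coef P j = c j" if "j \<in> F" for j
  proof -
    have "coef P j = (LINT x|M. (\<Sum>i\<in>F. c i * (\<phi> i x * cnj (\<phi> j x))))"
      unfolding coef_def P_def by (simp add: sum_distrib_right mult.assoc)
    also have "\<dots> = (\<Sum>i\<in>F. LINT x|M. c i * (\<phi> i x * cnj (\<phi> j x)))"
      by (intro Bochner_Integration.integral_sum integrable_mult_right I sq_integrable_phi)
    also have "\<dots> = (\<Sum>i\<in>F. if i = j then c i else 0)"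
      by (intro sum.cong) (auto simp: phi_ortho)
    finally show ?thesis using F that by simp
  qed
  have e3: "(LINT x|M. P x * cnj (u x)) = (\<Sum>i\<in>F. c i * cnj (coef u i))"
  proof -
    have "(LINT x|M. P x * cnj (u x)) = cnj (LINT x|M. u x * cnj (P x))"
      unfolding Bochner_Integration.integral_cnj[symmetric] by (simp add: mult.commute)
    then show ?thesis by (simp add: e1[OF u])
  qed
  have e4: "(LINT x|M. v x * cnj (v x)) = of_real (LINT x|M. (cmod (v x))\<^sup>2)" for v
    by (simp only: complex_norm_square[symmetric] integral_complex_of_real)
  have e5: "(\<Sum>i\<in>F. (c i - coef u i) * cnj (c i - coef u i)) = (\<Sum>i\<in>F. cnj (c i) * c i)
     - (\<Sum>i\<in>F. c i * cnj (coef u i)) - (\<Sum>i\<in>F. cnj (c i) * coef u i) + (\<Sum>i\<in>F. coef u i * cnj (coef u i))"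
    by (simp add: sum.distrib[symmetric] sum_subtractf[symmetric] algebra_simps)
  have "complex_of_real (LINT x|M. (cmod (u x - P x))\<^sup>2)
      = (LINT x|M. (u x - P x) * cnj (u x - P x))" by (rule e4[symmetric])
  also have "\<dots> = (LINT x|M. (u x * cnj (u x) - u x * cnj (P x)) - (P x * cnj (u x) - P x * cnj (P x)))"
    by (simp add: algebra_simps)
  also have "\<dots> = ((LINT x|M. u x * cnj (u x)) - (LINT x|M. u x * cnj (P x)))
      - ((LINT x|M. P x * cnj (u x)) - (LINT x|M. P x * cnj (P x)))"
    by (simp add: I u P)
  also have "\<dots> = of_real (LINT x|M. (cmod (u x))\<^sup>2) - (\<Sum>i\<in>F. cnj (c i) * coef u i)
      - ((\<Sum>i\<in>F. c i * cnj (coef u i)) - (\<Sum>i\<in>F. cnj (c i) * c i))"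
    using e2 by (simp add: e1[OF P] e1[OF u] e3 e4)
  also have "\<dots> =
     of_real ((LINT x|M. (cmod (u x))\<^sup>2) - (\<Sum>i\<in>F. (cmod (coef u i))\<^sup>2) + (\<Sum>i\<in>F. (cmod (c i - coef u i))\<^sup>2))"
    unfolding of_real_add of_real_diff of_real_sum complex_norm_square e5 by simp
  finally show ?thesis unfolding P_def by (simp only: of_real_eq_iff)
qed

lemma Bessel:
  assumes "sq_integrable M u" "finite F"
  shows "(\<Sum>i\<in>F. (cmod (coef u i))\<^sup>2) \<le> (LINT x|M. (cmod (u x))\<^sup>2)"
proof -
  have "0 \<le> (LINT x|M. (cmod (u x - (\<Sum>i\<in>F. coef u i * \<phi> i x)))\<^sup>2)" by simp
  also have "\<dots> = (LINT x|M. (cmod (u x))\<^sup>2) - (\<Sum>i\<in>F. (cmod (coef u i))\<^sup>2)"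
    by (subst integral_sq_diff_phi_sum[OF assms]) simp
  finally show ?thesis by simp
qed

text \<open>If some combination over \<open>F0\<close> is close, the one with the Fourier
  coefficients is at least as close, and enlarging the index set only subtracts further squares.
  Hence convergence along the net of finite index sets, which is what \<open>L2_has_sum\<close> asks
  for.\<close>

lemma approximable_expansion:
  assumes u: "approximable u" and "\<epsilon> > 0"
  shows "\<exists>F0. finite F0 \<and> (\<forall>F. finite F \<longrightarrow> F0 \<subseteq> F \<longrightarrow>
    (LINT x|M. (cmod (u x - (\<Sum>i\<in>F. coef u i * \<phi> i x)))\<^sup>2) < \<epsilon>)"
proof -
  have s: "sq_integrable M u" using u by (simp add: approximable_def)
  obtain F0 c where F0: "finite F0" and c: "(LINT x|M. (cmod (u x - (\<Sum>i\<in>F0. c i * \<phi> i x)))\<^sup>2) < \<epsilon>"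
    using u \<open>\<epsilon> > 0\<close> unfolding approximable_def by blast
  have "(LINT x|M. (cmod (u x - (\<Sum>i\<in>F. coef u i * \<phi> i x)))\<^sup>2) < \<epsilon>"
    if F: "finite F" "F0 \<subseteq> F" for F
  proof -
    have "(LINT x|M. (cmod (u x - (\<Sum>i\<in>F. coef u i * \<phi> i x)))\<^sup>2)
       = (LINT x|M. (cmod (u x))\<^sup>2) - (\<Sum>i\<in>F. (cmod (coef u i))\<^sup>2)"
      by (subst integral_sq_diff_phi_sum[OF s F(1)]) simp
    also have "\<dots> \<le> (LINT x|M. (cmod (u x))\<^sup>2) - (\<Sum>i\<in>F0. (cmod (coef u i))\<^sup>2)"
      using F by (simp add: sum_mono2)
    also have "\<dots> \<le> (LINT x|M. (cmod (u x - (\<Sum>i\<in>F0. c i * \<phi> i x)))\<^sup>2)"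
      by (subst integral_sq_diff_phi_sum[OF s F0]) (simp add: sum_nonneg)
    finally show ?thesis using c by simp
  qed
  then show ?thesis using F0 by blast
qed

lemma approximable_limit:
  assumes u: "sq_integrable M u"
    and lim: "\<And>\<epsilon>. \<epsilon> > 0 \<Longrightarrow> \<exists>v. approximable v \<and> (LINT x|M. (cmod (u x - v x))\<^sup>2) < \<epsilon>"
  shows "approximable u"
  unfolding approximable_def
proof (intro conjI u allI impI)
  fix \<epsilon> :: real assume "\<epsilon> > 0"
  then obtain v where v: "approximable v" "(LINT x|M. (cmod (u x - v x))\<^sup>2) < \<epsilon> / 4"
    using lim[of "\<epsilon> / 4"] by auto
  have sv: "sq_integrable M v" using v by (simp add: approximable_def)
  obtain F c where F: "finite F" "(LINT x|M. (cmod (v x - (\<Sum>i\<in>F. c i * \<phi> i x)))\<^sup>2) < \<epsilon> / 4"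
    using v(1) \<open>\<epsilon> > 0\<close> unfolding approximable_def by (meson divide_pos_pos zero_less_numeral)
  have "(LINT x|M. (cmod ((u x - v x) + (v x - (\<Sum>i\<in>F. c i * \<phi> i x))))\<^sup>2)
    \<le> 2 * (LINT x|M. (cmod (u x - v x))\<^sup>2) + 2 * (LINT x|M. (cmod (v x - (\<Sum>i\<in>F. c i * \<phi> i x)))\<^sup>2)"
    by (intro integral_sq_add_le sq_integrable_diff u sv sq_integrable_phi_sum)
  then have "(LINT x|M. (cmod (u x - (\<Sum>i\<in>F. c i * \<phi> i x)))\<^sup>2) < \<epsilon>"
    using v F by simp
  then show "\<exists>F c. finite F \<and> (LINT x|M. (cmod (u x - (\<Sum>i\<in>F. c i * \<phi> i x)))\<^sup>2) < \<epsilon>"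
    using F by blast
qed

lemma approximable_phi_sum: "finite F \<Longrightarrow> approximable (\<lambda>x. \<Sum>i\<in>F. c i * \<phi> i x)"
  unfolding approximable_def using sq_integrable_phi_sum
  by (intro conjI allI impI exI[of _ F] exI[of _ c]) auto

lemma approximable_add:
  assumes u: "approximable u" and v: "approximable v"
  shows "approximable (\<lambda>x. u x + v x)"
proof -
  have s: "sq_integrable M u" "sq_integrable M v" using u v by (auto simp: approximable_def)
  show ?thesis unfolding approximable_def
  proof (intro conjI allI impI)
    show "sq_integrable M (\<lambda>x. u x + v x)" by (intro sq_integrable_add s)
    fix \<epsilon> :: real assume e: "\<epsilon> > 0"
    obtain F where F: "finite F" "\<And>G. finite G \<Longrightarrow> F \<subseteq> G \<Longrightarrow>
      (LINT x|M. (cmod (u x - (\<Sum>i\<in>G. coef u i * \<phi> i x)))\<^sup>2) < \<epsilon> / 4"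
      using approximable_expansion[OF u, of "\<epsilon>/4"] e by auto
    obtain F' where F': "finite F'" "\<And>G. finite G \<Longrightarrow> F' \<subseteq> G \<Longrightarrow>
      (LINT x|M. (cmod (v x - (\<Sum>i\<in>G. coef v i * \<phi> i x)))\<^sup>2) < \<epsilon> / 4"
      using approximable_expansion[OF v, of "\<epsilon>/4"] e by auto
    \<comment> \<open>The expansions are accurate on every larger index set, so that one set serves
      both summands.\<close>
    define G where "G = F \<union> F'"
    have G: "finite G" "F \<subseteq> G" "F' \<subseteq> G" using F F' by (auto simp: G_def)
    have "(LINT x|M. (cmod ((u x - (\<Sum>i\<in>G. coef u i * \<phi> i x)) + (v x - (\<Sum>i\<in>G. coef v i * \<phi> i x))))\<^sup>2)
      \<le> 2 * (LINT x|M. (cmod (u x - (\<Sum>i\<in>G. coef u i * \<phi> i x)))\<^sup>2)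
        + 2 * (LINT x|M. (cmod (v x - (\<Sum>i\<in>G. coef v i * \<phi> i x)))\<^sup>2)"
      by (intro integral_sq_add_le sq_integrable_diff s sq_integrable_phi_sum)
    also have "\<dots> < \<epsilon>" using F(2)[OF G(1,2)] F'(2)[OF G(1,3)] by simp
    finally have "(LINT x|M. (cmod (u x + v x - (\<Sum>i\<in>G. (coef u i + coef v i) * \<phi> i x)))\<^sup>2) < \<epsilon>"
      by (simp add: algebra_simps sum.distrib)
    then show "\<exists>F c. finite F \<and> (LINT x|M. (cmod (u x + v x - (\<Sum>i\<in>F. c i * \<phi> i x)))\<^sup>2) < \<epsilon>"
      using G(1) by (intro exI[of _ G] exI[of _ "\<lambda>i. coef u i + coef v i"] conjI)
  qed
qed

lemma approximable_cmult:
  assumes u: "approximable u"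
  shows "approximable (\<lambda>x. k * u x)"
proof (cases "k = 0")
  case True
  then show ?thesis using approximable_phi_sum[of "{}"] by simp
next
  case False
  show ?thesis unfolding approximable_def
  proof (intro conjI allI impI)
    show "sq_integrable M (\<lambda>x. k * u x)"
      using u by (auto simp: approximable_def intro: sq_integrable_cmult)
    fix \<epsilon> :: real assume e: "\<epsilon> > 0"
    have "\<epsilon> / (cmod k)\<^sup>2 > 0" using e False by simp
    then obtain F c where F: "finite F"
      "(LINT x|M. (cmod (u x - (\<Sum>i\<in>F. c i * \<phi> i x)))\<^sup>2) < \<epsilon> / (cmod k)\<^sup>2"
      using u unfolding approximable_def by blast
    have "(LINT x|M. (cmod (k * u x - (\<Sum>i\<in>F. (k * c i) * \<phi> i x)))\<^sup>2)
      = (LINT x|M. (cmod k)\<^sup>2 * (cmod (u x - (\<Sum>i\<in>F. c i * \<phi> i x)))\<^sup>2)"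
      by (simp add: power_mult_distrib[symmetric] norm_mult[symmetric] algebra_simps sum_distrib_left)
    also have "\<dots> < \<epsilon>" using F(2) False by (simp add: field_simps)
    finally show "\<exists>F c. finite F \<and> (LINT x|M. (cmod (k * u x - (\<Sum>i\<in>F. c i * \<phi> i x)))\<^sup>2) < \<epsilon>"
      using F(1) by (intro exI[of _ F] exI[of _ "\<lambda>i. k * c i"]) auto
  qed
qed

lemma approximable_sum:
  assumes "\<And>j. j \<in> J \<Longrightarrow> approximable (f j)"
  shows "approximable (\<lambda>x. \<Sum>j\<in>J. f j x)"
  using assms
proof (induction J rule: infinite_finite_induct)
  case (insert j J)
  then show ?case by (auto intro!: approximable_add)
qed (use approximable_phi_sum[of "{}"] in auto)

lemma approximable_AE_cong:
  assumes u: "approximable u" and [measurable]: "v \<in> borel_measurable M" and ae: "AE x in M. u x = v x"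
  shows "approximable v"
proof (rule approximable_limit)
  have [measurable]: "u \<in> borel_measurable M" using u by (simp add: approximable_def sq_integrable_def)
  have "integrable M (\<lambda>x. (cmod (u x))\<^sup>2)" using u by (simp add: approximable_def sq_integrable_def)
  then have "integrable M (\<lambda>x. (cmod (v x))\<^sup>2)"
    by (rule integrable_cong_AE_imp) (use ae in auto)
  then show "sq_integrable M v" by (simp add: sq_integrable_def)
  fix \<epsilon> :: real assume "\<epsilon> > 0"
  have "(LINT x|M. (cmod (v x - u x))\<^sup>2) = (LINT x|M. 0)"
    by (rule integral_cong_AE) (use ae in auto)
  then show "\<exists>w. approximable w \<and> (LINT x|M. (cmod (v x - w x))\<^sup>2) < \<epsilon>"
    using u \<open>\<epsilon> > 0\<close> by (intro exI[of _ u]) auto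
qed

text \<open>Dominated convergence for the squared distances. The majorant bounds
  \<open>u - v n\<close> rather than \<open>v n\<close>, so that square integrability of
  \<open>u\<close> itself follows from the case \<open>n = 0\<close>.\<close>

lemma approximable_pointwise_limit:
  fixes v :: "nat \<Rightarrow> 'a \<Rightarrow> complex"
  assumes v: "\<And>n. approximable (v n)" and [measurable]: "u \<in> borel_measurable M"
    and w: "integrable M w" and dom: "\<And>n x. x \<in> space M \<Longrightarrow> (cmod (u x - v n x))\<^sup>2 \<le> w x"
    and lim: "\<And>x. x \<in> space M \<Longrightarrow> (\<lambda>n. v n x) \<longlonglongrightarrow> u x"
  shows "approximable u"
proof (rule approximable_limit)
  have [measurable]: "v n \<in> borel_measurable M" for n
    using v by (simp add: approximable_def sq_integrable_def)
  have "integrable M (\<lambda>x. (cmod (u x - v 0 x))\<^sup>2)"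
    by (rule Bochner_Integration.integrable_bound[OF w]) (use dom[of _ 0] in \<open>auto intro!: AE_I2 intro: order_trans[OF _ abs_ge_self]\<close>)
  then have "sq_integrable M (\<lambda>x. u x - v 0 x)" by (simp add: sq_integrable_def)
  from sq_integrable_add[OF this, of "v 0"] v show "sq_integrable M u"
    by (simp add: approximable_def)
  fix \<epsilon> :: real assume "\<epsilon> > 0"
  have "(\<lambda>n. LINT x|M. (cmod (u x - v n x))\<^sup>2) \<longlonglongrightarrow> (LINT x|M. 0)"
  proof (rule integral_dominated_convergence[where w = w])
    show "AE x in M. (\<lambda>n. (cmod (u x - v n x))\<^sup>2) \<longlonglongrightarrow> 0"
    proof (rule AE_I2)
      fix x assume "x \<in> space M"
      have "(\<lambda>n. (cmod (u x - v n x))\<^sup>2) \<longlonglongrightarrow> (cmod (u x - u x))\<^sup>2"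
        by (intro tendsto_intros lim \<open>x \<in> space M\<close>)
      then show "(\<lambda>n. (cmod (u x - v n x))\<^sup>2) \<longlonglongrightarrow> 0" by simp
    qed
  qed (use w dom in auto)
  then have "eventually (\<lambda>n. (LINT x|M. (cmod (u x - v n x))\<^sup>2) < \<epsilon>) sequentially"
    using \<open>\<epsilon> > 0\<close> by (intro order_tendstoD(2)) auto
  then obtain n where "(LINT x|M. (cmod (u x - v n x))\<^sup>2) < \<epsilon>"
    by (auto simp: eventually_sequentially)
  then show "\<exists>w. approximable w \<and> (LINT x|M. (cmod (u x - w x))\<^sup>2) < \<epsilon>" using v by blast
qed

text \<open>The sets with approximable indicator are closed under complements, by linearity and
  \<open>one\<close>, and under disjoint countable unions, by dominated convergence. Since the
  generator is stable under intersection, Dynkin's theorem applies.\<close>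

lemma approximable_indicator:
  assumes G: "Int_stable G" "G \<subseteq> Pow (space M)" "sets M = sigma_sets (space M) G"
    and one: "approximable (\<lambda>x. 1)"
    and gen: "\<And>A. A \<in> G \<Longrightarrow> approximable (indicator A)"
    and A: "A \<in> sets M"
  shows "approximable (indicator A)"
proof -
  have "A \<in> sigma_sets (space M) G" using A G(3) by simp
  with G(1,2) show ?thesis
  proof (induction rule: sigma_sets_induct_disjoint)
    case (basic A)
    then show ?case by (rule gen)
  next
    case empty
    then show ?case using approximable_phi_sum[of "{}"] by (simp add: indicator_def)
  next
    case (compl A)
    have [measurable]: "A \<in> sets M" using compl G(3) by simp
    have "approximable (\<lambda>x. 1 + (-1) * indicator A x)"
      by (intro approximable_add approximable_cmult one compl)
    then show ?case
      by (rule approximable_AE_cong) (auto simp: indicator_def intro!: AE_I2 split: if_splits)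
  next
    case (union A)
    have [measurable]: "A i \<in> sets M" for i using union(2) G(3) by auto
    have e: "(\<Sum>i<n. indicator (A i) x) = (indicator (\<Union>i<n. A i) x :: complex)" for n x
      by (rule indicator_UN_disjoint[symmetric]) (use union(1) in \<open>auto intro: disjoint_family_on_mono\<close>)
    show ?case
    proof (rule approximable_pointwise_limit[where v = "\<lambda>n x. indicator (\<Union>i<n. A i) x" and w = "\<lambda>x. 4"])
      show "approximable (indicator (\<Union>i<n. A i))" for n
        using approximable_sum[of "{..<n}" "\<lambda>i. indicator (A i)"] union(3) unfolding e by simp
      show "(\<lambda>n. indicator (\<Union>i<n. A i) x) \<longlonglongrightarrow> (indicator (\<Union>i. A i) x :: complex)" for x
        by (rule LIMSEQ_indicator_UN)
      show "(cmod (indicator (\<Union>i. A i) x - indicator (\<Union>i<n. A i) x))\<^sup>2 \<le> 4" for n x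
        by (auto simp: indicator_def)
    qed auto
  qed
qed

lemma approximable_sq_integrable:
  assumes ind: "\<And>A. A \<in> sets M \<Longrightarrow> approximable (indicator A)"
    and u: "sq_integrable M u"
  shows "approximable u"
proof -
  have um: "u \<in> borel_measurable M" using u by (simp add: sq_integrable_def)
  obtain s where s: "\<And>i. simple_function M (s i)"
      "\<And>x. x \<in> space M \<Longrightarrow> (\<lambda>i. s i x) \<longlonglongrightarrow> u x"
      "\<And>i x. x \<in> space M \<Longrightarrow> dist (s i x) 0 \<le> 2 * dist (u x) 0"
    using borel_measurable_implies_sequence_metric[OF um, of 0] by blast
  \<comment> \<open>The simple functions satisfy \<open>cmod (s i x) \<le> 2 * cmod (u x)\<close>,
    whence the majorant: 10 = 2 + 2 * 4.\<close>
  show ?thesis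
  proof (rule approximable_pointwise_limit[where v = s and w = "\<lambda>x. 10 * (cmod (u x))\<^sup>2"])
    fix i
    have "approximable (\<lambda>x. \<Sum>y\<in>s i ` space M. y * indicator (s i -` {y} \<inter> space M) x)"
      by (intro approximable_sum approximable_cmult ind simple_functionD(2)[OF s(1)])
    then show "approximable (s i)"
    proof (rule approximable_AE_cong)
      show "s i \<in> borel_measurable M" using s(1) by (rule borel_measurable_simple_function)
      show "AE x in M. (\<Sum>y\<in>s i ` space M. y * indicator (s i -` {y} \<inter> space M) x) = s i x"
      proof (rule AE_I2)
        fix x assume "x \<in> space M"
        then have "(\<Sum>y\<in>s i ` space M. y * indicator (s i -` {y} \<inter> space M) x)
          = (\<Sum>y\<in>s i ` space M. if y = s i x then y else 0)"
          by (intro sum.cong) (auto simp: indicator_def)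
        also have "\<dots> = s i x" using simple_functionD(1)[OF s(1)] \<open>x \<in> space M\<close> by simp
        finally show "(\<Sum>y\<in>s i ` space M. y * indicator (s i -` {y} \<inter> space M) x) = s i x" .
      qed
    qed
  next
    fix i x assume x: "x \<in> space M"
    have "(cmod (u x - s i x))\<^sup>2 \<le> 2 * (cmod (u x))\<^sup>2 + 2 * (cmod (s i x))\<^sup>2" by (rule cmod_diff_sq_le)
    also have "(cmod (s i x))\<^sup>2 \<le> (2 * cmod (u x))\<^sup>2" using s(3)[OF x] by (intro power_mono) auto
    finally show "(cmod (u x - s i x))\<^sup>2 \<le> 10 * (cmod (u x))\<^sup>2" by (simp add: power_mult_distrib)
  qed (use s u um in \<open>auto simp: sq_integrable_def\<close>)
qed

end

section \<open>Completeness of the trigonometric system on the unit square\<close>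

definition unit_measure :: "real measure" where
  "unit_measure = density lborel (indicator {0..1})"

lemma sets_unit_measure [simp, measurable_cong]: "sets unit_measure = sets borel"
  by (simp add: unit_measure_def)

lemma space_unit_measure [simp]: "space unit_measure = UNIV"
  by (simp add: unit_measure_def)

lemma unit_measure_alt: "unit_measure = density lborel (\<lambda>x. ennreal (indicator {0..1} x))"
  by (simp add: unit_measure_def ennreal_indicator)

lemma integral_unit_measure:
  fixes f :: "real \<Rightarrow> 'b::{banach, second_countable_topology}"
  assumes "f \<in> borel_measurable borel"
  shows "integral\<^sup>L unit_measure f = (LINT x|lborel. indicator {0..1} x *\<^sub>R f x)"
  unfolding unit_measure_alt by (rule integral_density) (use assms in auto)

lemma nn_integral_unit_measure:
  assumes [measurable]: "f \<in> borel_measurable borel"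
  shows "integral\<^sup>N unit_measure f = (\<integral>\<^sup>+x. indicator {0..1} x * f x \<partial>lborel)"
  unfolding unit_measure_def by (rule nn_integral_density) auto

lemma AE_unit_measure: "(AE x in unit_measure. P x) \<longleftrightarrow> (AE x in lborel. x \<in> {0..1} \<longrightarrow> P x)"
  unfolding unit_measure_def by (subst AE_density) (auto simp: indicator_def)

lemma AE_unit_measure_mem: "AE x in unit_measure. x \<in> {0..1}"
  by (simp add: AE_unit_measure)

interpretation unit_measure: prob_space unit_measure
proof
  show "emeasure unit_measure (space unit_measure) = 1"
    unfolding unit_measure_def by (subst emeasure_density) (auto simp: nn_integral_indicator)
qed

definition fourier_char :: "int \<Rightarrow> real \<Rightarrow> complex" where
  "fourier_char n x = cis (2 * pi * of_int n * x)"

lemma fourier_char_measurable [measurable]: "fourier_char n \<in> borel_measurable borel"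
  unfolding fourier_char_def by (intro borel_measurable_continuous_onI continuous_intros)

lemma cmod_fourier_char [simp]: "cmod (fourier_char n x) = 1"
  by (simp add: fourier_char_def)

lemma fourier_char_0 [simp]: "fourier_char 0 = (\<lambda>x. 1)"
  by (auto simp: fourier_char_def)

lemma fourier_char_mult_cnj: "fourier_char n x * cnj (fourier_char m x) = fourier_char (n - m) x"
  by (simp add: fourier_char_def cis_cnj cis_mult algebra_simps)

lemma fourier_char_of_int [simp]: "fourier_char n (of_int m) = 1"
  using cis_multiple_2pi[of "of_int (n * m)"] by (simp add: fourier_char_def mult_ac)

lemma fourier_char_add: "fourier_char n (x + y) = fourier_char n x * fourier_char n y"
  by (simp add: fourier_char_def cis_mult algebra_simps)

lemma has_vector_derivative_fourier_char:
  "(fourier_char n has_vector_derivative (2 * pi * of_int n * \<i>) * fourier_char n x) (at x within S)"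
proof -
  have "fourier_char n = (\<lambda>x. exp (\<i> * of_real (2 * pi * of_int n * x)))"
    by (auto simp: fourier_char_def cis_conv_exp)
  then show ?thesis
    by (auto intro!: derivative_eq_intros has_vector_derivative_real_field)
qed

lemma continuous_on_fourier_char [continuous_intros]: "continuous_on S (fourier_char n)"
  unfolding fourier_char_def by (intro continuous_intros)

lemma integral_fourier_char: "integral\<^sup>L unit_measure (fourier_char n) = of_bool (n = 0)"
proof (cases "n = 0")
  case True
  then show ?thesis using unit_measure.prob_space by simp
next
  case False
  let ?c = "2 * pi * of_int n * \<i>"
  have c: "?c \<noteq> 0" using False by simp
  have "(LINT x|lborel. indicator {0..1} x *\<^sub>R fourier_char n x)
     = fourier_char n 1 / ?c - fourier_char n 0 / ?c"
  proof (rule integral_FTC_Icc)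
    fix x :: real
    have "((\<lambda>x. fourier_char n x / ?c) has_vector_derivative (?c * fourier_char n x) / ?c) (at x within {0..1})"
      by (intro has_vector_derivative_divide has_vector_derivative_fourier_char)
    then show "((\<lambda>x. fourier_char n x / ?c) has_vector_derivative fourier_char n x) (at x within {0..1})"
      using c by simp
  qed (auto intro: continuous_intros)
  also have "\<dots> = 0" using fourier_char_of_int[of n 1] fourier_char_of_int[of n 0] by simp
  finally show ?thesis using False by (simp add: integral_unit_measure)
qed

interpretation fourier: orthonormal_functions unit_measure fourier_char
proof
  show "(LINT x|unit_measure. fourier_char i x * cnj (fourier_char j x)) = of_bool (i = j)" for i j
    by (simp add: fourier_char_mult_cnj integral_fourier_char)
qed auto

text \<open>Integration by parts; the integrated character vanishes, and what remains is the
  boundary term, produced by the jump of height 1 of the periodic sawtooth. It is the only function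
  whose Fourier coefficients enter the completeness proof.\<close>

lemma coef_sawtooth:
  assumes "n \<noteq> 0"
  shows "fourier.coef (\<lambda>x. complex_of_real (x - 1/2)) n = \<i> / (2 * pi * of_int n)"
proof -
  let ?c = "2 * pi * of_int (-n) * \<i>"
  have c: "?c \<noteq> 0" using assms by simp
  let ?F = "\<lambda>x. complex_of_real (x - 1/2) * (fourier_char (-n) x / ?c) - fourier_char (-n) x / ?c / ?c"
  have e: "cnj (fourier_char n x) = fourier_char (-n) x" for x
    using fourier_char_mult_cnj[of 0 x n] by simp
  have "(LINT x|lborel. indicator {0..1} x *\<^sub>R (complex_of_real (x - 1/2) * fourier_char (-n) x))
     = ?F 1 - ?F 0"
  proof (rule integral_FTC_Icc)
    fix x :: real
    have d: "((\<lambda>x. fourier_char (-n) x / ?c) has_vector_derivative (?c * fourier_char (-n) x) / ?c) (at x within {0..1})"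
      by (intro has_vector_derivative_divide has_vector_derivative_fourier_char)
    have "(?F has_vector_derivative (complex_of_real (x - 1/2) * ((?c * fourier_char (-n) x) / ?c)
        + 1 * (fourier_char (-n) x / ?c)) - (?c * fourier_char (-n) x) / ?c / ?c) (at x within {0..1})"
      by (intro has_vector_derivative_diff has_vector_derivative_mult d has_vector_derivative_divide)
         (auto intro!: derivative_eq_intros)
    also have "(complex_of_real (x - 1/2) * ((?c * fourier_char (-n) x) / ?c)
        + 1 * (fourier_char (-n) x / ?c)) - (?c * fourier_char (-n) x) / ?c / ?c
        = complex_of_real (x - 1/2) * fourier_char (-n) x" using c by simp
    finally show "(?F has_vector_derivative complex_of_real (x - 1/2) * fourier_char (-n) x) (at x within {0..1})" .
  qed (auto intro!: continuous_intros)
  also have "\<dots> = 1 / ?c" using fourier_char_of_int[of "-n" 1] fourier_char_of_int[of "-n" 0]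
    by (simp add: field_simps)
  also have "\<dots> = \<i> / (2 * pi * of_int n)" using assms by (simp add: field_simps)
  finally show ?thesis unfolding fourier.coef_def e
    by (subst integral_unit_measure) auto
qed

lemma integral_sq_sawtooth: "(LINT x|unit_measure. (cmod (complex_of_real (x - 1/2)))\<^sup>2) = 1/12"
proof -
  have "(LINT x|lborel. indicator {0..1} x *\<^sub>R (x - 1/2)\<^sup>2) = (1 - 1/2)^3/3 - (0 - 1/2)^3/(3::real)"
  proof (rule integral_FTC_Icc)
    fix x :: real
    have "((\<lambda>x::real. (x - 1/2)^3/3) has_real_derivative (x - 1/2)\<^sup>2) (at x within {0..1})"
      by (auto intro!: derivative_eq_intros)
    then show "((\<lambda>x::real. (x - 1/2)^3/3) has_vector_derivative (x - 1/2)\<^sup>2) (at x within {0..1})"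
      by (rule has_real_derivative_iff_has_vector_derivative[THEN iffD1])
  qed (auto intro!: continuous_intros)
  also have "\<dots> = 1/12" by (simp add: power3_eq_cube)
  finally show ?thesis
    by (subst integral_unit_measure) (auto simp del: of_real_diff)
qed

text \<open>Parseval's equation can be verified by hand here: the squares
  \<open>1 / (4 * pi\<^sup>2 * n\<^sup>2)\<close> over all non-zero integers \<open>n\<close> add
  up, by the value \<open>pi\<^sup>2 / 6\<close> of the sum of inverse squares, to 1/12, which is
  the squared norm of the sawtooth.\<close>

lemma approximable_sawtooth: "fourier.approximable (\<lambda>x. complex_of_real (x - 1/2))"
  unfolding fourier.approximable_def
proof (intro conjI allI impI)
  let ?s = "\<lambda>x. complex_of_real (x - 1/2)"
  have "integrable unit_measure (\<lambda>x. (cmod (?s x))\<^sup>2)"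
  proof (rule unit_measure.integrable_const_bound[where B = "1"])
    show "AE x in unit_measure. norm ((cmod (?s x))\<^sup>2) \<le> 1"
      using AE_unit_measure_mem
    proof eventually_elim
      case (elim x)
      then have "\<bar>x - 1/2\<bar> ^ 2 \<le> 1 ^ 2" by (intro power_mono) (auto simp: abs_if)
      then show ?case by (simp del: of_real_diff)
    qed
  qed auto
  then show sq: "sq_integrable unit_measure ?s" by (simp add: sq_integrable_def)
  fix \<epsilon> :: real assume "\<epsilon> > 0"
  define A where "A = (\<lambda>N::nat. int ` {1..N})"
  define B where "B = (\<lambda>N::nat. (\<lambda>k. - int k) ` {1..N})"
  have fin: "finite (A N \<union> B N)" for N by (simp add: A_def B_def)
  have "(LINT x|unit_measure. (cmod (?s x - (\<Sum>i\<in>A N \<union> B N. fourier.coef ?s i * fourier_char i x)))\<^sup>2)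
     = 1/12 - (1 / (2 * pi\<^sup>2)) * (\<Sum>k<N. 1 / (real k + 1)\<^sup>2)" for N
  proof -
    have c: "(cmod (fourier.coef ?s i))\<^sup>2 = 1 / (4 * pi\<^sup>2 * (real_of_int i)\<^sup>2)" if "i \<noteq> 0" for i
      unfolding coef_sawtooth[OF that] by (simp add: norm_divide norm_mult power_divide power_mult_distrib)
    have "(\<Sum>i\<in>A N \<union> B N. (cmod (fourier.coef ?s i))\<^sup>2)
       = (\<Sum>i\<in>A N. (cmod (fourier.coef ?s i))\<^sup>2) + (\<Sum>i\<in>B N. (cmod (fourier.coef ?s i))\<^sup>2)"
      by (rule sum.union_disjoint) (auto simp: A_def B_def)
    also have "(\<Sum>i\<in>A N. (cmod (fourier.coef ?s i))\<^sup>2) = (\<Sum>k\<in>{1..N}. 1 / (4 * pi\<^sup>2 * (real k)\<^sup>2))"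
      unfolding A_def by (subst sum.reindex) (auto simp: inj_on_def c simp del: of_real_diff intro!: sum.cong)
    also have "(\<Sum>i\<in>B N. (cmod (fourier.coef ?s i))\<^sup>2) = (\<Sum>k\<in>{1..N}. 1 / (4 * pi\<^sup>2 * (real k)\<^sup>2))"
      unfolding B_def by (subst sum.reindex) (auto simp: inj_on_def c simp del: of_real_diff intro!: sum.cong)
    also have "(\<Sum>k\<in>{1..N}. 1 / (4 * pi\<^sup>2 * (real k)\<^sup>2)) = (\<Sum>k<N. 1 / (4 * pi\<^sup>2 * (real k + 1)\<^sup>2))"
      by (intro sum.reindex_bij_witness[of _ Suc "\<lambda>k. k - 1"]) auto
    finally have "(\<Sum>i\<in>A N \<union> B N. (cmod (fourier.coef ?s i))\<^sup>2) = (1 / (2 * pi\<^sup>2)) * (\<Sum>k<N. 1 / (real k + 1)\<^sup>2)"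
      by (simp add: sum_distrib_left[symmetric] sum_divide_distrib[symmetric] divide_simps mult.assoc)
         (simp add: sum_distrib_left field_simps)
    then show ?thesis
      by (subst fourier.integral_sq_diff_phi_sum[OF sq fin])
         (simp only: integral_sq_sawtooth diff_self norm_zero, simp)
  qed
  moreover have "(\<lambda>N. 1/12 - (1 / (2 * pi\<^sup>2)) * (\<Sum>k<N. 1 / (real k + 1)\<^sup>2)) \<longlonglongrightarrow> 1/12 - (1 / (2 * pi\<^sup>2)) * (pi\<^sup>2 / 6)"
    using inverse_squares_sums unfolding sums_def by (intro tendsto_intros) (simp add: add.commute)
  ultimately have "(\<lambda>N. LINT x|unit_measure. (cmod (?s x - (\<Sum>i\<in>A N \<union> B N. fourier.coef ?s i * fourier_char i x)))\<^sup>2) \<longlonglongrightarrow> 0"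
    by simp
  then have "eventually (\<lambda>N. (LINT x|unit_measure. (cmod (?s x - (\<Sum>i\<in>A N \<union> B N. fourier.coef ?s i * fourier_char i x)))\<^sup>2) < \<epsilon>) sequentially"
    using \<open>\<epsilon> > 0\<close> by (rule order_tendstoD(2))
  then obtain N where "(LINT x|unit_measure. (cmod (?s x - (\<Sum>i\<in>A N \<union> B N. fourier.coef ?s i * fourier_char i x)))\<^sup>2) < \<epsilon>"
    by (auto simp: eventually_sequentially)
  then show "\<exists>F c. finite F \<and> (LINT x|unit_measure. (cmod (?s x - (\<Sum>i\<in>F. c i * fourier_char i x)))\<^sup>2) < \<epsilon>"
    using fin by (intro exI[of _ "A N \<union> B N"] exI[of _ "fourier.coef ?s"] conjI)
qed

text \<open>The rotation of the circle by \<open>t\<close>, with the wrap-around written out: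
  \<open>{..<t}\<close> is carried to \<open>{1 - t..<1}\<close> and the rest to
  \<open>{0..1 - t}\<close>. No periodicity of \<kappa> is involved.\<close>

lemma integral_unit_measure_shift:
  fixes \<kappa> :: "real \<Rightarrow> real"
  assumes \<kappa>: "continuous_on UNIV \<kappa>" and t: "0 \<le> t" "t \<le> 1"
  shows "(LINT x|unit_measure. (if x < t then \<kappa> (x - t + 1) else \<kappa> (x - t))) = integral\<^sup>L unit_measure \<kappa>"
proof -
  have [measurable]: "\<kappa> \<in> borel_measurable borel" using \<kappa> by (rule borel_measurable_continuous_onI)
  have int: "integrable lborel (\<lambda>x. indicator S x *\<^sub>R \<kappa> x)" if "S \<subseteq> {0..1}" "S \<in> sets borel" for S
  proof -
    have "set_integrable lborel {0..1} \<kappa>"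
      by (rule borel_integrable_atLeastAtMost') (use \<kappa> continuous_on_subset in blast)
    then have "set_integrable lborel S \<kappa>" by (rule set_integrable_subset) (use that in auto)
    then show ?thesis by (simp add: set_integrable_def)
  qed
  let ?A = "\<lambda>x. indicator {1 - t..<1} x *\<^sub>R \<kappa> x" and ?B = "\<lambda>x. indicator {0..1 - t} x *\<^sub>R \<kappa> x"
  have iA: "integrable lborel ?A" and iB: "integrable lborel ?B" using t by (intro int; auto)+
  have A: "(LINT x|lborel. ?A x) = (LINT x|lborel. ?A (x - t + 1))"
    using lborel_integral_real_affine[of 1 ?A "1 - t"] by (simp add: algebra_simps)
  have B: "(LINT x|lborel. ?B x) = (LINT x|lborel. ?B (x - t))"
    using lborel_integral_real_affine[of 1 ?B "- t"] by (simp add: algebra_simps)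
  have iA': "integrable lborel (\<lambda>x. ?A (x - t + 1))"
    using lborel_integrable_real_affine[OF iA, of 1 "1 - t"] by (simp add: algebra_simps)
  have iB': "integrable lborel (\<lambda>x. ?B (x - t))"
    using lborel_integrable_real_affine[OF iB, of 1 "- t"] by (simp add: algebra_simps)
  have "(LINT x|unit_measure. (if x < t then \<kappa> (x - t + 1) else \<kappa> (x - t)))
    = (LINT x|lborel. indicator {0..1} x *\<^sub>R (if x < t then \<kappa> (x - t + 1) else \<kappa> (x - t)))"
    by (rule integral_unit_measure) measurable
  also have "\<dots> = (LINT x|lborel. ?A (x - t + 1) + ?B (x - t))"
    using t by (intro Bochner_Integration.integral_cong refl) (auto simp: indicator_def)
  also have "\<dots> = (LINT x|lborel. ?A x + ?B x)"
    using iA iB iA' iB' A B by simp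
  also have "\<dots> = (LINT x|lborel. indicator {0..1} x *\<^sub>R \<kappa> x)"
  proof (rule integral_cong_AE)
    \<comment> \<open>The two pieces overlap at \<open>1 - t\<close> when this point lies in both,
      and neither need contain 1; both points are null.\<close>
    have "AE x in lborel. x \<noteq> 1" "AE x in lborel. x \<noteq> 1 - t" by (auto intro: AE_lborel_singleton)
    then show "AE x in lborel. ?A x + ?B x = indicator {0..1} x *\<^sub>R \<kappa> x"
      by eventually_elim (use t in \<open>auto simp: indicator_def\<close>)
  qed auto
  also have "\<dots> = integral\<^sup>L unit_measure \<kappa>" by (rule integral_unit_measure[symmetric]) measurable
  finally show ?thesis .
qed

text \<open>The function is the sawtooth of the fractional part of \<open>x - t\<close>. Rotation
  preserves the distance and maps trigonometric polynomials to trigonometric polynomials, with each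
  coefficient multiplied by \<open>fourier_char i (- t)\<close>.\<close>

lemma approximable_sawtooth_shift:
  assumes t: "0 \<le> t" "t \<le> 1"
  shows "fourier.approximable (\<lambda>x. complex_of_real (if x < t then x - t + 1/2 else x - t - 1/2))"
    (is "fourier.approximable ?u")
  unfolding fourier.approximable_def
proof (intro conjI allI impI)
  have um: "?u \<in> borel_measurable borel" by measurable
  have "integrable unit_measure (\<lambda>x. (cmod (?u x))\<^sup>2)"
  proof (rule unit_measure.integrable_const_bound[where B = "4"])
    show "AE x in unit_measure. norm ((cmod (?u x))\<^sup>2) \<le> 4"
      using AE_unit_measure_mem
    proof eventually_elim
      case (elim x)
      then have "cmod (?u x) \<le> 2" using t by (simp only: norm_of_real) auto
      then have "cmod (?u x) ^ 2 \<le> 2 ^ 2" by (intro power_mono) auto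
      then show ?case by simp
    qed
  qed (use um in measurable)
  then show "sq_integrable unit_measure ?u" using um by (simp add: sq_integrable_def)
  fix \<epsilon> :: real assume "\<epsilon> > 0"
  then obtain F c where F: "finite F" and
    c: "(LINT x|unit_measure. (cmod (complex_of_real (x - 1/2) - (\<Sum>i\<in>F. c i * fourier_char i x)))\<^sup>2) < \<epsilon>"
    using approximable_sawtooth unfolding fourier.approximable_def by blast
  define P where "P = (\<lambda>x. \<Sum>i\<in>F. c i * fourier_char i x)"
  define \<kappa> where "\<kappa> = (\<lambda>x. (cmod (complex_of_real (x - 1/2) - P x))\<^sup>2)"
  have per: "P (x + 1) = P x" for x
    unfolding P_def using fourier_char_of_int[of _ 1] by (simp add: fourier_char_add)
  have P': "P (x - t) = (\<Sum>i\<in>F. (c i * fourier_char i (- t)) * fourier_char i x)" for x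
    unfolding P_def using fourier_char_add[of _ x "-t"] by (simp add: mult_ac)
  have "continuous_on UNIV \<kappa>" unfolding \<kappa>_def P_def by (intro continuous_intros)
  from integral_unit_measure_shift[OF this t]
  have "(LINT x|unit_measure. (if x < t then \<kappa> (x - t + 1) else \<kappa> (x - t))) < \<epsilon>"
    using c unfolding \<kappa>_def P_def by simp
  also have "(\<lambda>x. if x < t then \<kappa> (x - t + 1) else \<kappa> (x - t)) = (\<lambda>x. (cmod (?u x - P (x - t)))\<^sup>2)"
  proof
    fix x
    have "P (x - t + 1) = P (x - t)" by (rule per)
    then show "(if x < t then \<kappa> (x - t + 1) else \<kappa> (x - t)) = (cmod (?u x - P (x - t)))\<^sup>2"
      by (simp add: \<kappa>_def algebra_simps)
  qed
  finally show "\<exists>F c. finite F \<and> (LINT x|unit_measure. (cmod (?u x - (\<Sum>i\<in>F. c i * fourier_char i x)))\<^sup>2) < \<epsilon>"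
    unfolding P' using F by (intro exI[of _ F] exI[of _ "\<lambda>i. c i * fourier_char i (- t)"] conjI)
qed

lemma approximable_one: "fourier.approximable (\<lambda>x. 1)"
  using fourier.approximable_phi_sum[of "{0}" "\<lambda>_. 1"] by simp

text \<open>For \<open>0 \<le> t \<le> 1\<close> the rotated sawtooth minus the sawtooth is the
  indicator of \<open>{..<t}\<close> minus the constant \<open>t\<close>: the two have the same
  slope and jump at different places.\<close>

lemma approximable_indicator_lessThan: "fourier.approximable (indicator {..<t})"
proof -
  consider "t < 0" | "0 \<le> t" "t \<le> 1" | "t > 1" by linarith
  then show ?thesis
  proof cases
    case 1
    have "fourier.approximable (\<lambda>x. 0)" using fourier.approximable_phi_sum[of "{}"] by simp
    then show ?thesis
      by (rule fourier.approximable_AE_cong)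
         (use 1 in \<open>auto simp: indicator_def intro: eventually_mono[OF AE_unit_measure_mem]\<close>)
  next
    case 3
    show ?thesis
      by (rule fourier.approximable_AE_cong[OF approximable_one])
         (use 3 in \<open>auto simp: indicator_def intro: eventually_mono[OF AE_unit_measure_mem]\<close>)
  next
    case 2
    have "fourier.approximable (\<lambda>x. (complex_of_real (if x < t then x - t + 1/2 else x - t - 1/2)
       + (-1) * complex_of_real (x - 1/2)) + of_real t * 1)"
      by (intro fourier.approximable_add fourier.approximable_cmult approximable_one
          approximable_sawtooth approximable_sawtooth_shift 2)
    then show ?thesis
      by (rule fourier.approximable_AE_cong) (auto simp: indicator_def intro!: AE_I2)
  qed
qed

lemma Int_stable_lessThan: "Int_stable (range lessThan :: real set set)"
proof (rule Int_stableI)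
  fix A B :: "real set" assume "A \<in> range lessThan" "B \<in> range lessThan"
  then obtain a b where "A = {..<a}" "B = {..<b}" by auto
  then have "A \<inter> B = {..<min a b}" by auto
  then show "A \<inter> B \<in> range lessThan" by blast
qed

lemma sets_borel_lessThan: "sets (borel::real measure) = sigma_sets UNIV (range lessThan)"
  using arg_cong[OF borel_eq_lessThan[where 'a = real], of sets] by (simp add: eucl_less_def lessThan_def)

lemma approximable_indicator_borel:
  assumes "A \<in> sets borel"
  shows "fourier.approximable (indicator A)"
proof (rule fourier.approximable_indicator[where G = "range lessThan"])
  show "Int_stable (range lessThan :: real set set)" by (rule Int_stable_lessThan)
  show "sets unit_measure = sigma_sets (space unit_measure) (range lessThan)"
    by (simp add: sets_borel_lessThan)
qed (use assms approximable_one approximable_indicator_lessThan in auto)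

section \<open>Fourier series on the unit square\<close>

definition unit_square :: "(real \<times> real) measure" where
  "unit_square = unit_measure \<Otimes>\<^sub>M unit_measure"

lemma sets_unit_square [measurable_cong]: "sets unit_square = sets (borel \<Otimes>\<^sub>M borel)"
  unfolding unit_square_def by (intro sets_pair_measure_cong) simp_all

lemma space_unit_square [simp]: "space unit_square = UNIV"
  by (simp add: unit_square_def space_pair_measure)

interpretation unit_square: pair_prob_space unit_measure unit_measure ..

interpretation unit_square_prob: prob_space unit_square
  unfolding unit_square_def by (rule unit_square.prob_space_axioms)

text \<open>The components are crossed on purpose: in the lattice point \<open>(m, n)\<close> the
  translation \<open>m\<close> acts on the Zak transform as a character in \<xi>, and the frequency
  \<open>n\<close> as a character in \<open>y\<close>.\<close>

definition torus_char :: "int \<times> int \<Rightarrow> real \<times> real \<Rightarrow> complex" where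
  "torus_char = (\<lambda>(m, n) (y, \<xi>). fourier_char n y * fourier_char m \<xi>)"

lemma integral_unit_square_mult:
  fixes f g :: "real \<Rightarrow> 'b::{banach, second_countable_topology, real_normed_field}"
  assumes f: "integrable unit_measure f" and g: "integrable unit_measure g"
  shows "integrable unit_square (\<lambda>z. f (fst z) * g (snd z))"
    and "(LINT z|unit_square. f (fst z) * g (snd z)) = integral\<^sup>L unit_measure f * integral\<^sup>L unit_measure g"
proof -
  have [measurable]: "f \<in> borel_measurable borel" "g \<in> borel_measurable borel"
    using borel_measurable_integrable[OF f] borel_measurable_integrable[OF g] by simp_all
  have "integrable (unit_measure \<Otimes>\<^sub>M unit_measure) (\<lambda>(x, y). f x * g y)"
  proof (rule unit_square.Fubini_integrable)
    show "integrable unit_measure (\<lambda>x. LINT y|unit_measure. norm (case (x, y) of (x, y) \<Rightarrow> f x * g y))"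
      using f g by (simp add: norm_mult)
  qed (use g in auto)
  then have i: "integrable (unit_measure \<Otimes>\<^sub>M unit_measure) (\<lambda>z. f (fst z) * g (snd z))"
    by (simp add: case_prod_unfold)
  then show "integrable unit_square (\<lambda>z. f (fst z) * g (snd z))" by (simp add: unit_square_def)
  have "(LINT x|unit_measure. LINT y|unit_measure. f x * g y)
      = (LINT z|unit_square. f (fst z) * g (snd z))"
    using unit_square.integral_fst'[OF i] by (simp add: unit_square_def)
  then show "(LINT z|unit_square. f (fst z) * g (snd z)) = integral\<^sup>L unit_measure f * integral\<^sup>L unit_measure g"
    by simp
qed

lemma torus_char_measurable [measurable]: "torus_char i \<in> borel_measurable (borel \<Otimes>\<^sub>M borel)"
  unfolding torus_char_def by (cases i) (simp add: case_prod_unfold)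

interpretation torus: orthonormal_functions unit_square torus_char
proof
  fix i j :: "int \<times> int"
  obtain m n m' n' where ij: "i = (m, n)" "j = (m', n')" by (cases i; cases j) auto
  have "(LINT z|unit_square. torus_char i z * cnj (torus_char j z))
      = (LINT z|unit_square. fourier_char (n - n') (fst z) * fourier_char (m - m') (snd z))"
    unfolding ij torus_char_def
    by (intro Bochner_Integration.integral_cong refl)
       (auto simp: fourier_char_mult_cnj[symmetric] mult_ac)
  also have "\<dots> = of_bool (n - n' = 0) * of_bool (m - m' = 0)"
    by (subst integral_unit_square_mult)
       (auto simp: integral_fourier_char intro!: unit_measure.integrable_const_bound[where B = 1])
  also have "\<dots> = of_bool (i = j)" by (auto simp: ij)
  finally show "(LINT z|unit_square. torus_char i z * cnj (torus_char j z)) = of_bool (i = j)" .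
next
  show "cmod (torus_char i x) \<le> 1" for i x
    by (cases i; cases x) (simp add: torus_char_def norm_mult)
qed auto

text \<open>The two factors are replaced by trigonometric polynomials one at a time. Each
  replacement error is a product function, whose squared norm is the product of the norms of its
  factors.\<close>

lemma torus_approximable_mult:
  assumes u: "fourier.approximable u" and v: "fourier.approximable v"
  shows "torus.approximable (\<lambda>z. u (fst z) * v (snd z))"
proof -
  have sq: "sq_integrable unit_square (\<lambda>z. f (fst z) * g (snd z))"
    and int: "(LINT z|unit_square. (cmod (f (fst z) * g (snd z)))\<^sup>2)
      = (LINT x|unit_measure. (cmod (f x))\<^sup>2) * (LINT x|unit_measure. (cmod (g x))\<^sup>2)"
    if f: "sq_integrable unit_measure f" and g: "sq_integrable unit_measure g" for f g
  proof -
    have [measurable]: "f \<in> borel_measurable borel" "g \<in> borel_measurable borel"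
      using sq_integrable_measurable[OF f] sq_integrable_measurable[OF g] by (simp_all cong: measurable_cong_sets)
    note i = integral_unit_square_mult[of "\<lambda>x. (cmod (f x))\<^sup>2" "\<lambda>x. (cmod (g x))\<^sup>2"]
    show "sq_integrable unit_square (\<lambda>z. f (fst z) * g (snd z))"
      using i(1) f g by (simp add: sq_integrable_def norm_mult power_mult_distrib)
    show "(LINT z|unit_square. (cmod (f (fst z) * g (snd z)))\<^sup>2)
      = (LINT x|unit_measure. (cmod (f x))\<^sup>2) * (LINT x|unit_measure. (cmod (g x))\<^sup>2)"
      using i(2) f g by (simp add: sq_integrable_def norm_mult power_mult_distrib)
  qed
  have su: "sq_integrable unit_measure u" and sv: "sq_integrable unit_measure v"
    using u v by (auto simp: fourier.approximable_def)
  have small: "\<exists>F c. finite F \<and> K * (LINT x|unit_measure. (cmod (w x - (\<Sum>i\<in>F. c i * fourier_char i x)))\<^sup>2) < \<epsilon>"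
    if w: "fourier.approximable w" and e: "\<epsilon> > 0" and K: "K \<ge> 0" for w K \<epsilon>
  proof -
    \<comment> \<open>\<open>K\<close> is the squared norm of the other factor and may be 0.\<close>
    have "\<epsilon> / (K + 1) > 0" using e K by simp
    then obtain F c where F: "finite F"
      "(LINT x|unit_measure. (cmod (w x - (\<Sum>i\<in>F. c i * fourier_char i x)))\<^sup>2) < \<epsilon> / (K + 1)"
      using w unfolding fourier.approximable_def by blast
    let ?I = "LINT x|unit_measure. (cmod (w x - (\<Sum>i\<in>F. c i * fourier_char i x)))\<^sup>2"
    have "K * ?I \<le> (K + 1) * ?I" by (intro mult_right_mono) auto
    also have "\<dots> < \<epsilon>" using F(2) K by (simp add: pos_less_divide_eq mult.commute)
    finally show ?thesis using F(1) by (intro exI[of _ F] exI[of _ c] conjI)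
  qed
  have step1: "torus.approximable (\<lambda>z. u (fst z) * (\<Sum>j\<in>G. d j * fourier_char j (snd z)))" if G: "finite G" for G d
  proof (rule torus.approximable_limit)
    define Q where "Q = (\<lambda>x. \<Sum>j\<in>G. d j * fourier_char j x)"
    have sQ: "sq_integrable unit_measure Q" unfolding Q_def by (rule fourier.sq_integrable_phi_sum)
    show "sq_integrable unit_square (\<lambda>z. u (fst z) * (\<Sum>j\<in>G. d j * fourier_char j (snd z)))"
      using sq[OF su sQ] by (simp add: Q_def)
    fix \<epsilon> :: real assume "\<epsilon> > 0"
    then obtain F c where F: "finite F"
      "(LINT x|unit_measure. (cmod (Q x))\<^sup>2) * (LINT x|unit_measure. (cmod (u x - (\<Sum>i\<in>F. c i * fourier_char i x)))\<^sup>2) < \<epsilon>"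
      using small[OF u, of \<epsilon> "LINT x|unit_measure. (cmod (Q x))\<^sup>2"] by auto
    define P where "P = (\<lambda>x. \<Sum>i\<in>F. c i * fourier_char i x)"
    have sP: "sq_integrable unit_measure P" unfolding P_def by (rule fourier.sq_integrable_phi_sum)
    have "torus.approximable (\<lambda>z. \<Sum>k\<in>G \<times> F. (d (fst k) * c (snd k)) * torus_char k z)"
      by (rule torus.approximable_phi_sum) (use F G in auto)
    also have "(\<lambda>z. \<Sum>k\<in>G \<times> F. (d (fst k) * c (snd k)) * torus_char k z) = (\<lambda>z. P (fst z) * Q (snd z))"
    proof
      fix z :: "real \<times> real"
      have "P (fst z) * Q (snd z) = Q (snd z) * P (fst z)" by (rule mult.commute)
      also have "\<dots> = (\<Sum>j\<in>G. \<Sum>i\<in>F. (d j * fourier_char j (snd z)) * (c i * fourier_char i (fst z)))"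
        unfolding P_def Q_def by (rule sum_product)
      also have "\<dots> = (\<Sum>k\<in>G \<times> F. (d (fst k) * c (snd k)) * torus_char k z)"
        unfolding sum.cartesian_product
        by (intro sum.cong refl) (auto simp: torus_char_def case_prod_unfold mult_ac)
      finally show "(\<Sum>k\<in>G \<times> F. (d (fst k) * c (snd k)) * torus_char k z) = P (fst z) * Q (snd z)" ..
    qed
    finally have a: "torus.approximable (\<lambda>z. P (fst z) * Q (snd z))" .
    have "(LINT z|unit_square. (cmod (u (fst z) * Q (snd z) - P (fst z) * Q (snd z)))\<^sup>2)
        = (LINT z|unit_square. (cmod ((u (fst z) - P (fst z)) * Q (snd z)))\<^sup>2)"
      by (simp add: algebra_simps)
    also have "\<dots> < \<epsilon>"
      using int[OF sq_integrable_diff[OF su sP] sQ] F(2) by (simp add: P_def mult.commute)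
    finally show "\<exists>v. torus.approximable v \<and>
      (LINT x|unit_square. (cmod (u (fst x) * (\<Sum>j\<in>G. d j * fourier_char j (snd x)) - v x))\<^sup>2) < \<epsilon>"
      using a by (intro exI[of _ "\<lambda>z. P (fst z) * Q (snd z)"] conjI) (simp_all add: Q_def)
  qed
  show ?thesis
  proof (rule torus.approximable_limit[OF sq[OF su sv]])
    fix \<epsilon> :: real assume "\<epsilon> > 0"
    then obtain G d where G: "finite G"
      "(LINT x|unit_measure. (cmod (u x))\<^sup>2) * (LINT x|unit_measure. (cmod (v x - (\<Sum>i\<in>G. d i * fourier_char i x)))\<^sup>2) < \<epsilon>"
      using small[OF v, of \<epsilon> "LINT x|unit_measure. (cmod (u x))\<^sup>2"] by auto
    define Q where "Q = (\<lambda>x. \<Sum>j\<in>G. d j * fourier_char j x)"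
    have sQ: "sq_integrable unit_measure Q" unfolding Q_def by (rule fourier.sq_integrable_phi_sum)
    have "(LINT z|unit_square. (cmod (u (fst z) * v (snd z) - u (fst z) * Q (snd z)))\<^sup>2)
        = (LINT z|unit_square. (cmod (u (fst z) * (v (snd z) - Q (snd z))))\<^sup>2)"
      by (simp add: algebra_simps)
    also have "\<dots> < \<epsilon>"
      using int[OF su sq_integrable_diff[OF sv sQ]] G(2) by (simp add: Q_def)
    finally show "\<exists>w. torus.approximable w \<and> (LINT x|unit_square. (cmod (u (fst x) * v (snd x) - w x))\<^sup>2) < \<epsilon>"
      using step1[OF G(1), of d] by (intro exI[of _ "\<lambda>z. u (fst z) * Q (snd z)"] conjI) (simp_all add: Q_def)
  qed
qed

theorem torus_complete:
  assumes "sq_integrable unit_square u"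
  shows "torus.approximable u"
proof (rule torus.approximable_sq_integrable[OF _ assms])
  fix A assume A: "A \<in> sets unit_square"
  show "torus.approximable (indicator A)"
  proof (rule torus.approximable_indicator[where G = "{a \<times> b | a b. a \<in> sets unit_measure \<and> b \<in> sets unit_measure}"])
    show "Int_stable {a \<times> b | a b. a \<in> sets unit_measure \<and> b \<in> sets unit_measure}"
      by (rule Int_stable_pair_measure_generator)
    show "sets unit_square = sigma_sets (space unit_square) {a \<times> b | a b. a \<in> sets unit_measure \<and> b \<in> sets unit_measure}"
      unfolding unit_square_def sets_pair_measure space_pair_measure ..
    show "torus.approximable (\<lambda>x. 1)" using torus_approximable_mult[OF approximable_one approximable_one] by simp
    fix B assume "B \<in> {a \<times> b | a b. a \<in> sets unit_measure \<and> b \<in> sets unit_measure}"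
    then obtain a b where B: "B = a \<times> b" "a \<in> sets borel" "b \<in> sets borel" by auto
    have "torus.approximable (\<lambda>z. indicator a (fst z) * indicator b (snd z))"
      by (intro torus_approximable_mult approximable_indicator_borel B)
    then show "torus.approximable (indicator B)"
      by (simp add: B(1) indicator_times[abs_def])
  qed (use A in auto)
qed

section \<open>Fourier inversion for integrable functions\<close>

lemma (in pair_sigma_finite) integrable_dominated_by_product:
  fixes F :: "'a \<Rightarrow> 'b \<Rightarrow> 'c::{banach, second_countable_topology}"
  assumes F [measurable]: "case_prod F \<in> borel_measurable (M1 \<Otimes>\<^sub>M M2)"
    and u: "integrable M1 u" and v: "integrable M2 v"
    and dom: "\<And>x y. norm (F x y) \<le> u x * (v y :: real)"
  shows "integrable (M1 \<Otimes>\<^sub>M M2) (case_prod F)"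
proof -
  have [measurable]: "u \<in> borel_measurable M1" "v \<in> borel_measurable M2" using u v by auto
  have "integrable (M1 \<Otimes>\<^sub>M M2) (\<lambda>(x, y). u x * v y)"
  proof (rule Fubini_integrable)
    have "integrable M1 (\<lambda>x. \<bar>u x\<bar> * (LINT y|M2. \<bar>v y\<bar>))" using u by auto
    then show "integrable M1 (\<lambda>x. LINT y|M2. norm (case (x, y) of (x, y) \<Rightarrow> u x * v y))"
      by (simp add: abs_mult)
  qed (use v in auto)
  then show ?thesis
  proof (rule Bochner_Integration.integrable_bound)
    show "AE z in M1 \<Otimes>\<^sub>M M2. norm (case_prod F z) \<le> norm (case z of (x, y) \<Rightarrow> u x * v y)"
      using dom by (auto intro!: AE_I2 intro: order_trans[OF _ abs_ge_self])
  qed auto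
qed

text \<open>Dynkin's theorem on the half-lines, which are stable under intersection, makes the
  integral of \<open>d\<close> vanish on all Borel sets; the assumption \<open>all\<close> provides
  complements. Real and imaginary part are compared with the density 0.\<close>

lemma AE_zero_from_halflines:
  fixes d :: "real \<Rightarrow> complex"
  assumes d: "integrable lborel d" and half: "\<And>t. (LINT x|lborel. indicator {..<t} x *\<^sub>R d x) = 0"
    and all: "(LINT x|lborel. d x) = 0"
  shows "AE x in lborel. d x = 0"
proof -
  have [measurable]: "d \<in> borel_measurable borel" using d by auto
  have Z: "(LINT x|lborel. indicator A x *\<^sub>R d x) = 0" if A: "A \<in> sets borel" for A
  proof -
    have I: "integrable lborel (\<lambda>x. indicator B x *\<^sub>R d x)" if "B \<in> sets borel" for B
      using integrable_mult_indicator[of B lborel d] that d by simp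
    have "A \<in> sigma_sets UNIV (range lessThan)" and S: "B \<in> sigma_sets UNIV (range lessThan) \<Longrightarrow> B \<in> sets borel"
      for B :: "real set" using A by (simp_all add: sets_borel_lessThan)
    have pow: "range lessThan \<subseteq> Pow (UNIV :: real set)" by auto
    show ?thesis
      using Int_stable_lessThan pow \<open>A \<in> sigma_sets UNIV (range lessThan)\<close>
    proof (induction rule: sigma_sets_induct_disjoint)
      case (basic A)
      then show ?case using half by auto
    next
      case (compl A)
      have "(\<lambda>x. indicator (UNIV - A) x *\<^sub>R d x) = (\<lambda>x. d x - indicator A x *\<^sub>R d x)"
        by (auto simp: indicator_def)
      then show ?case using compl I[OF S] d all by simp
    next
      case (union A)
      have A: "A i \<in> sets borel" for i using union(2) S by auto
      have "(\<lambda>n. LINT x|lborel. indicator (\<Union>i<n. A i) x *\<^sub>R d x)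
          \<longlonglongrightarrow> (LINT x|lborel. indicator (\<Union>i. A i) x *\<^sub>R d x)"
      proof (rule integral_dominated_convergence[where w = "\<lambda>x. norm (d x)"])
        show "AE x in lborel. (\<lambda>n. indicator (\<Union>i<n. A i) x *\<^sub>R d x) \<longlonglongrightarrow> indicator (\<Union>i. A i) x *\<^sub>R d x"
          by (intro AE_I2 tendsto_intros LIMSEQ_indicator_UN)
        show "AE x in lborel. norm (indicator (\<Union>i<n. A i) x *\<^sub>R d x) \<le> norm (d x)" for n
          by (auto simp: indicator_def)
      qed (use A d in auto)
      moreover have "(LINT x|lborel. indicator (\<Union>i<n. A i) x *\<^sub>R d x) = 0" for n
      proof -
        have e: "(\<lambda>x. indicator (\<Union>i<n. A i) x *\<^sub>R d x) = (\<lambda>x. \<Sum>i<n. indicator (A i) x *\<^sub>R d x)"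
          by (subst indicator_UN_disjoint)
             (use union(1) in \<open>auto intro: disjoint_family_on_mono simp: scaleR_sum_left\<close>)
        have "(LINT x|lborel. (\<Sum>i<n. indicator (A i) x *\<^sub>R d x)) = (\<Sum>i<n. LINT x|lborel. indicator (A i) x *\<^sub>R d x)"
          by (intro Bochner_Integration.integral_sum I A)
        then show ?thesis unfolding e using union(3) by simp
      qed
      ultimately have "(\<lambda>n::nat. 0) \<longlonglongrightarrow> (LINT x|lborel. indicator (\<Union>i. A i) x *\<^sub>R d x)" by (simp only:)
      then show ?case by (rule LIMSEQ_unique[OF _ tendsto_const])
    qed simp
  qed
  have IA: "integrable lborel (\<lambda>x. indicator A x *\<^sub>R d x)" if "A \<in> sets borel" for A
    using integrable_mult_indicator[of A lborel d] that d by simp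
  have Re: "AE x in lborel. Re (d x) = 0"
  proof (rule density_unique_real[where f = "\<lambda>x. Re (d x)" and f' = "\<lambda>x. 0"])
    fix A :: "real set" assume "A \<in> sets lborel"
    then show "(LINT x:A|lborel. Re (d x)) = (LINT x:A|lborel. 0)"
      using integral_Re[OF IA, of A] Z[of A] by (simp add: set_lebesgue_integral_def)
  qed (use d in auto)
  have Im: "AE x in lborel. Im (d x) = 0"
  proof (rule density_unique_real[where f = "\<lambda>x. Im (d x)" and f' = "\<lambda>x. 0"])
    fix A :: "real set" assume "A \<in> sets lborel"
    then show "(LINT x:A|lborel. Im (d x)) = (LINT x:A|lborel. 0)"
      using integral_Im[OF IA, of A] Z[of A] by (simp add: set_lebesgue_integral_def)
  qed (use d in auto)
  show ?thesis using Re Im by eventually_elim (simp add: complex_eq_iff)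
qed

lemma gaussian_fourier:
  assumes a: "a > 0"
  shows "integrable lborel (\<lambda>x. exp (- pi * a * x\<^sup>2))"
    and "(LINT x|lborel. exp (- pi * a * x\<^sup>2) *\<^sub>R cis (2 * pi * x * t)) = of_real (exp (- pi * t\<^sup>2 / a) / sqrt a)"
proof -
  \<comment> \<open>This scale turns the standard normal density into the given Gaussian, so that
    its characteristic function can be used.\<close>
  define c where "c = sqrt (2 * pi * a)"
  have c: "c > 0" "c\<^sup>2 = 2 * pi * a" using a by (auto simp: c_def)
  have d: "std_normal_density (0 + c * x) = exp (- pi * a * x\<^sup>2) / sqrt (2 * pi)" for x
    using c by (simp add: std_normal_density_def power_mult_distrib)
  have "integrable lborel (\<lambda>x. std_normal_density (0 + c * x))"
    using integrable_std_normal_moment[of 0] c by (intro lborel_integrable_real_affine) auto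
  then show "integrable lborel (\<lambda>x. exp (- pi * a * x\<^sup>2))"
    unfolding d using integrable_divide_zero[of "sqrt (2 * pi)" lborel "\<lambda>x. exp (- (pi * a * x\<^sup>2)) / sqrt (2 * pi)"]
      integrable_mult_left[of "sqrt (2 * pi)" lborel "\<lambda>x. exp (- (pi * a * x\<^sup>2)) / sqrt (2 * pi)"] by simp
  define s where "s = 2 * pi * t / c"
  have "complex_of_real (exp (- s\<^sup>2 / 2)) = char std_normal_distribution s"
    by (simp add: char_std_normal_distribution)
  also have "\<dots> = (LINT x|lborel. std_normal_density x *\<^sub>R iexp (s * x))"
    unfolding char_def by (subst integral_density) auto
  also have "\<dots> = c *\<^sub>R (LINT x|lborel. std_normal_density (0 + c * x) *\<^sub>R iexp (s * (0 + c * x)))"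
    using c by (subst lborel_integral_real_affine[of c _ 0]) auto
  also have "\<dots> = c *\<^sub>R (LINT x|lborel. (1 / sqrt (2 * pi)) *\<^sub>R (exp (- pi * a * x\<^sup>2) *\<^sub>R cis (2 * pi * x * t)))"
    unfolding d using c by (simp add: s_def cis_conv_exp mult_ac)
  also have "\<dots> = (c / sqrt (2 * pi)) *\<^sub>R (LINT x|lborel. exp (- pi * a * x\<^sup>2) *\<^sub>R cis (2 * pi * x * t))"
    by (subst integral_scaleR_right) (simp add: scaleR_scaleR)
  also have "c / sqrt (2 * pi) = sqrt a" by (simp add: c_def real_sqrt_mult)
  also have "- s\<^sup>2 / 2 = - pi * t\<^sup>2 / a"
    using c a by (simp add: s_def power_divide power_mult_distrib) (simp add: power2_eq_square)
  finally have e: "complex_of_real (exp (- pi * t\<^sup>2 / a))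
     = sqrt a *\<^sub>R (LINT x|lborel. exp (- pi * a * x\<^sup>2) *\<^sub>R cis (2 * pi * x * t))" .
  have "complex_of_real (exp (- pi * t\<^sup>2 / a) / sqrt a) = (1 / sqrt a) *\<^sub>R complex_of_real (exp (- pi * t\<^sup>2 / a))"
    by (simp add: scaleR_conv_of_real)
  also have "\<dots> = (LINT x|lborel. exp (- pi * a * x\<^sup>2) *\<^sub>R cis (2 * pi * x * t))"
    unfolding e using a by simp
  finally show "(LINT x|lborel. exp (- pi * a * x\<^sup>2) *\<^sub>R cis (2 * pi * x * t)) = of_real (exp (- pi * t\<^sup>2 / a) / sqrt a)" ..
qed

lemma gaussian_integral:
  assumes a: "a > 0"
  shows "(LINT x|lborel. exp (- pi * a * x\<^sup>2)) = 1 / sqrt a"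
proof -
  have "(LINT x|lborel. complex_of_real (exp (- pi * a * x\<^sup>2))) = of_real (1 / sqrt a)"
    using gaussian_fourier(2)[OF a, of 0] by (simp add: scaleR_conv_of_real)
  then show ?thesis by (simp only: integral_complex_of_real of_real_eq_iff)
qed

lemma cis_measurable [measurable (raw)]:
  "f \<in> borel_measurable M \<Longrightarrow> (\<lambda>x. cis (f x)) \<in> borel_measurable M"
  by (rule measurable_compose[of f M borel]) (auto intro!: borel_measurable_continuous_onI continuous_intros)

definition fourier_transform :: "(real \<Rightarrow> complex) \<Rightarrow> real \<Rightarrow> complex" where
  "fourier_transform h \<theta> = (LINT x|lborel. h x * cis (- (2 * pi * \<theta> * x)))"

lemma fourier_transform_measurable [measurable]:
  assumes [measurable]: "h \<in> borel_measurable borel"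
  shows "fourier_transform h \<in> borel_measurable borel"
  unfolding fourier_transform_def[abs_def] by measurable

text \<open>A Gaussian factor in the inversion integral makes Fubini applicable and turns it into
  the convolution \<open>Hn n\<close> of \<open>h\<close> with an approximate identity. Instead of
  studying the convergence of the convolutions to \<open>h\<close>, one tests them against
  indicators of intervals: both sides then converge by dominated convergence, and \<open>H\<close>
  and \<open>h\<close> have the same integral over every bounded interval.\<close>

theorem fourier_inversion_AE:
  assumes h: "integrable lborel h" and hh: "integrable lborel (fourier_transform h)"
  shows "AE x in lborel. h x = (LINT \<theta>|lborel. fourier_transform h \<theta> * cis (2 * pi * \<theta> * x))"
proof -
  have [measurable]: "h \<in> borel_measurable borel" using h by auto
  define H where "H = (\<lambda>x. LINT \<theta>|lborel. fourier_transform h \<theta> * cis (2 * pi * \<theta> * x))"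
  define C where "C = (LINT \<theta>|lborel. cmod (fourier_transform h \<theta>))"
  \<comment> \<open>Gaussian summability factor, tending to 1 from below; its transform is the
    heat-type kernel of width \<open>1 / real (Suc n)\<close>.\<close>
  define g where "g = (\<lambda>(n::nat) \<theta>::real. exp (- pi * (\<theta> / real (Suc n))\<^sup>2))"
  define Hn where "Hn = (\<lambda>(n::nat) x. LINT \<theta>|lborel. (g n \<theta> *\<^sub>R fourier_transform h \<theta>) * cis (2 * pi * \<theta> * x))"
  have [measurable]: "H \<in> borel_measurable borel" "Hn n \<in> borel_measurable borel" for n
    unfolding H_def Hn_def g_def by measurable
  have gm [measurable]: "g n \<in> borel_measurable borel" for n unfolding g_def by measurable
  have g1: "0 \<le> g n \<theta>" "g n \<theta> \<le> 1" for n \<theta> by (auto simp: g_def)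
  have geq: "g n = (\<lambda>\<theta>. exp (- pi * (1 / (real (Suc n))\<^sup>2) * \<theta>\<^sup>2))" for n
    by (simp add: g_def power_divide)
  have gi: "integrable lborel (g n)" for n
    unfolding geq by (rule gaussian_fourier) auto
  have H_bound: "cmod (H x) \<le> C" for x
    unfolding H_def C_def by (rule order_trans[OF integral_norm_bound]) (simp add: norm_mult)
  have Hn_bound: "cmod (Hn n x) \<le> C" for n x
  proof -
    have "cmod (Hn n x) \<le> (LINT \<theta>|lborel. g n \<theta> * cmod (fourier_transform h \<theta>))"
      unfolding Hn_def using g1 by (intro order_trans[OF integral_norm_bound]) (simp add: norm_mult)
    also have "\<dots> \<le> C" unfolding C_def
    proof (rule integral_mono)
      show "integrable lborel (\<lambda>\<theta>. g n \<theta> * cmod (fourier_transform h \<theta>))"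
        by (rule Bochner_Integration.integrable_bound[OF hh])
           (use g1 in \<open>auto simp: abs_mult intro!: AE_I2 mult_left_le_one_le\<close>)
    qed (use g1 hh in \<open>auto intro: mult_left_le_one_le\<close>)
    finally show ?thesis .
  qed
  have Hn_lim: "(\<lambda>n. Hn n x) \<longlonglongrightarrow> H x" for x
    unfolding Hn_def H_def
  proof (rule integral_dominated_convergence[where w = "\<lambda>\<theta>. cmod (fourier_transform h \<theta>)"])
    have "(\<lambda>n. g n \<theta>) \<longlonglongrightarrow> 1" for \<theta>
    proof -
      have "(\<lambda>n. \<theta> / real (Suc n)) \<longlonglongrightarrow> 0"
        using LIMSEQ_inverse_real_of_nat tendsto_mult_right_zero[of "\<lambda>n. inverse (real (Suc n))" sequentially \<theta>]
        by (simp add: divide_inverse)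
      then have "(\<lambda>n. exp (- pi * (\<theta> / real (Suc n))\<^sup>2)) \<longlonglongrightarrow> exp (- pi * 0\<^sup>2)"
        by (intro tendsto_intros)
      then show ?thesis by (simp add: g_def)
    qed
    then have "(\<lambda>n. g n \<theta> *\<^sub>R fourier_transform h \<theta> * cis (2 * pi * \<theta> * x))
      \<longlonglongrightarrow> 1 *\<^sub>R fourier_transform h \<theta> * cis (2 * pi * \<theta> * x)" for \<theta>
      by (intro tendsto_intros)
    then show "AE \<theta> in lborel. (\<lambda>n. g n \<theta> *\<^sub>R fourier_transform h \<theta> * cis (2 * pi * \<theta> * x))
      \<longlonglongrightarrow> fourier_transform h \<theta> * cis (2 * pi * \<theta> * x)" by simp
    show "AE \<theta> in lborel. norm (g n \<theta> *\<^sub>R fourier_transform h \<theta> * cis (2 * pi * \<theta> * x)) \<le> cmod (fourier_transform h \<theta>)" for n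
      using g1 by (auto simp: norm_mult intro!: AE_I2 mult_left_le_one_le)
  qed (use hh in auto)
  have Hn_eq: "Hn n x = (LINT y|lborel. h y * of_real (real (Suc n) * exp (- pi * ((x - y) * real (Suc n))\<^sup>2)))" for n x
  proof -
    have int: "integrable (lborel \<Otimes>\<^sub>M lborel) (\<lambda>(\<theta>, y). g n \<theta> *\<^sub>R (h y * cis (- (2 * pi * \<theta> * y))) * cis (2 * pi * \<theta> * x))"
      by (rule lborel_pair.integrable_dominated_by_product[where u = "g n" and v = "\<lambda>y. cmod (h y)"])
         (use gi h g1 in \<open>auto simp: norm_mult\<close>)
    have "Hn n x = (LINT \<theta>|lborel. LINT y|lborel. g n \<theta> *\<^sub>R (h y * cis (- (2 * pi * \<theta> * y))) * cis (2 * pi * \<theta> * x))"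
      unfolding Hn_def fourier_transform_def by simp
    also have "\<dots> = (LINT y|lborel. LINT \<theta>|lborel. g n \<theta> *\<^sub>R (h y * cis (- (2 * pi * \<theta> * y))) * cis (2 * pi * \<theta> * x))"
      by (rule lborel_pair.Fubini_integral[OF int, symmetric])
    also have "\<dots> = (LINT y|lborel. h y * of_real (real (Suc n) * exp (- pi * ((x - y) * real (Suc n))\<^sup>2)))"
    proof (intro Bochner_Integration.integral_cong refl)
      fix y :: real
      have "(LINT \<theta>|lborel. g n \<theta> *\<^sub>R (h y * cis (- (2 * pi * \<theta> * y))) * cis (2 * pi * \<theta> * x))
        = (LINT \<theta>|lborel. h y * (g n \<theta> *\<^sub>R cis (2 * pi * \<theta> * (x - y))))"
      proof (intro Bochner_Integration.integral_cong refl)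
        fix \<theta>
        have "cis (2 * pi * \<theta> * (x - y)) = cis (- (2 * pi * \<theta> * y)) * cis (2 * pi * \<theta> * x)"
          unfolding cis_mult by (simp add: algebra_simps)
        then show "g n \<theta> *\<^sub>R (h y * cis (- (2 * pi * \<theta> * y))) * cis (2 * pi * \<theta> * x) = h y * (g n \<theta> *\<^sub>R cis (2 * pi * \<theta> * (x - y)))"
          by (simp add: mult_ac)
      qed
      also have "\<dots> = h y * of_real (exp (- pi * (x - y)\<^sup>2 / (1 / (real (Suc n))\<^sup>2)) / sqrt (1 / (real (Suc n))\<^sup>2))"
        unfolding geq by (subst integral_mult_right_zero) (subst gaussian_fourier(2), auto)
      also have "exp (- pi * (x - y)\<^sup>2 / (1 / (real (Suc n))\<^sup>2)) / sqrt (1 / (real (Suc n))\<^sup>2) = real (Suc n) * exp (- pi * ((x - y) * real (Suc n))\<^sup>2)"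
        by (simp add: real_sqrt_divide power_mult_distrib del: of_nat_Suc)
      finally show "(LINT \<theta>|lborel. g n \<theta> *\<^sub>R (h y * cis (- (2 * pi * \<theta> * y))) * cis (2 * pi * \<theta> * x))
         = h y * of_real (real (Suc n) * exp (- pi * ((x - y) * real (Suc n))\<^sup>2))" .
    qed
    finally show ?thesis .
  qed
  have fin: "emeasure lborel {a..<b} < top" for a b :: real
    by (cases "a \<le> b") auto
  have main: "(LINT x|lborel. indicator {a..<b} x *\<^sub>R H x) = (LINT x|lborel. indicator {a..<b} x *\<^sub>R h x)" for a b
  proof -
    \<comment> \<open>By the substitution \<open>x = y + s / real (Suc n)\<close> this is the
      kernel's convolution with the indicator: the mollification is moved from \<open>h\<close> to
      the test function.\<close>
    define \<psi> where "\<psi> = (\<lambda>(n::nat) y. LINT s|lborel. indicator {a..<b} (y + s / real (Suc n)) *\<^sub>R exp (- pi * s\<^sup>2))"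
    have [measurable]: "\<psi> n \<in> borel_measurable borel" for n unfolding \<psi>_def by measurable
    have e1: "integrable lborel (\<lambda>s. exp (- pi * s\<^sup>2))" using gaussian_fourier(1)[of 1] by simp
    have e2: "(LINT s|lborel. exp (- pi * s\<^sup>2)) = 1" using gaussian_integral[of 1] by simp
    have psi_b: "norm (\<psi> n y) \<le> 1" for n y
    proof -
      have "norm (\<psi> n y) \<le> (LINT s|lborel. norm (indicator {a..<b} (y + s / real (Suc n)) *\<^sub>R exp (- pi * s\<^sup>2)))"
        unfolding \<psi>_def by (rule integral_norm_bound)
      also have "\<dots> \<le> (LINT s|lborel. exp (- pi * s\<^sup>2))"
        by (rule integral_mono) (use e1 in \<open>auto simp: indicator_def intro!: Bochner_Integration.integrable_bound[OF e1]\<close>)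
      finally show ?thesis using e2 by simp
    qed
    \<comment> \<open>At the endpoints of a non-empty interval the limit would be 1/2, half of the
      mass of the kernel; two points do not affect the integral.\<close>
    have psi_lim: "(\<lambda>n. \<psi> n y) \<longlonglongrightarrow> indicator {a..<b} y" if y: "y \<noteq> a" "y \<noteq> b" for y
    proof -
      have "(\<lambda>n. \<psi> n y) \<longlonglongrightarrow> (LINT s|lborel. indicator {a..<b} y *\<^sub>R exp (- pi * s\<^sup>2))"
        unfolding \<psi>_def
      proof (rule integral_dominated_convergence[where w = "\<lambda>s. exp (- pi * s\<^sup>2)"])
        show "AE s in lborel. (\<lambda>n. indicator {a..<b} (y + s / real (Suc n)) *\<^sub>R exp (- pi * s\<^sup>2))
            \<longlonglongrightarrow> indicator {a..<b} y *\<^sub>R exp (- pi * s\<^sup>2)"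
        proof (rule AE_I2)
          fix s
          have l: "(\<lambda>n. y + s / real (Suc n)) \<longlonglongrightarrow> y"
            using LIMSEQ_inverse_real_of_nat tendsto_mult_right_zero[of "\<lambda>n. inverse (real (Suc n))" sequentially s]
              tendsto_add[OF tendsto_const[of y]] by (fastforce simp: divide_inverse)
          have "eventually (\<lambda>n. indicator {a..<b} (y + s / real (Suc n)) = (indicator {a..<b} y :: real)) sequentially"
          proof -
            consider "y < a" | "y > b" | "y > a" "y < b" using y by linarith
            then show ?thesis
            proof cases
              case 1
              have "eventually (\<lambda>n. y + s / real (Suc n) < a) sequentially" using order_tendstoD(2)[OF l 1] .
              then show ?thesis by eventually_elim (use 1 in \<open>auto simp: indicator_def\<close>)
            next
              case 2
              have "eventually (\<lambda>n. y + s / real (Suc n) > b) sequentially" using order_tendstoD(1)[OF l 2] .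
              then show ?thesis by eventually_elim (use 2 in \<open>auto simp: indicator_def\<close>)
            next
              case 3
              have "eventually (\<lambda>n. y + s / real (Suc n) < b \<and> y + s / real (Suc n) > a) sequentially"
                by (intro eventually_conj order_tendstoD(2)[OF l 3(2)] order_tendstoD(1)[OF l 3(1)])
              then show ?thesis by eventually_elim (use 3 in \<open>auto simp: indicator_def\<close>)
            qed
          qed
          then show "(\<lambda>n. indicator {a..<b} (y + s / real (Suc n)) *\<^sub>R exp (- pi * s\<^sup>2))
            \<longlonglongrightarrow> indicator {a..<b} y *\<^sub>R exp (- pi * s\<^sup>2)"
            by (intro tendsto_intros tendsto_eventually)
        qed
        show "AE s in lborel. norm (indicator {a..<b} (y + s / real (Suc n)) *\<^sub>R exp (- pi * s\<^sup>2)) \<le> exp (- pi * s\<^sup>2)" for n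
          by (auto simp: indicator_def)
      qed (use e1 in auto)
      then show ?thesis using e2 by simp
    qed
    have Hn_int: "(LINT x|lborel. indicator {a..<b} x *\<^sub>R Hn n x) = (LINT y|lborel. \<psi> n y *\<^sub>R h y)" for n
    proof -
      have int: "integrable (lborel \<Otimes>\<^sub>M lborel)
        (\<lambda>(x, y). indicator {a..<b} x *\<^sub>R (h y * of_real (real (Suc n) * exp (- pi * ((x - y) * real (Suc n))\<^sup>2))))"
      proof (rule lborel_pair.integrable_dominated_by_product[where u = "indicator {a..<b}" and v = "\<lambda>y. real (Suc n) * cmod (h y)"])
        fix x y :: real
        have "exp (- pi * ((x - y) * real (Suc n))\<^sup>2) \<le> 1" by simp
        then have "cmod (h y) * (real (Suc n) * exp (- pi * ((x - y) * real (Suc n))\<^sup>2)) \<le> cmod (h y) * (real (Suc n) * 1)"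
          by (intro mult_left_mono) auto
        then show "norm (indicator {a..<b} x *\<^sub>R (h y * of_real (real (Suc n) * exp (- pi * ((x - y) * real (Suc n))\<^sup>2))))
            \<le> indicator {a..<b} x * (real (Suc n) * cmod (h y))"
          by (auto simp: norm_mult indicator_def mult_ac simp del: of_nat_Suc)
      qed (use h in \<open>auto simp: integrable_indicator_iff fin\<close>)
      have "(LINT x|lborel. indicator {a..<b} x *\<^sub>R Hn n x)
         = (LINT x|lborel. LINT y|lborel. indicator {a..<b} x *\<^sub>R (h y * of_real (real (Suc n) * exp (- pi * ((x - y) * real (Suc n))\<^sup>2))))"
        unfolding Hn_eq by simp
      also have "\<dots> = (LINT y|lborel. LINT x|lborel. indicator {a..<b} x *\<^sub>R (h y * of_real (real (Suc n) * exp (- pi * ((x - y) * real (Suc n))\<^sup>2))))"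
        by (rule lborel_pair.Fubini_integral[OF int, symmetric])
      also have "\<dots> = (LINT y|lborel. \<psi> n y *\<^sub>R h y)"
      proof (intro Bochner_Integration.integral_cong refl)
        fix y :: real
        let ?f = "\<lambda>x::real. indicator {a..<b} x * (real (Suc n) * exp (- pi * ((x - y) * real (Suc n))\<^sup>2)) :: real"
        have "(LINT x|lborel. indicator {a..<b} x *\<^sub>R (h y * of_real (real (Suc n) * exp (- pi * ((x - y) * real (Suc n))\<^sup>2))))
          = (LINT x|lborel. h y * of_real (?f x))"
          by (intro Bochner_Integration.integral_cong refl) (simp add: scaleR_conv_of_real mult_ac del: of_nat_Suc)
        also have "\<dots> = h y * of_real (LINT x|lborel. ?f x)"
          by (simp only: integral_mult_right_zero integral_complex_of_real)
        also have "(LINT x|lborel. ?f x) = \<bar>1 / real (Suc n)\<bar> *\<^sub>R (LINT s|lborel. ?f (y + (1 / real (Suc n)) * s))"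
          by (rule lborel_integral_real_affine) simp
        also have "\<dots> = (LINT s|lborel. \<bar>1 / real (Suc n)\<bar> *\<^sub>R ?f (y + (1 / real (Suc n)) * s))"
          by (rule integral_scaleR_right[symmetric])
        also have "\<dots> = \<psi> n y"
          unfolding \<psi>_def by (intro Bochner_Integration.integral_cong refl) (simp add: field_simps del: of_nat_Suc)
        finally show "(LINT x|lborel. indicator {a..<b} x *\<^sub>R (h y * of_real (real (Suc n) * exp (- pi * ((x - y) * real (Suc n))\<^sup>2)))) = \<psi> n y *\<^sub>R h y"
          by (simp add: scaleR_conv_of_real mult_ac)
      qed
      finally show ?thesis .
    qed
    have L1: "(\<lambda>n. LINT y|lborel. \<psi> n y *\<^sub>R h y) \<longlonglongrightarrow> (LINT y|lborel. indicator {a..<b} y *\<^sub>R h y)"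
    proof (rule integral_dominated_convergence[where w = "\<lambda>y. norm (h y)"])
      have "AE y in lborel. y \<noteq> a" "AE y in lborel. y \<noteq> b" by (auto intro: AE_lborel_singleton)
      then show "AE y in lborel. (\<lambda>n. \<psi> n y *\<^sub>R h y) \<longlonglongrightarrow> indicator {a..<b} y *\<^sub>R h y"
        by eventually_elim (intro tendsto_intros psi_lim)
      show "AE y in lborel. norm (\<psi> n y *\<^sub>R h y) \<le> norm (h y)" for n
        using psi_b by (auto intro!: AE_I2 mult_left_le_one_le)
    qed (use h in auto)
    have L2: "(\<lambda>n. LINT x|lborel. indicator {a..<b} x *\<^sub>R Hn n x) \<longlonglongrightarrow> (LINT x|lborel. indicator {a..<b} x *\<^sub>R H x)"
    proof (rule integral_dominated_convergence[where w = "\<lambda>x. indicator {a..<b} x * C"])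
      show "AE x in lborel. (\<lambda>n. indicator {a..<b} x *\<^sub>R Hn n x) \<longlonglongrightarrow> indicator {a..<b} x *\<^sub>R H x"
        by (intro AE_I2 tendsto_intros Hn_lim)
      show "AE x in lborel. norm (indicator {a..<b} x *\<^sub>R Hn n x) \<le> indicator {a..<b} x * C" for n
        using Hn_bound by (auto simp: indicator_def)
    qed (auto simp: integrable_indicator_iff fin)
    show ?thesis by (rule LIMSEQ_unique[OF L2[unfolded Hn_int] L1])
  qed
  \<comment> \<open>\<open>H\<close> is known to be bounded, which gives integrability of the
    difference on bounded intervals; hence the localisation.\<close>
  have "AE x in lborel. \<forall>N::nat. indicator {- real N..<real N} x *\<^sub>R (h x - H x) = 0"
    unfolding AE_all_countable
  proof
    fix N :: nat
    have i1: "integrable lborel (\<lambda>x. indicator {a..<b} x *\<^sub>R h x)" for a b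
      using integrable_mult_indicator[of "{a..<b}" lborel h] h by simp
    have i2: "integrable lborel (\<lambda>x. indicator {a..<b} x *\<^sub>R H x)" for a b
    proof (rule Bochner_Integration.integrable_bound)
      show "integrable lborel (\<lambda>x. indicator {a..<b} x * C)" by (auto simp: integrable_indicator_iff fin)
      show "AE x in lborel. norm (indicator {a..<b} x *\<^sub>R H x) \<le> norm (indicator {a..<b} x * C)"
        using H_bound by (auto simp: indicator_def intro!: AE_I2 intro: order_trans[OF _ abs_ge_self])
    qed auto
    have D: "(LINT x|lborel. indicator {a..<b} x *\<^sub>R (h x - H x)) = 0" for a b
      using main[of a b] i1[of a b] i2[of a b] by (simp add: scaleR_diff_right)
    show "AE x in lborel. indicator {- real N..<real N} x *\<^sub>R (h x - H x) = 0"
    proof (rule AE_zero_from_halflines)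
      show "integrable lborel (\<lambda>x. indicator {- real N..<real N} x *\<^sub>R (h x - H x))"
        using i1[of "- real N" "real N"] i2[of "- real N" "real N"] by (simp add: scaleR_diff_right)
      show "(LINT x|lborel. indicator {- real N..<real N} x *\<^sub>R (h x - H x)) = 0" by (rule D)
      fix t
      have "(\<lambda>x. indicator {..<t} x *\<^sub>R indicator {- real N..<real N} x *\<^sub>R (h x - H x))
         = (\<lambda>x. indicator {- real N..<min t (real N)} x *\<^sub>R (h x - H x))"
        by (auto simp: indicator_def)
      then show "(LINT x|lborel. indicator {..<t} x *\<^sub>R indicator {- real N..<real N} x *\<^sub>R (h x - H x)) = 0"
        using D by simp
    qed
  qed
  then show ?thesis
  proof eventually_elim
    case (elim x)
    obtain N where "\<bar>x\<bar> < real N" using reals_Archimedean2 by blast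
    then show ?case using elim[rule_format, of N] unfolding H_def by (auto simp: indicator_def)
  qed
qed

section \<open>The Gabor transform\<close>

lemma fst_borel_measurable [measurable (raw)]:
  fixes f :: "'a \<Rightarrow> real \<times> real"
  shows "f \<in> borel_measurable M \<Longrightarrow> (\<lambda>x. fst (f x)) \<in> borel_measurable M"
  by (rule measurable_compose[of f M borel]) (auto intro!: borel_measurable_continuous_onI continuous_intros)

lemma snd_borel_measurable [measurable (raw)]:
  fixes f :: "'a \<Rightarrow> real \<times> real"
  shows "f \<in> borel_measurable M \<Longrightarrow> (\<lambda>x. snd (f x)) \<in> borel_measurable M"
  by (rule measurable_compose[of f M borel]) (auto intro!: borel_measurable_continuous_onI continuous_intros)

section \<open>Gabor functions and their scalar products\<close>

definition gauss_window :: "real \<Rightarrow> real" where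
  "gauss_window t = 2 powr (1/4) * exp (- pi * t\<^sup>2)"

lemma gabor_eq: "gabor \<mu> x = of_real (gauss_window (x - fst \<mu>)) * cis (2 * pi * snd \<mu> * x)"
proof -
  obtain p \<theta> where \<mu>: "\<mu> = (p, \<theta>)" by (cases \<mu>)
  have "gabor \<mu> x = of_real (2 powr (1/4)) *
      exp (of_real (- pi * (x - p)\<^sup>2) + \<i> * of_real (2 * pi * \<theta> * x))"
    unfolding \<mu> gabor_def by (simp add: mult_ac)
  also have "\<dots> = of_real (2 powr (1/4)) * (of_real (exp (- pi * (x - p)\<^sup>2)) * cis (2 * pi * \<theta> * x))"
    unfolding exp_add exp_of_real cis_conv_exp ..
  finally show ?thesis unfolding \<mu> gauss_window_def by (simp add: mult_ac)
qed

lemma gauss_window_nonneg [simp]: "0 \<le> gauss_window t"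
  by (simp add: gauss_window_def)

lemma continuous_on_gauss_window [continuous_intros]:
  "continuous_on S f \<Longrightarrow> continuous_on S (\<lambda>x. gauss_window (f x))"
  unfolding gauss_window_def by (intro continuous_intros) auto

lemma gauss_window_measurable [measurable]: "gauss_window \<in> borel_measurable borel"
  by (intro borel_measurable_continuous_onI continuous_intros)

lemma cmod_gabor: "cmod (gabor \<mu> x) = gauss_window (x - fst \<mu>)"
  by (simp add: gabor_eq norm_mult)

lemma gauss_window_le: "gauss_window t \<le> 2"
proof -
  have "(2::real) powr (1/4) \<le> 2 powr 1" by (intro powr_mono) auto
  moreover have "exp (- pi * t\<^sup>2) \<le> 1" by simp
  ultimately have "(2::real) powr (1/4) * exp (- pi * t\<^sup>2) \<le> 2 * 1" by (intro mult_mono) auto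
  then show ?thesis by (simp add: gauss_window_def)
qed

lemma continuous_on_gabor:
  "continuous_on S f \<Longrightarrow> continuous_on S g \<Longrightarrow> continuous_on S (\<lambda>x. gabor (f x) (g x))"
  unfolding gabor_eq by (intro continuous_intros)

lemma gabor_measurable_pair [measurable (raw)]:
  assumes [measurable]: "f \<in> borel_measurable M" "g \<in> borel_measurable M"
  shows "(\<lambda>x. gabor (f x) (g x)) \<in> borel_measurable M"
  unfolding gabor_eq by measurable

lemma gauss_window_mult:
  "gauss_window (x - p) * gauss_window (x - q)
     = sqrt 2 * exp (- pi / 2 * (p - q)\<^sup>2) * exp (- pi * 2 * (x - (p + q) / 2)\<^sup>2)"
proof -
  have "(2::real) powr (1/4) * 2 powr (1/4) = sqrt 2"
    by (simp add: powr_add[symmetric] powr_half_sqrt)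
  moreover have "- pi * (x - p)\<^sup>2 + - pi * (x - q)\<^sup>2 = - pi / 2 * (p - q)\<^sup>2 + - pi * 2 * (x - (p + q) / 2)\<^sup>2"
    by (simp add: field_simps power2_eq_square)
  then have "exp (- pi * (x - p)\<^sup>2) * exp (- pi * (x - q)\<^sup>2) = exp (- pi / 2 * (p - q)\<^sup>2) * exp (- pi * 2 * (x - (p + q) / 2)\<^sup>2)"
    by (simp only: exp_add[symmetric])
  moreover have "gauss_window (x - p) * gauss_window (x - q) = (2 powr (1/4) * 2 powr (1/4)) *
      (exp (- pi * (x - p)\<^sup>2) * exp (- pi * (x - q)\<^sup>2))"
    unfolding gauss_window_def by (simp only: mult_ac)
  ultimately show ?thesis by (simp only: mult.assoc)
qed

lemma integral_gauss_window_sq: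
  "integrable lborel (\<lambda>p. (gauss_window (x - p))\<^sup>2)" "(LINT p|lborel. (gauss_window (x - p))\<^sup>2) = 1"
proof -
  have e: "(\<lambda>p. (gauss_window (x - p))\<^sup>2) = (\<lambda>p. sqrt 2 * exp (- pi * 2 * (- x + 1 * p)\<^sup>2))"
    using gauss_window_mult[of x _ _] by (auto simp: power2_eq_square[of "gauss_window _"] power2_commute)
  have "integrable lborel (\<lambda>p. exp (- pi * 2 * (- x + 1 * p)\<^sup>2))"
    by (rule lborel_integrable_real_affine[of "\<lambda>p. exp (- pi * 2 * p\<^sup>2)"]) (use gaussian_fourier(1)[of 2] in auto)
  then show "integrable lborel (\<lambda>p. (gauss_window (x - p))\<^sup>2)" unfolding e by simp
  have "(LINT p|lborel. exp (- pi * 2 * p\<^sup>2)) = (LINT p|lborel. exp (- pi * 2 * (- x + 1 * p)\<^sup>2))"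
    using lborel_integral_real_affine[of 1 "\<lambda>p. exp (- pi * 2 * p\<^sup>2)" "- x"] by simp
  then show "(LINT p|lborel. (gauss_window (x - p))\<^sup>2) = 1"
    unfolding e using gaussian_integral[of 2] by simp
qed

lemma sq_integrable_gabor: "sq_integrable lborel (gabor \<mu>)"
proof -
  have "(\<lambda>x. (gauss_window (x - fst \<mu>))\<^sup>2) = (\<lambda>x. (gauss_window (fst \<mu> - x))\<^sup>2)"
    by (simp add: gauss_window_def power2_commute)
  then show ?thesis
    using integral_gauss_window_sq(1)[of "fst \<mu>"] by (simp add: sq_integrable_def cmod_gabor)
qed

lemma L2_iff: "f \<in> L2 \<longleftrightarrow> sq_integrable lborel f"
  by (simp add: L2_def sq_integrable_def)

lemma L2_measurable: "f \<in> L2 \<Longrightarrow> f \<in> borel_measurable borel"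
  by (simp add: L2_def)

lemma L2_inner_gabor_measurable [measurable]:
  assumes [measurable]: "f \<in> borel_measurable borel"
  shows "(\<lambda>\<mu>. L2_inner f (gabor \<mu>)) \<in> borel_measurable borel"
  unfolding L2_inner_def by measurable

lemma L2_inner_integrable: "f \<in> L2 \<Longrightarrow> g \<in> L2 \<Longrightarrow> integrable lborel (\<lambda>x. f x * cnj (g x))"
  by (simp add: L2_iff sq_integrable_mult_cnj)

lemma gabor_L2 [simp]: "gabor \<mu> \<in> L2"
  by (simp add: L2_iff sq_integrable_gabor)

lemma L2_inner_add: "f \<in> L2 \<Longrightarrow> g \<in> L2 \<Longrightarrow> h \<in> L2 \<Longrightarrow>
    L2_inner (\<lambda>x. f x + g x) h = L2_inner f h + L2_inner g h"
  unfolding L2_inner_def by (simp add: L2_inner_integrable algebra_simps)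

lemma L2_inner_cmult: "L2_inner (\<lambda>x. c * f x) h = c * L2_inner f h"
  unfolding L2_inner_def by (simp add: mult.assoc)

text \<open>The product of the two Gaussians is a Gaussian about the midpoint \<open>c\<close>,
  whose Fourier transform at the frequency difference is again a Gaussian. Recentring at
  \<open>c\<close> contributes only a phase, which the modulus removes.\<close>

lemma cmod_L2_inner_gabor:
  "cmod (L2_inner (gabor \<nu>) (gabor \<mu>)) = exp (- pi / 2 * (fst \<nu> - fst \<mu>)\<^sup>2) * exp (- pi / 2 * (snd \<nu> - snd \<mu>)\<^sup>2)"
proof -
  define c where "c = (fst \<nu> + fst \<mu>) / 2"
  define A where "A = sqrt 2 * exp (- pi / 2 * (fst \<nu> - fst \<mu>)\<^sup>2)"
  define t where "t = snd \<nu> - snd \<mu>"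
  have "gabor \<nu> x * cnj (gabor \<mu> x) = A *\<^sub>R (exp (- pi * 2 * (x - c)\<^sup>2) *\<^sub>R cis (2 * pi * x * t))" for x
  proof -
    have "cis (2 * pi * snd \<nu> * x) * cnj (cis (2 * pi * snd \<mu> * x)) = cis (2 * pi * x * t)"
      by (simp add: cis_cnj cis_mult t_def algebra_simps)
    moreover have "complex_of_real (gauss_window (x - fst \<nu>)) * of_real (gauss_window (x - fst \<mu>))
       = of_real (A * exp (- pi * 2 * (x - c)\<^sup>2))"
      unfolding of_real_mult[symmetric] gauss_window_mult A_def c_def ..
    moreover have "gabor \<nu> x * cnj (gabor \<mu> x) = (complex_of_real (gauss_window (x - fst \<nu>)) * of_real (gauss_window (x - fst \<mu>)))
        * (cis (2 * pi * snd \<nu> * x) * cnj (cis (2 * pi * snd \<mu> * x)))"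
      unfolding gabor_eq complex_cnj_mult complex_cnj_complex_of_real by (simp only: mult_ac)
    ultimately show ?thesis by (simp add: scaleR_conv_of_real mult.assoc)
  qed
  then have "L2_inner (gabor \<nu>) (gabor \<mu>) = A *\<^sub>R (LINT x|lborel. exp (- pi * 2 * (x - c)\<^sup>2) *\<^sub>R cis (2 * pi * x * t))"
    unfolding L2_inner_def by (simp only: integral_scaleR_right)
  also have "(LINT x|lborel. exp (- pi * 2 * (x - c)\<^sup>2) *\<^sub>R cis (2 * pi * x * t))
     = (LINT x|lborel. (exp (- pi * 2 * x\<^sup>2) *\<^sub>R cis (2 * pi * x * t)) * cis (2 * pi * c * t))"
    by (subst lborel_integral_real_affine[of 1 _ c]) (auto simp: cis_mult algebra_simps)
  also have "\<dots> = of_real (exp (- pi * t\<^sup>2 / 2) / sqrt 2) * cis (2 * pi * c * t)"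
    by (subst integral_mult_left_zero) (subst gaussian_fourier(2), auto)
  finally show ?thesis by (simp add: norm_mult A_def t_def norm_divide)
qed

lemma L2_inner_gabor_fourier:
  "L2_inner f (gabor (p, \<theta>)) = fourier_transform (\<lambda>x. f x * of_real (gauss_window (x - p))) \<theta>"
  unfolding L2_inner_def fourier_transform_def by (simp add: gabor_eq cis_cnj mult_ac)

text \<open>For fixed \<open>p\<close> the Gabor transform is the Fourier transform of \<open>f\<close> times a Gaussian; inverting it,
  multiplying by the same Gaussian and integrating over \<open>p\<close> recovers \<open>f\<close>.\<close>

theorem gabor_inversion:
  assumes f: "f \<in> L2" and V: "integrable lborel (\<lambda>\<mu>. L2_inner f (gabor \<mu>))"
  shows "AE x in lborel. f x = (LINT \<mu>|lborel. L2_inner f (gabor \<mu>) * gabor \<mu> x)"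
proof -
  have fm [measurable]: "f \<in> borel_measurable borel" using f by (rule L2_measurable)
  define h where "h = (\<lambda>p x. f x * complex_of_real (gauss_window (x - p)))"
  define \<Phi> where "\<Phi> = (\<lambda>p x. LINT \<theta>|lborel. fourier_transform (h p) \<theta> * cis (2 * pi * \<theta> * x))"
  have V': "integrable (lborel \<Otimes>\<^sub>M lborel) (\<lambda>(p, \<theta>). fourier_transform (h p) \<theta>)"
    using V unfolding lborel_prod h_def by (simp add: L2_inner_gabor_fourier[symmetric] case_prod_unfold)
  have hm [measurable]: "h p \<in> borel_measurable borel" for p unfolding h_def by measurable
  have hi: "integrable lborel (h p)" for p
  proof -
    have "(\<lambda>x. f x * cnj (gabor (p, 0) x)) = h p"
      by (auto simp: gabor_eq h_def)
    then show ?thesis using L2_inner_integrable[OF f gabor_L2[of "(p, 0)"]] by simp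
  qed
  have "AE p in lborel. integrable lborel (fourier_transform (h p))"
    using lborel_pair.AE_integrable_fst[OF V'] .
  then have a1: "AE p in lborel. AE x in lborel. h p x = \<Phi> p x"
    by eventually_elim (use fourier_inversion_AE[OF hi] in \<open>simp add: \<Phi>_def\<close>)
  have [measurable]: "(\<lambda>(p, x). h p x) \<in> borel_measurable (borel \<Otimes>\<^sub>M borel)"
    unfolding h_def by measurable
  have [measurable]: "(\<lambda>(p, x). \<Phi> p x) \<in> borel_measurable (borel \<Otimes>\<^sub>M borel)"
    unfolding \<Phi>_def fourier_transform_def h_def by measurable
  \<comment> \<open>Fourier inversion holds for almost every \<open>p\<close> outside a null set of
    \<open>x\<close> depending on \<open>p\<close>. Measurability of the set of good pairs allows
    the two quantifiers to be exchanged, so that for fixed \<open>x\<close> one can integrate over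
    \<open>p\<close>.\<close>
  have "{z \<in> space (lborel \<Otimes>\<^sub>M lborel). h (fst z) (snd z) = \<Phi> (fst z) (snd z)} \<in> sets (lborel \<Otimes>\<^sub>M lborel)"
    by measurable
  from lborel_pair.AE_commute[OF this] a1
  have "AE x in lborel. AE p in lborel. h p x = \<Phi> p x" by simp
  then show ?thesis
  proof eventually_elim
    case (elim x)
    have int: "integrable (lborel \<Otimes>\<^sub>M lborel) (\<lambda>(p, \<theta>). fourier_transform (h p) \<theta> * gabor (p, \<theta>) x)"
    proof (rule Bochner_Integration.integrable_bound)
      show "integrable (lborel \<Otimes>\<^sub>M lborel) (\<lambda>z. 2 * (case z of (p, \<theta>) \<Rightarrow> fourier_transform (h p) \<theta>))"
        using V' by simp
      show "(\<lambda>(p, \<theta>). fourier_transform (h p) \<theta> * gabor (p, \<theta>) x) \<in> borel_measurable (lborel \<Otimes>\<^sub>M lborel)"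
        unfolding fourier_transform_def h_def gabor_eq fst_conv snd_conv by measurable
      show "AE z in lborel \<Otimes>\<^sub>M lborel. norm (case z of (p, \<theta>) \<Rightarrow> fourier_transform (h p) \<theta> * gabor (p, \<theta>) x)
        \<le> norm (2 * (case z of (p, \<theta>) \<Rightarrow> fourier_transform (h p) \<theta>))"
        using gauss_window_le
        by (auto simp: norm_mult cmod_gabor mult.commute[of 2] intro!: AE_I2 mult_left_mono)
    qed
    have "(LINT \<mu>|lborel. L2_inner f (gabor \<mu>) * gabor \<mu> x)
        = (LINT p|lborel. LINT \<theta>|lborel. fourier_transform (h p) \<theta> * gabor (p, \<theta>) x)"
      unfolding lborel_pair.integral_fst[OF int] unfolding lborel_prod h_def
      by (simp add: L2_inner_gabor_fourier[symmetric] case_prod_unfold)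
    also have "\<dots> = (LINT p|lborel. of_real (gauss_window (x - p)) * \<Phi> p x)"
    proof (intro Bochner_Integration.integral_cong refl)
      fix p
      have "(LINT \<theta>|lborel. fourier_transform (h p) \<theta> * gabor (p, \<theta>) x)
        = (LINT \<theta>|lborel. of_real (gauss_window (x - p)) * (fourier_transform (h p) \<theta> * cis (2 * pi * \<theta> * x)))"
        by (simp add: gabor_eq mult_ac)
      then show "(LINT \<theta>|lborel. fourier_transform (h p) \<theta> * gabor (p, \<theta>) x) = of_real (gauss_window (x - p)) * \<Phi> p x"
        unfolding \<Phi>_def by simp
    qed
    also have "\<dots> = (LINT p|lborel. f x * of_real ((gauss_window (x - p))\<^sup>2))"
    proof (rule integral_cong_AE)
      show "AE p in lborel. of_real (gauss_window (x - p)) * \<Phi> p x = f x * of_real ((gauss_window (x - p))\<^sup>2)"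
        using elim by eventually_elim (simp add: h_def power2_eq_square mult_ac flip: \<Phi>_def)
    qed measurable
    also have "\<dots> = f x * of_real (LINT p|lborel. (gauss_window (x - p))\<^sup>2)"
      by (simp only: integral_mult_right_zero integral_complex_of_real)
    also have "\<dots> = f x" by (simp add: integral_gauss_window_sq)
    finally show ?case ..
  qed
qed

section \<open>Continuous representatives\<close>

definition gabor_synthesis :: "(real \<Rightarrow> complex) \<Rightarrow> real \<Rightarrow> complex" where
  "gabor_synthesis f x = (LINT \<mu>|lborel. L2_inner f (gabor \<mu>) * gabor \<mu> x)"

lemma continuous_on_integral_dominated:
  fixes F :: "'a \<Rightarrow> real \<Rightarrow> complex"
  assumes [measurable]: "\<And>x. (\<lambda>\<mu>. F \<mu> x) \<in> borel_measurable M" and w: "integrable M w"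
    and dom: "\<And>\<mu> x. cmod (F \<mu> x) \<le> w \<mu>" and cont: "\<And>\<mu>. continuous_on UNIV (F \<mu>)"
  shows "continuous_on UNIV (\<lambda>x. LINT \<mu>|M. F \<mu> x)"
  unfolding continuous_on_sequentially
proof (intro ballI allI impI)
  fix x :: "nat \<Rightarrow> real" and a assume "(\<forall>n. x n \<in> UNIV) \<and> x \<longlonglongrightarrow> a"
  then have x: "x \<longlonglongrightarrow> a" by simp
  have [measurable]: "w \<in> borel_measurable M" using w by auto
  have "(\<lambda>n. LINT \<mu>|M. F \<mu> (x n)) \<longlonglongrightarrow> (LINT \<mu>|M. F \<mu> a)"
  proof (rule integral_dominated_convergence[where w = w])
    show "AE \<mu> in M. (\<lambda>n. F \<mu> (x n)) \<longlonglongrightarrow> F \<mu> a"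
      using cont x by (intro AE_I2) (auto simp: continuous_on_sequentially o_def)
  qed (use w dom in auto)
  then show "((\<lambda>x. LINT \<mu>|M. F \<mu> x) \<circ> x) \<longlonglongrightarrow> (LINT \<mu>|M. F \<mu> a)" by (simp add: o_def)
qed

text \<open>Two continuous functions differ on an open set; here it is null, hence empty. This makes
  the definite description in \<open>cont_rep\<close> meaningful.\<close>

lemma continuous_rep_unique:
  assumes "continuous_rep f g" "continuous_rep f h"
  shows "g = h"
proof -
  have c: "continuous_on UNIV g" "continuous_on UNIV h"
    and ae: "AE x in lborel. g x = f x" "AE x in lborel. h x = f x"
    using assms by (auto simp: continuous_rep_def)
  have "open {x. g x \<noteq> h x}" using c by (intro open_Collect_neq)
  moreover have "negligible {x. g x \<noteq> h x}"
  proof -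
    have "AE x in lborel. x \<notin> {x. g x \<noteq> h x}" using ae by eventually_elim auto
    then have "{x. g x \<noteq> h x} \<in> null_sets lborel"
      using \<open>open {x. g x \<noteq> h x}\<close> by (subst (asm) AE_iff_null_sets[symmetric]) auto
    then show ?thesis by (simp add: negligible_iff_null_sets null_sets_completionI)
  qed
  ultimately have "{x. g x \<noteq> h x} = {}" using open_not_negligible by blast
  then show ?thesis by auto
qed

lemma cont_rep_eqI:
  assumes "continuous_rep f g" shows "cont_rep f = g"
  unfolding cont_rep_def using assms continuous_rep_unique by (intro the_equality)

lemma cont_rep_gabor_synthesis:
  assumes f: "f \<in> L2" and V: "integrable lborel (\<lambda>\<mu>. L2_inner f (gabor \<mu>))"
  shows "continuous_rep f (gabor_synthesis f)"
proof -
  have [measurable]: "f \<in> borel_measurable borel" using f by (rule L2_measurable)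
  have "continuous_on UNIV (gabor_synthesis f)"
    unfolding gabor_synthesis_def
  proof (rule continuous_on_integral_dominated[where w = "\<lambda>\<mu>. cmod (L2_inner f (gabor \<mu>)) * 2"])
    show "continuous_on UNIV (\<lambda>x. L2_inner f (gabor \<mu>) * gabor \<mu> x)" for \<mu>
      by (intro continuous_intros continuous_on_gabor)
    show "cmod (L2_inner f (gabor \<mu>) * gabor \<mu> x) \<le> cmod (L2_inner f (gabor \<mu>)) * 2" for \<mu> x
      using gauss_window_le by (auto simp: norm_mult cmod_gabor intro!: mult_left_mono)
  qed (use V in auto)
  then show ?thesis
    using gabor_inversion[OF assms] by (auto simp: continuous_rep_def gabor_synthesis_def elim: eventually_mono)
qed

section \<open>The Zak transform of a Gabor function\<close>

lemma summable_on_int_exp_abs: "(\<lambda>q::int. exp (- \<bar>real_of_int q\<bar>)) summable_on UNIV"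
proof -
  have g: "(\<lambda>n::nat. exp (- real n)) summable_on UNIV"
  proof -
    have "summable (\<lambda>n. exp (- 1 :: real) ^ n)" by (rule summable_geometric) simp
    then have "summable (\<lambda>n. exp (- real n))"
      by (simp add: exp_of_nat_mult[symmetric])
    then show ?thesis by (subst summable_on_UNIV_nonneg_real_iff) auto
  qed
  have 1: "(\<lambda>q::int. exp (- \<bar>real_of_int q\<bar>)) summable_on range int"
    by (subst summable_on_reindex) (use g in \<open>auto simp: o_def\<close>)
  have 2: "(\<lambda>q::int. exp (- \<bar>real_of_int q\<bar>)) summable_on range (\<lambda>n. - int n)"
    by (subst summable_on_reindex) (use g in \<open>auto simp: o_def inj_on_def\<close>)
  have "range int \<union> range (\<lambda>n. - int n) = UNIV"
  proof -
    have "q \<in> range int \<union> range (\<lambda>n. - int n)" for q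
      by (cases q rule: int_cases2) auto
    then show ?thesis by auto
  qed
  then show ?thesis using summable_on_union[OF 1 2] by simp
qed

definition lattice_const :: real where
  "lattice_const = exp 1 * (\<Sum>\<^sub>\<infinity>q::int. exp (- \<bar>real_of_int q\<bar>))"

lemma lattice_const_pos: "lattice_const > 0"
proof -
  have "exp (- \<bar>real_of_int 0\<bar>) \<le> (\<Sum>\<^sub>\<infinity>q::int. exp (- \<bar>real_of_int q\<bar>))"
    using finite_sum_le_infsum[OF summable_on_int_exp_abs, of "{0}"] by simp
  then show ?thesis unfolding lattice_const_def by simp
qed

text \<open>Replacing \<open>x\<close> by its integer part changes each exponent by at most 1, which
  the factor \<open>exp 1\<close> in \<open>lattice_const\<close> absorbs; an integer shift permutes
  the terms of the full series. The point is uniformity in \<open>x\<close>.\<close>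

lemma lattice_sum_le:
  assumes "finite A"
  shows "(\<Sum>q\<in>A. exp (- \<bar>x + real_of_int q\<bar>)) \<le> lattice_const"
proof -
  define m where "m = \<lfloor>x\<rfloor>"
  have "exp (- \<bar>x + real_of_int q\<bar>) \<le> exp 1 * exp (- \<bar>real_of_int (q + m)\<bar>)" for q
  proof -
    have "\<bar>real_of_int (q + m)\<bar> - 1 \<le> \<bar>x + real_of_int q\<bar>" unfolding m_def by linarith
    then show ?thesis unfolding exp_add[symmetric] by simp
  qed
  then have "(\<Sum>q\<in>A. exp (- \<bar>x + real_of_int q\<bar>)) \<le> (\<Sum>q\<in>A. exp 1 * exp (- \<bar>real_of_int (q + m)\<bar>))"
    by (rule sum_mono)
  also have "\<dots> = exp 1 * (\<Sum>q\<in>(\<lambda>q. q + m) ` A. exp (- \<bar>real_of_int q\<bar>))"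
    by (subst sum.reindex) (auto simp: sum_distrib_left)
  also have "\<dots> \<le> lattice_const"
    unfolding lattice_const_def
    by (intro mult_left_mono finite_sum_le_infsum summable_on_int_exp_abs) (use assms in auto)
  finally show ?thesis .
qed

lemma lattice_summable:
  fixes F :: "int \<Rightarrow> complex"
  assumes dom: "\<And>q. cmod (F q) \<le> B * exp (- \<bar>x + real_of_int q\<bar>)"
  shows "(\<lambda>q. cmod (F q)) summable_on UNIV" "F summable_on UNIV"
    "(\<Sum>\<^sub>\<infinity>q. cmod (F q)) \<le> B * lattice_const" "cmod (\<Sum>\<^sub>\<infinity>q. F q) \<le> B * lattice_const"
proof -
  have B: "B \<ge> 0"
    using order_trans[OF norm_ge_zero dom[of 0]] by (simp add: zero_le_mult_iff)
  have fin: "(\<Sum>q\<in>A. cmod (F q)) \<le> B * lattice_const" if "finite A" for A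
  proof -
    have "(\<Sum>q\<in>A. cmod (F q)) \<le> (\<Sum>q\<in>A. B * exp (- \<bar>x + real_of_int q\<bar>))" by (intro sum_mono dom)
    also have "\<dots> \<le> B * lattice_const"
      unfolding sum_distrib_left[symmetric] by (intro mult_left_mono lattice_sum_le that B)
    finally show ?thesis .
  qed
  show s: "(\<lambda>q. cmod (F q)) summable_on UNIV"
    by (rule nonneg_bounded_partial_sums_imp_summable_on) (use fin in \<open>auto intro!: eventually_finite_subsets_at_top_weakI\<close>)
  then show "F summable_on UNIV" by (rule abs_summable_summable)
  show le: "(\<Sum>\<^sub>\<infinity>q. cmod (F q)) \<le> B * lattice_const"
    by (rule infsum_le_finite_sums[OF s]) (use fin in auto)
  show "cmod (\<Sum>\<^sub>\<infinity>q. F q) \<le> B * lattice_const"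
    using norm_infsum_bound[OF s] le by simp
qed

text \<open>Since pi > 3, \<open>pi * t\<^sup>2 - 2 * \<bar>t\<bar> + 1\<close> dominates
  \<open>(\<bar>t\<bar> - 1)\<^sup>2 + 2 * t\<^sup>2\<close>, so the Gaussian decays like
  \<open>exp (- 2 * \<bar>t\<bar>)\<close>; half of this rate pays for
  \<open>1 + \<bar>t\<bar>\<close>, a factor that derivatives of the window and of the phases
  produce.\<close>

lemma gauss_window_exp_le: "(1 + \<bar>t\<bar>) * gauss_window t \<le> 2 * exp 1 * exp (- \<bar>t\<bar>)"
proof -
  have "0 \<le> (\<bar>t\<bar> - 1)\<^sup>2 + 2 * t\<^sup>2" by simp
  also have "\<dots> \<le> pi * t\<^sup>2 - 2 * \<bar>t\<bar> + 1"
    using mult_right_mono[of 3 pi "t\<^sup>2"] pi_gt3 by (simp add: power2_diff)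
  finally have e: "- pi * t\<^sup>2 \<le> 1 - 2 * \<bar>t\<bar>" by simp
  have "(2::real) powr (1/4) \<le> 2 powr 1" by (intro powr_mono) auto
  then have "gauss_window t \<le> 2 * exp (1 - 2 * \<bar>t\<bar>)"
    unfolding gauss_window_def using e by (intro mult_mono) auto
  then have "(1 + \<bar>t\<bar>) * gauss_window t \<le> exp \<bar>t\<bar> * (2 * exp (1 - 2 * \<bar>t\<bar>))"
    by (intro mult_mono) auto
  also have "\<dots> = 2 * (exp \<bar>t\<bar> * exp (1 - 2 * \<bar>t\<bar>))" by (simp only: mult_ac)
  also have "exp \<bar>t\<bar> * exp (1 - 2 * \<bar>t\<bar>) = exp 1 * exp (- \<bar>t\<bar>)"
    unfolding exp_add[symmetric] by simp
  finally show ?thesis by simp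
qed

lemma gauss_window_le_exp: "gauss_window t \<le> 2 * exp 1 * exp (- \<bar>t\<bar>)"
proof -
  have "1 * gauss_window t \<le> (1 + \<bar>t\<bar>) * gauss_window t" by (intro mult_right_mono) auto
  then show ?thesis using gauss_window_exp_le[of t] by simp
qed

text \<open>Mean value estimate on the ball of radius 1 about \<open>t\<close>, where the
  exponential bound varies by a factor \<open>exp 1\<close> at most. Keeping the decay in
  \<open>t\<close> leaves the differences summable over the integers.\<close>

lemma gauss_window_Lipschitz:
  assumes "\<bar>t - t'\<bar> \<le> 1"
  shows "\<bar>gauss_window t - gauss_window t'\<bar> \<le> \<bar>t - t'\<bar> * (4 * pi * exp 2 * exp (- \<bar>t\<bar>))"
proof -
  have d: "(gauss_window has_real_derivative (- 2 * pi * s * gauss_window s)) (at s within S)" for s S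
    unfolding gauss_window_def[abs_def] by (auto intro!: derivative_eq_intros)
  have b: "\<bar>- 2 * pi * s * gauss_window s\<bar> \<le> 4 * pi * exp 2 * exp (- \<bar>t\<bar>)" if s: "\<bar>s - t\<bar> \<le> 1" for s
  proof -
    have "\<bar>- 2 * pi * s * gauss_window s\<bar> = 2 * pi * (\<bar>s\<bar> * gauss_window s)" by (simp add: abs_mult)
    also have "\<dots> \<le> 2 * pi * ((1 + \<bar>s\<bar>) * gauss_window s)" by (intro mult_left_mono mult_right_mono) auto
    also have "\<dots> \<le> 2 * pi * (2 * exp 1 * exp (- \<bar>s\<bar>))" by (intro mult_left_mono gauss_window_exp_le) auto
    also have "\<dots> \<le> 2 * pi * (2 * exp 1 * exp (1 - \<bar>t\<bar>))" using s by (intro mult_left_mono) auto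
    also have "\<dots> = 4 * pi * (exp 1 * exp (1 - \<bar>t\<bar>))" by simp
    also have "exp 1 * exp (1 - \<bar>t\<bar>) = exp 2 * exp (- \<bar>t\<bar>)" unfolding exp_add[symmetric] by simp
    finally show ?thesis by simp
  qed
  have "norm (gauss_window t - gauss_window t') \<le> (4 * pi * exp 2 * exp (- \<bar>t\<bar>)) * norm (t - t')"
    by (rule field_differentiable_bound[of "cball t 1" gauss_window "\<lambda>s. - 2 * pi * s * gauss_window s"])
       (use d b assms in \<open>auto simp: dist_real_def abs_minus_commute\<close>)
  then show ?thesis by (simp add: mult.commute)
qed

lemma cmod_cis_diff_le: "cmod (cis a - cis b) \<le> \<bar>a - b\<bar>"
proof -
  have "cis a - cis b = cis b * (cis (a - b) - 1)"
    by (simp add: right_diff_distrib cis_mult)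
  moreover have "cmod (cis (a - b) - 1) \<le> \<bar>a - b\<bar>"
    using iexp_approx1[of "a - b" 0] by (simp add: cis_conv_exp)
  ultimately show ?thesis by (simp add: norm_mult)
qed

section \<open>Regularity of the Zak transform of a Gabor function\<close>

definition zak_gabor :: "real \<times> real \<Rightarrow> real \<Rightarrow> real \<Rightarrow> complex" where
  "zak_gabor \<mu> y \<xi> = (\<Sum>\<^sub>\<infinity>q. fourier_char q \<xi> * gabor \<mu> (y + of_int q))"

lemma zak_gabor_term_le:
  "cmod (fourier_char q \<xi> * gabor \<mu> (y + of_int q)) \<le> (2 * exp 1) * exp (- \<bar>(y - fst \<mu>) + of_int q\<bar>)"
  using gauss_window_le_exp[of "y + of_int q - fst \<mu>"] by (simp add: norm_mult cmod_gabor algebra_simps)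

lemma gabor_term_le:
  "cmod (gabor \<mu> (y + of_int q)) \<le> (2 * exp 1) * exp (- \<bar>(y - fst \<mu>) + of_int q\<bar>)"
  using zak_gabor_term_le[of q 0 \<mu> y] by (simp add: norm_mult)

lemma zak_gabor_summable: "(\<lambda>q. fourier_char q \<xi> * gabor \<mu> (y + of_int q)) summable_on UNIV"
  by (rule lattice_summable(2)[OF zak_gabor_term_le])

lemma cmod_zak_gabor_le: "cmod (zak_gabor \<mu> y \<xi>) \<le> 2 * exp 1 * lattice_const"
  unfolding zak_gabor_def by (rule lattice_summable(4)[OF zak_gabor_term_le])

text \<open>Each term is a window times a phase. The phase changes by 2 pi times
  \<open>of_int q * (\<xi> - \<xi>') + \<theta> * (y - y')\<close>, and only the integers
  \<open>q\<close> near \<open>p\<close> matter, the distance being measured by \<open>t\<close>;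
  therefore the constant grows linearly in \<open>norm \<mu>\<close>, while the factor
  \<open>1 + \<bar>t\<bar>\<close> disappears in the Gaussian.\<close>

lemma zak_gabor_Lipschitz:
  assumes y: "\<bar>y\<bar> \<le> 1" and r: "\<bar>y - y'\<bar> \<le> r" "\<bar>\<xi> - \<xi>'\<bar> \<le> r" "r \<le> 1"
  shows "cmod (zak_gabor \<mu> y \<xi> - zak_gabor \<mu> y' \<xi>')
    \<le> (8 * pi * exp 1 + 4 * pi * exp 2) * lattice_const * ((1 + norm \<mu>) * r)"
proof -
  have r0: "r \<ge> 0" using r by linarith
  obtain p \<theta> where \<mu>: "\<mu> = (p, \<theta>)" by (cases \<mu>)
  have p: "\<bar>p\<bar> \<le> norm \<mu>" "\<bar>\<theta>\<bar> \<le> norm \<mu>" using norm_fst_le[of p \<theta>] norm_snd_le[of \<theta> p] by (auto simp: \<mu>)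
  have T: "cmod (fourier_char q \<xi> * gabor \<mu> (y + of_int q) - fourier_char q \<xi>' * gabor \<mu> (y' + of_int q))
      \<le> ((8 * pi * exp 1 + 4 * pi * exp 2) * ((1 + norm \<mu>) * r)) * exp (- \<bar>(y - p) + of_int q\<bar>)" for q
  proof -
    define t where "t = y + of_int q - p"
    define t' where "t' = y' + of_int q - p"
    define A where "A = 2 * pi * of_int q * \<xi> + 2 * pi * \<theta> * (y + of_int q)"
    define A' where "A' = 2 * pi * of_int q * \<xi>' + 2 * pi * \<theta> * (y' + of_int q)"
    have e: "fourier_char q \<xi> * gabor \<mu> (y + of_int q) - fourier_char q \<xi>' * gabor \<mu> (y' + of_int q)
       = (cis A - cis A') * of_real (gauss_window t) + cis A' * of_real (gauss_window t - gauss_window t')"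
      unfolding fourier_char_def gabor_eq \<mu> fst_conv snd_conv A_def A'_def cis_mult[symmetric] t_def t'_def
      by (simp add: algebra_simps)
    have "A - A' = (2 * pi) * (of_int q * (\<xi> - \<xi>') + \<theta> * (y - y'))"
      unfolding A_def A'_def by (simp add: algebra_simps)
    then have "\<bar>A - A'\<bar> = 2 * pi * \<bar>of_int q * (\<xi> - \<xi>') + \<theta> * (y - y')\<bar>"
      by (simp add: abs_mult)
    also have "\<dots> \<le> 2 * pi * (\<bar>of_int q\<bar> * r + \<bar>\<theta>\<bar> * r)"
      by (intro mult_left_mono order_trans[OF abs_triangle_ineq] add_mono) (use r in \<open>auto simp: abs_mult intro!: mult_left_mono\<close>)
    also have "\<dots> = 2 * pi * r * (\<bar>of_int q\<bar> + \<bar>\<theta>\<bar>)" by (simp add: algebra_simps)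
    also have "\<dots> \<le> 2 * pi * r * (2 * ((1 + norm \<mu>) * (1 + \<bar>t\<bar>)))"
    proof (intro mult_left_mono)
      have "\<bar>of_int q\<bar> \<le> \<bar>t\<bar> + \<bar>y\<bar> + \<bar>p\<bar>" unfolding t_def by linarith
      moreover have "(1 + norm \<mu>) * (1 + \<bar>t\<bar>) = 1 + \<bar>t\<bar> + norm \<mu> + norm \<mu> * \<bar>t\<bar>" by (simp add: algebra_simps)
      moreover have "0 \<le> norm \<mu> * \<bar>t\<bar>" by simp
      ultimately show "\<bar>of_int q\<bar> + \<bar>\<theta>\<bar> \<le> 2 * ((1 + norm \<mu>) * (1 + \<bar>t\<bar>))" using p y by linarith
    qed (use r0 in auto)
    finally have A: "\<bar>A - A'\<bar> \<le> 4 * pi * r * (1 + norm \<mu>) * (1 + \<bar>t\<bar>)" by (simp add: algebra_simps)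
    have "cmod ((cis A - cis A') * of_real (gauss_window t)) \<le> (4 * pi * r * (1 + norm \<mu>) * (1 + \<bar>t\<bar>)) * gauss_window t"
      using order_trans[OF cmod_cis_diff_le A] by (simp add: norm_mult mult_right_mono)
    also have "\<dots> = 4 * pi * r * (1 + norm \<mu>) * ((1 + \<bar>t\<bar>) * gauss_window t)" by (simp only: mult_ac)
    also have "\<dots> \<le> 4 * pi * r * (1 + norm \<mu>) * (2 * exp 1 * exp (- \<bar>t\<bar>))"
      using r0 by (intro mult_left_mono gauss_window_exp_le) auto
    finally have 1: "cmod ((cis A - cis A') * of_real (gauss_window t)) \<le> 4 * pi * r * (1 + norm \<mu>) * (2 * exp 1 * exp (- \<bar>t\<bar>))" .
    have tt: "t - t' = y - y'" by (simp add: t_def t'_def)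
    have "cmod (cis A' * of_real (gauss_window t - gauss_window t')) = \<bar>gauss_window t - gauss_window t'\<bar>"
      unfolding norm_mult norm_of_real norm_cis by simp
    also have "\<dots> \<le> \<bar>t - t'\<bar> * (4 * pi * exp 2 * exp (- \<bar>t\<bar>))"
      by (rule gauss_window_Lipschitz) (use r tt in linarith)
    also have "\<dots> \<le> ((1 + norm \<mu>) * r) * (4 * pi * exp 2 * exp (- \<bar>t\<bar>))"
    proof (rule mult_right_mono)
      have "0 \<le> norm \<mu> * r" using r0 by simp
      moreover have "(1 + norm \<mu>) * r = r + norm \<mu> * r" by (simp add: algebra_simps)
      ultimately show "\<bar>t - t'\<bar> \<le> (1 + norm \<mu>) * r" unfolding tt using r by linarith
    qed auto
    finally have 2: "cmod (cis A' * of_real (gauss_window t - gauss_window t')) \<le> ((1 + norm \<mu>) * r) * (4 * pi * exp 2 * exp (- \<bar>t\<bar>))" .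
    have "cmod (fourier_char q \<xi> * gabor \<mu> (y + of_int q) - fourier_char q \<xi>' * gabor \<mu> (y' + of_int q))
      \<le> 4 * pi * r * (1 + norm \<mu>) * (2 * exp 1 * exp (- \<bar>t\<bar>)) + ((1 + norm \<mu>) * r) * (4 * pi * exp 2 * exp (- \<bar>t\<bar>))"
      unfolding e by (rule order_trans[OF norm_triangle_ineq add_mono[OF 1 2]])
    also have "\<dots> = ((8 * pi * exp 1 + 4 * pi * exp 2) * ((1 + norm \<mu>) * r)) * exp (- \<bar>t\<bar>)"
      by (simp add: algebra_simps)
    also have "t = (y - p) + of_int q" by (simp add: t_def)
    finally show ?thesis .
  qed
  have "((\<lambda>q. fourier_char q \<xi> * gabor \<mu> (y + of_int q) + - (fourier_char q \<xi>' * gabor \<mu> (y' + of_int q)))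
      has_sum (zak_gabor \<mu> y \<xi> + - zak_gabor \<mu> y' \<xi>')) UNIV"
    unfolding zak_gabor_def by (intro has_sum_add has_sum_uminusI has_sum_infsum zak_gabor_summable)
  then have "zak_gabor \<mu> y \<xi> - zak_gabor \<mu> y' \<xi>'
     = (\<Sum>\<^sub>\<infinity>q. fourier_char q \<xi> * gabor \<mu> (y + of_int q) - fourier_char q \<xi>' * gabor \<mu> (y' + of_int q))"
    by (simp add: infsumI)
  then show ?thesis using lattice_summable(4)[OF T] by (simp add: mult_ac)
qed

text \<open>Interpolation between the Lipschitz estimate and the uniform bound by means of
  \<open>min 1 s \<le> s powr \<alpha>\<close>. The Lipschitz estimate would cost a full power of
  \<open>norm \<mu>\<close>, for which an exponent \<delta> slightly above 2 leaves no room.\<close>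

lemma zak_gabor_Hoelder:
  assumes \<alpha>: "0 \<le> \<alpha>" "\<alpha> \<le> 1" and y: "y \<in> {0..1}" and \<xi>: "\<xi> \<in> {0..1}"
  shows "cmod (zak_gabor \<mu> y \<xi> - zak_gabor \<mu> (1/2) (1/2))
    \<le> (8 * pi * exp 1 + 4 * pi * exp 2 + 4 * exp 1) * lattice_const * ((1 + norm \<mu>) powr \<alpha> * norm (y - 1/2, \<xi> - 1/2) powr \<alpha>)"
proof -
  define r where "r = norm (y - 1/2, \<xi> - 1/2)"
  define C where "C = (8 * pi * exp 1 + 4 * pi * exp 2 + 4 * exp 1) * lattice_const"
  have C: "C \<ge> 0" using lattice_const_pos by (simp add: C_def)
  have rb: "\<bar>y - 1/2\<bar> \<le> r" "\<bar>\<xi> - 1/2\<bar> \<le> r"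
    using norm_fst_le[of "y - 1/2" "\<xi> - 1/2"] norm_snd_le[of "\<xi> - 1/2" "y - 1/2"] by (auto simp: r_def)
  have r1: "r \<le> 1"
    using norm_Pair_le[of "y - 1/2" "\<xi> - 1/2"] y \<xi> unfolding r_def by (auto simp: abs_if split: if_splits)
  have r0: "r \<ge> 0" by (simp add: r_def)
  let ?D = "cmod (zak_gabor \<mu> y \<xi> - zak_gabor \<mu> (1/2) (1/2))"
  have "?D \<le> (8 * pi * exp 1 + 4 * pi * exp 2) * lattice_const * ((1 + norm \<mu>) * r)"
    by (rule zak_gabor_Lipschitz) (use rb r1 y in auto)
  also have "\<dots> \<le> C * ((1 + norm \<mu>) * r)"
    unfolding C_def using r0 lattice_const_pos by (intro mult_right_mono) auto
  finally have 1: "?D \<le> C * ((1 + norm \<mu>) * r)" .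
  have "?D \<le> 2 * (2 * exp 1 * lattice_const)"
    using norm_triangle_ineq4[of "zak_gabor \<mu> y \<xi>" "zak_gabor \<mu> (1/2) (1/2)"]
      cmod_zak_gabor_le[of \<mu> y \<xi>] cmod_zak_gabor_le[of \<mu> "1/2" "1/2"] by linarith
  also have "\<dots> = (4 * exp 1) * lattice_const" by simp
  also have "\<dots> \<le> C" unfolding C_def using lattice_const_pos by (intro mult_right_mono) auto
  finally have 2: "?D \<le> C" .
  have t: "min 1 s \<le> s powr \<alpha>" if "s \<ge> 0" for s :: real
  proof (cases "s \<le> 1")
    case True
    show ?thesis
    proof (cases "s = 0")
      case False
      then have "s powr 1 \<le> s powr \<alpha>" using True that \<alpha> by (intro powr_mono') auto
      then show ?thesis using that False by simp
    qed simp
  next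
    case False
    then show ?thesis using ge_one_powr_ge_zero[of s \<alpha>] \<alpha> by simp
  qed
  have "?D \<le> C * min 1 ((1 + norm \<mu>) * r)" using 1 2 by (simp add: min_def)
  also have "\<dots> \<le> C * (((1 + norm \<mu>) * r) powr \<alpha>)" using C r0 by (intro mult_left_mono t) auto
  also have "((1 + norm \<mu>) * r) powr \<alpha> = (1 + norm \<mu>) powr \<alpha> * r powr \<alpha>" using r0 by (simp add: powr_mult)
  finally show ?thesis unfolding C_def r_def .
qed

section \<open>Quasi-periodicity and values at the centre of the square\<close>

text \<open>Shifting the summation index by \<open>m\<close> undoes the translation and leaves a
  character in \<xi>; an integer frequency is insensitive to integer shifts of \<open>y\<close> and
  comes out as a character.\<close>

lemma zak_gabor_lattice:
  "zak_gabor (of_int m, of_int n) y \<xi> = torus_char (m, n) (y, \<xi>) * zak_gabor 0 y \<xi>"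
proof -
  have "zak_gabor (of_int m, of_int n) y \<xi>
     = (\<Sum>\<^sub>\<infinity>q. fourier_char (q + m) \<xi> * gabor (of_int m, of_int n) (y + of_int (q + m)))"
    unfolding zak_gabor_def
    by (rule infsum_reindex_bij_betw[symmetric]) (rule bij_betwI[where g = "\<lambda>q. q - m"], auto)
  also have "\<dots> = (\<Sum>\<^sub>\<infinity>q. torus_char (m, n) (y, \<xi>) * (fourier_char q \<xi> * gabor 0 (y + of_int q)))"
  proof (intro infsum_cong)
    fix q
    have "cis (2 * pi * of_int n * (y + of_int (q + m))) = fourier_char n (y + of_int (q + m))"
      by (simp add: fourier_char_def)
    also have "\<dots> = fourier_char n y" unfolding fourier_char_add by (simp only: fourier_char_of_int mult_1_right)
    finally have 1: "cis (2 * pi * of_int n * (y + of_int (q + m))) = fourier_char n y" .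
    have 2: "fourier_char (q + m) \<xi> = fourier_char q \<xi> * fourier_char m \<xi>"
      by (simp add: fourier_char_def cis_mult algebra_simps)
    show "fourier_char (q + m) \<xi> * gabor (of_int m, of_int n) (y + of_int (q + m))
      = torus_char (m, n) (y, \<xi>) * (fourier_char q \<xi> * gabor 0 (y + of_int q))"
      unfolding gabor_eq fst_conv snd_conv 1 2 torus_char_def by (simp add: mult_ac)
  qed
  also have "\<dots> = torus_char (m, n) (y, \<xi>) * zak_gabor 0 y \<xi>"
    unfolding zak_gabor_def by (rule infsum_cmult_right')
  finally show ?thesis .
qed

lemma gauss_window_int_summable: "(\<lambda>q::int. gauss_window (of_int q)) summable_on UNIV"
proof -
  have "(\<lambda>q::int. cmod (complex_of_real (gauss_window (of_int q)))) summable_on UNIV"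
    by (rule lattice_summable(1)[of _ "2 * exp 1" 0]) (use gauss_window_le_exp in simp)
  then show ?thesis by simp
qed

lemma infsum_gauss_window_int:
  "(\<Sum>\<^sub>\<infinity>q::int. complex_of_real (gauss_window (of_int q))) = of_real (\<Sum>\<^sub>\<infinity>q::int. gauss_window (of_int q))"
  by (rule infsumI has_sum_of_real has_sum_infsum gauss_window_int_summable)+

lemma Theta_0: "Theta 0 = of_real (\<Sum>\<^sub>\<infinity>q::int. gauss_window (of_int q))"
proof -
  have "(\<Sum>\<^sub>\<infinity>q::int. complex_of_real (gauss_window (of_int q)))
     = (\<Sum>\<^sub>\<infinity>q::int. of_real (2 powr (1/4)) * exp (2 * of_real pi * \<i> * of_int q * 0 - of_real pi * (of_int q)\<^sup>2))"
    by (intro infsum_cong) (simp add: gauss_window_def exp_of_real[symmetric])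
  also have "\<dots> = Theta 0" unfolding Theta_def by (rule infsum_cmult_right')
  finally show ?thesis by (simp add: infsum_gauss_window_int)
qed

lemma Theta_0_nz: "Theta 0 \<noteq> 0"
proof -
  have "0 < gauss_window (of_int 0)" by (simp add: gauss_window_def)
  also have "\<dots> \<le> (\<Sum>\<^sub>\<infinity>q::int. gauss_window (of_int q))"
    using finite_sum_le_infsum[OF gauss_window_int_summable, of "{0}"] by simp
  finally show ?thesis unfolding Theta_0 by simp
qed

text \<open>At the centre, the phases of all terms agree up to multiples of 2 pi, so that nothing
  cancels and the Gaussians add up to \<open>Theta 0\<close>. The case \<open>m = n = 0\<close>
  normalises the sharp functional; the other points provide the test functions that show it to be
  unbounded.\<close>

lemma zak_gabor_half:
  "zak_gabor (of_int m + 1/2, of_int n + 1/2) (1/2) (1/2) = (-1) powi n * (\<i> * Theta 0)"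
proof -
  have "zak_gabor (of_int m + 1/2, of_int n + 1/2) (1/2) (1/2)
     = (\<Sum>\<^sub>\<infinity>q. (-1) powi n * \<i> * complex_of_real (gauss_window (of_int (q - m))))"
    unfolding zak_gabor_def
  proof (intro infsum_cong)
    fix q
    have "2 * pi * of_int q * (1/2) + 2 * pi * (of_int n + 1/2) * (1/2 + of_int q)
       = (pi * of_int n + pi / 2) + 2 * pi * of_int (q * (n + 1))"
      by (simp add: field_simps)
    then have "cis (2 * pi * of_int q * (1/2)) * cis (2 * pi * (of_int n + 1/2) * (1/2 + of_int q))
       = cis (pi * of_int n) * cis (pi / 2) * cis (2 * pi * of_int (q * (n + 1)))"
      unfolding cis_mult by simp
    also have "cis (2 * pi * of_int (q * (n + 1))) = 1" using cis_multiple_2pi[of "of_int (q * (n + 1))"] by simp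
    also have "cis (pi * of_int n) = (-1) powi n"
      using cis_power_int[of pi n] by (simp add: mult.commute)
    finally have c: "cis (2 * pi * of_int q * (1/2)) * cis (2 * pi * (of_int n + 1/2) * (1/2 + of_int q)) = (-1) powi n * \<i>"
      by simp
    have "fourier_char q (1/2) * gabor (of_int m + 1/2, of_int n + 1/2) (1/2 + of_int q)
      = (cis (2 * pi * of_int q * (1/2)) * cis (2 * pi * (of_int n + 1/2) * (1/2 + of_int q))) * of_real (gauss_window (of_int (q - m)))"
      unfolding gabor_eq fourier_char_def fst_conv snd_conv by (simp add: mult_ac algebra_simps)
    then show "fourier_char q (1/2) * gabor (of_int m + 1/2, of_int n + 1/2) (1/2 + of_int q)
      = (-1) powi n * \<i> * of_real (gauss_window (of_int (q - m)))" unfolding c .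
  qed
  also have "\<dots> = (-1) powi n * \<i> * (\<Sum>\<^sub>\<infinity>q. complex_of_real (gauss_window (of_int (q - m))))"
    by (rule infsum_cmult_right')
  also have "(\<Sum>\<^sub>\<infinity>q. complex_of_real (gauss_window (of_int (q - m)))) = (\<Sum>\<^sub>\<infinity>q. complex_of_real (gauss_window (of_int q)))"
    by (rule infsum_reindex_bij_betw) (rule bij_betwI[where g = "\<lambda>q. q + m"], auto)
  finally show ?thesis by (simp add: Theta_0 infsum_gauss_window_int)
qed

text \<open>With \<open>z = exp (- 2 * pi * (y - 1/2)) * cis (2 * pi * (\<xi> - 1/2))\<close>, the terms with indices \<open>k\<close> and
  \<open>- 1 - k\<close> of the Zak transform of the Gaussian add up to a multiple of \<open>z ^ (2 * k + 1) - 1\<close>.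
  All these are divisible by \<open>z - 1\<close>, and the term with \<open>k = 0\<close> dominates the others.\<close>

lemma zak_gabor_zero_pairing:
  fixes y \<xi> :: real
  defines "s \<equiv> y - 1/2" and "t \<equiv> \<xi> - 1/2"
  defines "z \<equiv> complex_of_real (exp (- 2 * pi * s)) * cis (2 * pi * t)"
  defines "b \<equiv> \<lambda>k::nat. 2 powr (1/4) * exp (- pi * ((k + 1/2)\<^sup>2 + s\<^sup>2)) * exp (- pi * s)"
  shows "fourier_char (int k) \<xi> * gabor 0 (y + of_int (int k))
      + fourier_char (- 1 - int k) \<xi> * gabor 0 (y + of_int (- 1 - int k))
      = (-1) ^ k * of_real (b k) * (inverse z ^ (k + 1) * (z ^ (2 * k + 1) - 1))"
proof -
  have z0: "z \<noteq> 0" by (simp add: z_def)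
  have zk: "z ^ n = of_real (exp (- 2 * pi * s * n)) * cis (2 * pi * t * n)" for n :: nat
    unfolding z_def power_mult_distrib of_real_power[symmetric] exp_of_nat_mult[symmetric] Complex.DeMoivre
    by (simp add: mult_ac)
  have iz: "inverse z ^ n = of_real (exp (2 * pi * s * n)) * cis (- (2 * pi * t * n))" for n :: nat
    unfolding power_inverse zk by (simp add: cis_inverse exp_minus of_real_inverse[symmetric] del: of_real_inverse)
  have c1: "fourier_char (int k) \<xi> = (-1) ^ k * cis (2 * pi * t * k)" for k
  proof -
    have "fourier_char (int k) \<xi> = cis (real k * pi) * cis (2 * pi * t * k)"
      by (simp add: fourier_char_def cis_mult t_def algebra_simps)
    then show ?thesis by (simp add: Complex.DeMoivre[symmetric])
  qed
  have c2: "fourier_char (- 1 - int k) \<xi> = - ((-1) ^ k * cis (- (2 * pi * t * (k + 1))))" for k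
  proof -
    have "fourier_char (- 1 - int k) \<xi> = cnj (fourier_char (int (k + 1)) \<xi>)"
      using fourier_char_mult_cnj[of 0 \<xi> "int (k + 1)"] by (simp add: algebra_simps)
    then show ?thesis unfolding c1 by (simp add: cis_cnj)
  qed
  have g1: "gauss_window (y + of_int (int k)) = b k * exp (- 2 * pi * s * k)"
  proof -
    have "- pi * (y + of_int (int k))\<^sup>2 = (- pi * ((k + 1/2)\<^sup>2 + s\<^sup>2) + - pi * s) + (- 2 * pi * s * k)"
      by (simp add: s_def power2_eq_square algebra_simps)
    then have "exp (- pi * (y + of_int (int k))\<^sup>2) = exp (- pi * ((k + 1/2)\<^sup>2 + s\<^sup>2)) * exp (- pi * s) * exp (- 2 * pi * s * k)"
      by (simp only: exp_add)
    then show ?thesis by (simp only: gauss_window_def b_def mult_ac)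
  qed
  have g2: "gauss_window (y + of_int (- 1 - int k)) = b k * exp (2 * pi * s * (k + 1))"
  proof -
    have "- pi * (y + of_int (- 1 - int k))\<^sup>2 = (- pi * ((k + 1/2)\<^sup>2 + s\<^sup>2) + - pi * s) + (2 * pi * s * (k + 1))"
      by (simp add: s_def power2_eq_square algebra_simps)
    then have "exp (- pi * (y + of_int (- 1 - int k))\<^sup>2) = exp (- pi * ((k + 1/2)\<^sup>2 + s\<^sup>2)) * exp (- pi * s) * exp (2 * pi * s * (k + 1))"
      by (simp only: exp_add)
    then show ?thesis by (simp only: gauss_window_def b_def mult_ac)
  qed
  have "inverse z ^ (k + 1) * (z ^ (2 * k + 1) - 1) = z ^ k - inverse z ^ (k + 1)"
  proof -
    have "z ^ (2 * k + 1) = z ^ (k + 1) * z ^ k" by (simp add: power_add[symmetric] mult_2)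
    moreover have "inverse z ^ (k + 1) * z ^ (k + 1) = 1"
      unfolding power_mult_distrib[symmetric] using z0 by simp
    ultimately show ?thesis
      by (simp only: right_diff_distrib mult.assoc[symmetric] mult_1_left mult_1_right)
  qed
  then show ?thesis
    unfolding gabor_eq fst_zero snd_zero c1 c2 zk iz
    by (simp only: g1 g2 diff_zero mult_zero_right mult_zero_left cis_zero mult_1_right of_real_mult)
       (simp add: algebra_simps)
qed

text \<open>The cubic Taylor remainder is at most 64/150 of \<open>\<bar>x\<bar>\<close>. The range
  8/5 covers pi/2, as pi < 16/5.\<close>

lemma abs_sin_ge:
  fixes x :: real
  assumes "\<bar>x\<bar> \<le> 8/5"
  shows "\<bar>x\<bar> / 2 \<le> \<bar>sin x\<bar>"
proof -
  have "\<bar>sin x - (\<Sum>m<3. sin_coeff m * x ^ m)\<bar> \<le> inverse (fact 3) * \<bar>x\<bar> ^ 3"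
    by (rule Maclaurin_sin_bound)
  moreover have "(\<Sum>m<3. sin_coeff m * x ^ m) = x"
    by (simp add: sin_coeff_def numeral_3_eq_3)
  moreover have "inverse (fact 3) * \<bar>x\<bar> ^ 3 = (\<bar>x\<bar> / 6) * \<bar>x\<bar>\<^sup>2"
    by (simp add: fact_numeral power3_eq_cube power2_eq_square)
  moreover have "(\<bar>x\<bar> / 6) * \<bar>x\<bar>\<^sup>2 \<le> (\<bar>x\<bar> / 6) * (8/5)\<^sup>2"
    using assms by (intro mult_left_mono power_mono) auto
  ultimately have "\<bar>sin x - x\<bar> \<le> \<bar>x\<bar> / 6 * (64/25)" by (simp add: power2_eq_square)
  then show ?thesis by (simp add: abs_if split: if_splits)
qed

lemma abs_exp_minus_one_ge:
  fixes x a :: real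
  assumes "\<bar>x\<bar> \<le> a"
  shows "exp (- a) * \<bar>x\<bar> \<le> \<bar>exp x - 1\<bar>"
proof (cases "x \<ge> 0")
  case True
  have "exp (- a) \<le> 1" using assms by simp
  then have "exp (- a) * \<bar>x\<bar> \<le> 1 * \<bar>x\<bar>" by (rule mult_right_mono) auto
  also have "\<dots> \<le> exp x - 1" using exp_ge_add_one_self[of x] True by linarith
  finally show ?thesis by simp
next
  case False
  have "exp (- a) * \<bar>x\<bar> \<le> exp x * (- x)" using False assms by (intro mult_mono) auto
  also have "\<dots> \<le> exp x * (exp (- x) - 1)"
    using exp_ge_add_one_self[of "- x"] by (intro mult_left_mono) auto
  also have "\<dots> = 1 - exp x" by (simp add: right_diff_distrib exp_minus)
  finally show ?thesis using False by simp
qed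

lemma three_power_ge: "2 * real k + 1 \<le> 3 ^ k"
  by (induction k) (auto simp: algebra_simps)

text \<open>With \<open>\<rho> = exp (- 2 * pi * s)\<close> the squared modulus equals
  \<open>(\<rho> - 1)\<^sup>2 + 4 * \<rho> * (sin (pi * t))\<^sup>2\<close>, which separates the
  variables: one summand controls \<open>s\<^sup>2\<close>, the other \<open>t\<^sup>2\<close>. The
  constant is the smallest value of \<rho>.\<close>

lemma cmod_z_minus_one_ge:
  assumes s: "\<bar>s\<bar> \<le> 1/2" and t: "\<bar>t\<bar> \<le> 1/2"
  shows "exp (- pi) * norm (s, t) \<le> cmod (complex_of_real (exp (- 2 * pi * s)) * cis (2 * pi * t) - 1)"
proof -
  define \<rho> where "\<rho> = exp (- 2 * pi * s)"
  have pi: "3 < pi" "pi < 16/5" using pi_gt3 pi_approx by auto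
  have ps: "\<bar>- 2 * pi * s\<bar> \<le> pi"
    using mult_left_mono[OF s, of "2 * pi"] by (simp add: abs_mult)
  have \<rho>: "exp (- pi) \<le> \<rho>" using ps unfolding \<rho>_def by (auto simp: abs_le_iff)
  have "complex_of_real \<rho> * cis (2 * pi * t) - 1 = Complex (\<rho> * cos (2 * pi * t) - 1) (\<rho> * sin (2 * pi * t))"
    by (simp add: complex_eq_iff)
  then have "(cmod (of_real \<rho> * cis (2 * pi * t) - 1))\<^sup>2 = (\<rho> * cos (2 * pi * t) - 1)\<^sup>2 + (\<rho> * sin (2 * pi * t))\<^sup>2"
    by (simp add: cmod_power2)
  also have "\<dots> = \<rho>\<^sup>2 * ((cos (2 * pi * t))\<^sup>2 + (sin (2 * pi * t))\<^sup>2) - 2 * \<rho> * cos (2 * pi * t) + 1"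
    by (simp only: power2_diff power_mult_distrib distrib_left one_power2 mult_1_right)
  also have "\<dots> = \<rho>\<^sup>2 - 2 * \<rho> * cos (2 * pi * t) + 1"
    by (simp only: sin_cos_squared_add2 mult_1_right)
  also have "cos (2 * pi * t) = 1 - 2 * (sin (pi * t))\<^sup>2"
    using cos_double_sin[of "pi * t"] by (simp only: mult.assoc)
  also have "\<rho>\<^sup>2 - 2 * \<rho> * (1 - 2 * (sin (pi * t))\<^sup>2) + 1 = (\<rho> - 1)\<^sup>2 + 4 * \<rho> * (sin (pi * t))\<^sup>2"
    by (simp add: power2_diff algebra_simps)
  finally have e: "(cmod (of_real \<rho> * cis (2 * pi * t) - 1))\<^sup>2 = (\<rho> - 1)\<^sup>2 + 4 * \<rho> * (sin (pi * t))\<^sup>2" .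
  have "exp (- pi) * \<bar>s\<bar> \<le> exp (- pi) * \<bar>- 2 * pi * s\<bar>"
    using pi mult_right_mono[of 1 "2 * pi" "\<bar>s\<bar>"] by (intro mult_left_mono) (auto simp: abs_mult)
  also have "\<dots> \<le> \<bar>\<rho> - 1\<bar>" unfolding \<rho>_def by (rule abs_exp_minus_one_ge[OF ps])
  finally have "(exp (- pi) * \<bar>s\<bar>)\<^sup>2 \<le> \<bar>\<rho> - 1\<bar>\<^sup>2" by (intro power_mono) auto
  then have 1: "(exp (- pi))\<^sup>2 * s\<^sup>2 \<le> (\<rho> - 1)\<^sup>2" by (simp add: power_mult_distrib)
  have "\<bar>pi * t\<bar> \<le> 8/5" using mult_mono[of pi "16/5" "\<bar>t\<bar>" "1/2"] pi t by (simp add: abs_mult)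
  then have "\<bar>pi * t\<bar> / 2 \<le> \<bar>sin (pi * t)\<bar>" by (rule abs_sin_ge)
  moreover have "\<bar>t\<bar> \<le> \<bar>pi * t\<bar> / 2"
    using mult_right_mono[of 2 pi "\<bar>t\<bar>"] pi by (simp add: abs_mult)
  ultimately have "\<bar>t\<bar>\<^sup>2 \<le> \<bar>sin (pi * t)\<bar>\<^sup>2" by (intro power_mono) auto
  then have "t\<^sup>2 \<le> (sin (pi * t))\<^sup>2" by simp
  moreover have "(exp (- pi))\<^sup>2 \<le> 4 * \<rho>"
  proof -
    have "exp (- pi) * exp (- pi) \<le> exp (- pi) * 1" by (intro mult_left_mono) auto
    also have "\<dots> \<le> 4 * \<rho>" using \<rho> by (smt (verit) exp_gt_zero)
    finally show ?thesis by (simp add: power2_eq_square)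
  qed
  ultimately have 2: "(exp (- pi))\<^sup>2 * t\<^sup>2 \<le> 4 * \<rho> * (sin (pi * t))\<^sup>2" by (intro mult_mono) (auto simp: \<rho>_def)
  have "(exp (- pi) * norm (s, t))\<^sup>2 = (exp (- pi))\<^sup>2 * s\<^sup>2 + (exp (- pi))\<^sup>2 * t\<^sup>2"
    by (simp add: power_mult_distrib norm_Pair algebra_simps)
  also have "\<dots> \<le> (cmod (of_real \<rho> * cis (2 * pi * t) - 1))\<^sup>2" unfolding e using 1 2 by simp
  finally show ?thesis unfolding \<rho>_def by (rule power2_le_imp_le) simp
qed

text \<open>The pairs with \<open>k \<ge> 1\<close> amount to at most (3/8) / (1 - 3/8) = 3/5 of the
  modulus of the pair \<open>P 0\<close>, which leaves 2/5. Of the two factors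
  \<open>exp (- pi)\<close>, one bounds \<open>cmod (z - 1)\<close> and the other the coefficient
  \<open>b 0 / cmod z\<close> of \<open>P 0\<close>.\<close>

lemma zak_gabor_zero_ge:
  assumes y: "y \<in> {0..1}" and \<xi>: "\<xi> \<in> {0..1}"
  shows "(2/5) * exp (- 2 * pi) * norm (y - 1/2, \<xi> - 1/2) \<le> cmod (zak_gabor 0 y \<xi>)"
proof -
  define s where "s = y - 1/2"
  define t where "t = \<xi> - 1/2"
  define z where "z = complex_of_real (exp (- 2 * pi * s)) * cis (2 * pi * t)"
  define b where "b = (\<lambda>k::nat. 2 powr (1/4) * exp (- pi * ((k + 1/2)\<^sup>2 + s\<^sup>2)) * exp (- pi * s))"
  define a where "a = (\<lambda>q. fourier_char q \<xi> * gabor 0 (y + of_int q))"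
  define P where "P = (\<lambda>k::nat. a (int k) + a (- 1 - int k))"
  have P: "P k = (-1) ^ k * of_real (b k) * (inverse z ^ (k + 1) * (z ^ (2 * k + 1) - 1))" for k
    unfolding P_def a_def z_def b_def s_def t_def by (rule zak_gabor_zero_pairing)
  have s: "\<bar>s\<bar> \<le> 1/2" and t: "\<bar>t\<bar> \<le> 1/2" using y \<xi> by (auto simp: s_def t_def abs_if)
  have z0: "z \<noteq> 0" by (simp add: z_def)
  have ps: "\<bar>- 2 * pi * s\<bar> \<le> pi"
    using mult_left_mono[OF s, of "2 * pi"] by (simp add: abs_mult)
  have cz: "cmod z = exp (- 2 * pi * s)" by (simp add: z_def norm_mult)
  have b0: "b k > 0" for k by (simp add: b_def)
  have bk: "b k = b 0 * exp (- pi * (real k * (real k + 1)))" for k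
  proof -
    have "- pi * ((k + 1/2)\<^sup>2 + s\<^sup>2) = - pi * ((real 0 + 1/2)\<^sup>2 + s\<^sup>2) + - pi * (real k * (real k + 1))"
      by (simp add: power2_eq_square algebra_simps)
    then have "exp (- pi * ((k + 1/2)\<^sup>2 + s\<^sup>2)) = exp (- pi * ((real 0 + 1/2)\<^sup>2 + s\<^sup>2)) * exp (- pi * (real k * (real k + 1)))"
      by (simp only: exp_add)
    then show ?thesis unfolding b_def by (simp only: mult_ac)
  qed
  have P0: "cmod (P 0) = b 0 * inverse (cmod z) * cmod (z - 1)"
    using b0[of 0] unfolding P by (simp add: norm_mult norm_inverse)
  \<comment> \<open>After division by \<open>z - 1\<close> a geometric sum of
    \<open>2 * k + 1\<close> terms remains. Against it stands the Gaussian decay of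
    \<open>b k\<close>, and altogether there is a factor \<open>2 * k + 1 \<le> 3 ^ k\<close> and a
    factor at most \<open>exp (- 3) ^ k \<le> (1/8) ^ k\<close>.\<close>
  have Pk: "cmod (P k) \<le> cmod (P 0) * (3/8) ^ k" for k
  proof (cases "k = 0")
    case False
    \<comment> \<open>The modulus is that of \<open>z\<close> to the power \<open>j - k - 1\<close>,
      and the distance of \<open>j\<close> from \<open>k\<close> is at most
      \<open>k\<close>.\<close>
    have tm: "cmod (inverse z ^ (k + 1) * z ^ j) \<le> inverse (cmod z) * exp (pi * k)" if j: "j < 2 * k + 1" for j
    proof -
      have "cmod (inverse z ^ (k + 1) * z ^ j) = exp (2 * pi * s) * exp ((- 2 * pi * s) * (real j - real k))"
      proof -
        have "cmod (inverse z ^ (k + 1) * z ^ j) = exp (2 * pi * s) ^ (k + 1) * exp (- 2 * pi * s) ^ j"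
          by (simp only: norm_mult norm_power norm_inverse cz exp_minus[symmetric]) simp
        also have "\<dots> = exp (2 * pi * s) * exp ((- 2 * pi * s) * (real j - real k))"
          unfolding exp_of_nat_mult[symmetric] exp_add[symmetric] by (simp add: algebra_simps)
        finally show ?thesis .
      qed
      also have "\<dots> \<le> exp (2 * pi * s) * exp (pi * k)"
      proof (intro mult_left_mono)
        have "(- 2 * pi * s) * (real j - real k) \<le> \<bar>- 2 * pi * s\<bar> * \<bar>real j - real k\<bar>"
          unfolding abs_mult[symmetric] by (rule abs_ge_self)
        also have "\<dots> \<le> pi * real k" using ps j by (intro mult_mono) auto
        finally show "exp ((- 2 * pi * s) * (real j - real k)) \<le> exp (pi * k)" by simp
      qed auto
      finally show ?thesis by (simp add: cz exp_minus)
    qed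
    have "inverse z ^ (k + 1) * (z ^ (2 * k + 1) - 1) = (z - 1) * (\<Sum>j<2 * k + 1. inverse z ^ (k + 1) * z ^ j)"
      unfolding power_diff_1_eq by (simp only: sum_distrib_left mult_ac)
    then have "cmod (P k) = b k * (cmod (z - 1) * cmod (\<Sum>j<2 * k + 1. inverse z ^ (k + 1) * z ^ j))"
      unfolding P using b0[of k] by (simp add: norm_mult norm_power)
    also have "\<dots> \<le> b k * (cmod (z - 1) * (\<Sum>j<2 * k + 1. inverse (cmod z) * exp (pi * k)))"
      by (intro mult_left_mono order_trans[OF norm_sum] sum_mono tm) (use b0[of k] in auto)
    also have "\<dots> = cmod (P 0) * ((2 * real k + 1) * (exp (- pi * (real k * (real k + 1))) * exp (pi * k)))"
      unfolding P0 bk[of k] by (simp add: algebra_simps)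
    also have "exp (- pi * (real k * (real k + 1))) * exp (pi * k) = exp (- pi * (real k * real k))"
      unfolding exp_add[symmetric] by (simp add: algebra_simps)
    also have "\<dots> \<le> exp (- 3 * real k)"
    proof -
      have "3 * real k \<le> pi * (real k * real k)"
        using pi_gt3 False by (intro mult_mono) auto
      then show ?thesis by simp
    qed
    also have "exp (- 3 * real k) = exp (- 3) ^ k" by (simp add: exp_of_nat_mult[symmetric] mult.commute)
    also have "\<dots> \<le> (1/8) ^ k"
    proof (intro power_mono)
      have "(2::real) ^ 3 \<le> exp 1 ^ 3" using exp_ge_add_one_self[of 1] by (intro power_mono) auto
      then have "(8::real) \<le> exp 3" by (simp add: exp_of_nat_mult[symmetric])
      then show "exp (- 3) \<le> (1/8 :: real)" by (simp add: exp_minus field_simps)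
    qed auto
    also have "cmod (P 0) * ((2 * real k + 1) * (1/8) ^ k) \<le> cmod (P 0) * (3 ^ k * (1/8) ^ k)"
      by (intro mult_left_mono mult_right_mono three_power_ge) auto
    also have "(3::real) ^ k * (1/8) ^ k = (3/8) ^ k" by (simp add: power_mult_distrib[symmetric])
    finally show ?thesis by (simp add: mult_left_mono mult_right_mono)
  qed simp
  have sa: "a summable_on UNIV" unfolding a_def by (rule zak_gabor_summable)
  have "zak_gabor 0 y \<xi> = infsum a UNIV" by (simp add: zak_gabor_def a_def)
  also have "UNIV = range int \<union> range (\<lambda>k. - 1 - int k)"
  proof -
    have "q \<in> range int \<union> range (\<lambda>k. - 1 - int k)" for q
    proof (cases "q \<ge> 0")
      case True
      then have "q = int (nat q)" by simp
      then show ?thesis by blast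
    next
      case False
      then have "q = - 1 - int (nat (- 1 - q))" by simp
      then show ?thesis by blast
    qed
    then show ?thesis by auto
  qed
  also have "infsum a \<dots> = infsum a (range int) + infsum a (range (\<lambda>k. - 1 - int k))"
    by (intro infsum_Un_disjoint summable_on_subset_banach[OF sa]) auto
  also have "infsum a (range int) = (\<Sum>\<^sub>\<infinity>k. a (int k))"
    by (subst infsum_reindex) (auto simp: o_def)
  also have "infsum a (range (\<lambda>k. - 1 - int k)) = (\<Sum>\<^sub>\<infinity>k. a (- 1 - int k))"
    by (subst infsum_reindex) (auto simp: o_def inj_on_def)
  also have "(\<Sum>\<^sub>\<infinity>k. a (int k)) + (\<Sum>\<^sub>\<infinity>k. a (- 1 - int k)) = infsum P UNIV"
    unfolding P_def
  proof (rule infsum_add[symmetric])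
    show "(\<lambda>k. a (int k)) summable_on UNIV"
      using summable_on_reindex[of int UNIV a] summable_on_subset_banach[OF sa, of "range int"] by (auto simp: o_def)
    show "(\<lambda>k. a (- 1 - int k)) summable_on UNIV"
      using summable_on_reindex[of "\<lambda>k. - 1 - int k" UNIV a] summable_on_subset_banach[OF sa, of "range (\<lambda>k. - 1 - int k)"]
      by (auto simp: o_def inj_on_def)
  qed
  finally have E: "zak_gabor 0 y \<xi> = infsum P UNIV" .
  have g: "summable (\<lambda>k. cmod (P 0) * (3/8 :: real) ^ k)" by (intro summable_mult summable_geometric) auto
  have sP: "summable (\<lambda>k. cmod (P k))"
    by (rule summable_comparison_test'[OF g, of 0]) (use Pk in auto)
  have "infsum P UNIV = suminf P"
    using has_sum_imp_sums[OF has_sum_infsum[OF norm_summable_imp_summable_on[OF sP]]] by (simp add: sums_iff)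
  also have "\<dots> = P 0 + (\<Sum>k. P (Suc k))"
    using suminf_split_head[OF summable_norm_cancel[OF sP]] by simp
  finally have E2: "zak_gabor 0 y \<xi> = P 0 + (\<Sum>k. P (Suc k))" using E by simp
  have sP': "summable (\<lambda>k. cmod (P (Suc k)))" using sP by (subst summable_Suc_iff)
  have g': "(\<lambda>k. cmod (P 0) * (3/8) * (3/8 :: real) ^ k) sums (cmod (P 0) * (3/8) * (1 / (1 - 3/8)))"
    by (intro sums_mult geometric_sums) auto
  have "cmod (\<Sum>k. P (Suc k)) \<le> (\<Sum>k. cmod (P (Suc k)))" by (rule summable_norm[OF sP'])
  also have "\<dots> \<le> (\<Sum>k. cmod (P 0) * (3/8) * (3/8 :: real) ^ k)"
    using Pk[of "Suc _"] by (intro suminf_le sP' sums_summable[OF g']) (simp add: mult_ac)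
  also have "\<dots> = cmod (P 0) * (3/5)" using g' by (simp add: sums_iff)
  finally have "cmod (\<Sum>k. P (Suc k)) \<le> cmod (P 0) * (3/5)" .
  moreover have "cmod (P 0) \<le> cmod (zak_gabor 0 y \<xi>) + cmod (\<Sum>k. P (Suc k))"
    using norm_triangle_ineq4[of "zak_gabor 0 y \<xi>" "\<Sum>k. P (Suc k)"] unfolding E2 by simp
  ultimately have lower: "(2/5) * cmod (P 0) \<le> cmod (zak_gabor 0 y \<xi>)" by simp
  have "exp (- 2 * pi) * norm (s, t) = exp (- pi) * (exp (- pi) * norm (s, t))"
    by (simp add: mult.assoc[symmetric] exp_add[symmetric])
  also have "\<dots> \<le> (b 0 * inverse (cmod z)) * cmod (z - 1)"
  proof (intro mult_mono)
    show "exp (- pi) * norm (s, t) \<le> cmod (z - 1)"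
      unfolding z_def by (rule cmod_z_minus_one_ge[OF s t])
    \<comment> \<open>The exponent of \<open>b 0 / cmod z\<close> is
      \<open>- pi / 4 - pi * s\<^sup>2 + pi * s\<close>; for \<open>\<bar>s\<bar> \<le> 1/2\<close>
      its minimum is - pi, attained at s = -1/2.\<close>
    have "s\<^sup>2 \<le> 1/4" using power_mono[OF s, of 2] by (simp add: power2_eq_square)
    then have "pi * s\<^sup>2 \<le> pi * (1/4)" by (intro mult_left_mono) auto
    moreover have "- 2 * pi * s \<le> pi" using ps by (rule order_trans[OF abs_ge_self])
    moreover have "- pi * ((real 0 + 1/2)\<^sup>2 + s\<^sup>2) + (- pi * s) + 2 * pi * s = - (pi * (1/4)) - pi * s\<^sup>2 + pi * s"
      by (simp add: power2_eq_square algebra_simps)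
    ultimately have "- pi \<le> - pi * ((real 0 + 1/2)\<^sup>2 + s\<^sup>2) + (- pi * s) + 2 * pi * s"
      by linarith
    then have "exp (- pi) \<le> exp (- pi * ((real 0 + 1/2)\<^sup>2 + s\<^sup>2)) * exp (- pi * s) * exp (2 * pi * s)"
      unfolding exp_add[symmetric] by simp
    also have "\<dots> \<le> 2 powr (1/4) * (exp (- pi * ((real 0 + 1/2)\<^sup>2 + s\<^sup>2)) * exp (- pi * s) * exp (2 * pi * s))"
      using mult_right_mono[of 1 "2 powr (1/4) :: real" "exp (- pi * ((real 0 + 1/2)\<^sup>2 + s\<^sup>2)) * exp (- pi * s) * exp (2 * pi * s)"]
        ge_one_powr_ge_zero[of 2 "1/4"] by simp
    also have "\<dots> = b 0 * inverse (cmod z)" unfolding b_def cz by (simp add: exp_minus)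
    finally show "exp (- pi) \<le> b 0 * inverse (cmod z)" .
  qed (use b0[of 0] in auto)
  also have "\<dots> = cmod (P 0)" by (simp add: P0)
  finally have "(2/5) * (exp (- 2 * pi) * norm (s, t)) \<le> (2/5) * cmod (P 0)"
    by (intro mult_left_mono) simp_all
  then show ?thesis using lower by (simp add: s_def t_def mult.assoc)
qed

section \<open>Isometry of the Zak transform\<close>

text \<open>Enumerating the integers turns the unordered sums into series, the form in which
  measurability, termwise integration and dominated convergence are applied.\<close>

lemma int_decode_sums:
  fixes F :: "int \<Rightarrow> complex"
  assumes "(\<lambda>q. cmod (F q)) summable_on UNIV"
  shows "summable (\<lambda>n. cmod (F (int_decode n)))" "infsum F UNIV = (\<Sum>n. F (int_decode n))"
proof -
  have b: "bij_betw int_decode UNIV UNIV" using bij_int_decode by (simp add: bij_def bij_betw_def)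
  have "(\<lambda>n. cmod (F (int_decode n))) summable_on UNIV"
    using summable_on_reindex_bij_betw[OF b, of "\<lambda>q. cmod (F q)"] assms by simp
  then show s: "summable (\<lambda>n. cmod (F (int_decode n)))" by (rule summable_on_imp_summable)
  have "infsum F UNIV = (\<Sum>\<^sub>\<infinity>n. F (int_decode n))"
    using infsum_reindex_bij_betw[OF b, of F] by simp
  also have "\<dots> = (\<Sum>n. F (int_decode n))"
    using has_sum_imp_sums[OF has_sum_infsum[OF norm_summable_imp_summable_on[OF s]]] by (simp add: sums_iff)
  finally show "infsum F UNIV = (\<Sum>n. F (int_decode n))" .
qed

lemma fourier_char_measurable_comp [measurable (raw)]:
  "f \<in> borel_measurable M \<Longrightarrow> (\<lambda>x. fourier_char n (f x)) \<in> borel_measurable M"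
  by (rule measurable_compose[OF _ fourier_char_measurable])

lemma zak_gabor_measurable [measurable (raw)]:
  assumes [measurable]: "f \<in> borel_measurable M" "g \<in> borel_measurable M" "h \<in> borel_measurable M"
  shows "(\<lambda>x. zak_gabor (f x) (g x) (h x)) \<in> borel_measurable M"
proof -
  have "zak_gabor \<mu> y \<xi> = (\<Sum>n. fourier_char (int_decode n) \<xi> * gabor \<mu> (y + of_int (int_decode n)))" for \<mu> y \<xi>
    unfolding zak_gabor_def by (rule int_decode_sums(2)) (rule lattice_summable(1)[OF zak_gabor_term_le])
  then show ?thesis by simp
qed

text \<open>The partial sums are uniformly bounded by the sum of the moduli, so the finite formula
  passes to the limit; completeness of the characters does not enter.\<close>

lemma Parseval_absolutely_summable:
  assumes c: "summable (\<lambda>n. cmod (c n))"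
  shows "(\<lambda>n. (cmod (c n))\<^sup>2) sums (LINT \<xi>|unit_measure. (cmod (\<Sum>n. fourier_char (int_decode n) \<xi> * c n))\<^sup>2)"
proof -
  define S where "S = (\<lambda>N \<xi>. \<Sum>n<N. fourier_char (int_decode n) \<xi> * c n)"
  have fin: "(LINT \<xi>|unit_measure. (cmod (S N \<xi>))\<^sup>2) = (\<Sum>n<N. (cmod (c n))\<^sup>2)" for N
  proof -
    \<comment> \<open>Written as a deviation from 0, so that \<open>integral_sq_diff_phi_sum\<close>
      with \<open>u\<close> zero gives the finite Parseval formula.\<close>
    have S: "S N \<xi> = - (0 - (\<Sum>i\<in>int_decode ` {..<N}. c (int_encode i) * fourier_char i \<xi>))" for \<xi>
      unfolding S_def by (subst sum.reindex) (auto simp: inj_int_decode mult.commute)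
    have "(LINT \<xi>|unit_measure. (cmod (S N \<xi>))\<^sup>2)
      = (LINT \<xi>|unit_measure. (cmod (0 - (\<Sum>i\<in>int_decode ` {..<N}. c (int_encode i) * fourier_char i \<xi>)))\<^sup>2)"
      unfolding S norm_minus_cancel ..
    also have "\<dots> = (\<Sum>i\<in>int_decode ` {..<N}. (cmod (c (int_encode i)))\<^sup>2)"
      by (subst fourier.integral_sq_diff_phi_sum) (auto simp: sq_integrable_def fourier.coef_def)
    also have "\<dots> = (\<Sum>n<N. (cmod (c n))\<^sup>2)"
      by (subst sum.reindex) (auto simp: inj_int_decode)
    finally show ?thesis .
  qed
  have sb: "summable (\<lambda>n. cmod (fourier_char (int_decode n) \<xi> * c n))" for \<xi>
    using c by (simp add: norm_mult)
  have "(\<lambda>N. LINT \<xi>|unit_measure. (cmod (S N \<xi>))\<^sup>2)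
      \<longlonglongrightarrow> (LINT \<xi>|unit_measure. (cmod (\<Sum>n. fourier_char (int_decode n) \<xi> * c n))\<^sup>2)"
  proof (rule integral_dominated_convergence[where w = "\<lambda>_. (\<Sum>n. cmod (c n))\<^sup>2"])
    show "AE \<xi> in unit_measure. (\<lambda>N. (cmod (S N \<xi>))\<^sup>2) \<longlonglongrightarrow> (cmod (\<Sum>n. fourier_char (int_decode n) \<xi> * c n))\<^sup>2"
      unfolding S_def
      by (intro AE_I2 tendsto_intros summable_LIMSEQ summable_norm_cancel[OF sb])
    show "AE \<xi> in unit_measure. norm ((cmod (S N \<xi>))\<^sup>2) \<le> (\<Sum>n. cmod (c n))\<^sup>2" for N
    proof (rule AE_I2)
      fix \<xi>
      have "cmod (S N \<xi>) \<le> (\<Sum>n<N. cmod (c n))"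
        unfolding S_def by (rule order_trans[OF norm_sum]) (simp add: norm_mult)
      also have "\<dots> \<le> (\<Sum>n. cmod (c n))" by (rule sum_le_suminf[OF c]) auto
      finally show "norm ((cmod (S N \<xi>))\<^sup>2) \<le> (\<Sum>n. cmod (c n))\<^sup>2" by (simp add: power_mono)
    qed
  qed (auto simp: S_def)
  then show ?thesis unfolding sums_def fin .
qed

text \<open>The line is tiled by half-open unit intervals; the closed interval of
  \<open>unit_measure\<close> differs from such a tile by one null point.\<close>

lemma nn_integral_unit_intervals:
  fixes g :: "real \<Rightarrow> ennreal"
  assumes [measurable]: "g \<in> borel_measurable borel"
  shows "(\<integral>\<^sup>+x. g x \<partial>lborel) = (\<integral>\<^sup>+y. (\<Sum>n. g (y + of_int (int_decode n))) \<partial>unit_measure)"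
proof -
  define A where "A = (\<lambda>n. {real_of_int (int_decode n)..<real_of_int (int_decode n) + 1})"
  have [measurable]: "A n \<in> sets borel" for n by (simp add: A_def)
  have d: "disjoint_family A"
    unfolding disjoint_family_on_def
  proof (intro ballI impI)
    fix m n :: nat assume "m \<noteq> n"
    then have "int_decode m \<noteq> int_decode n" by (metis int_decode_inverse)
    then show "A m \<inter> A n = {}" by (auto simp: A_def)
  qed
  have u: "(\<Union>n. A n) = UNIV"
  proof -
    have "x \<in> A (int_encode \<lfloor>x\<rfloor>)" for x by (simp add: A_def)
    then show ?thesis by auto
  qed
  have "(\<integral>\<^sup>+x. g x \<partial>lborel) = (\<integral>\<^sup>+x. (\<Sum>n. g x * indicator (A n) x) \<partial>lborel)"
    by (simp add: suminf_indicator[OF d] u)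
  also have "\<dots> = (\<Sum>n. \<integral>\<^sup>+x. g x * indicator (A n) x \<partial>lborel)"
    by (rule nn_integral_suminf) measurable
  also have "\<dots> = (\<Sum>n. \<integral>\<^sup>+y. g (y + of_int (int_decode n)) \<partial>unit_measure)"
  proof (intro suminf_cong)
    fix n
    have "(\<integral>\<^sup>+x. g x * indicator (A n) x \<partial>lborel)
        = (\<integral>\<^sup>+x. g (of_int (int_decode n) + 1 * x) * indicator (A n) (of_int (int_decode n) + 1 * x) \<partial>lborel)"
      by (subst nn_integral_real_affine[of _ 1 "of_int (int_decode n)"]) auto
    also have "\<dots> = (\<integral>\<^sup>+x. indicator {0..1} x * g (x + of_int (int_decode n)) \<partial>lborel)"
    proof (rule nn_integral_cong_AE)
      have "AE x in lborel. x \<noteq> (1::real)" by (rule AE_lborel_singleton)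
      then show "AE x in lborel. g (of_int (int_decode n) + 1 * x) * indicator (A n) (of_int (int_decode n) + 1 * x)
        = indicator {0..1} x * g (x + of_int (int_decode n))"
        by eventually_elim (auto simp: A_def indicator_def add.commute)
    qed
    also have "\<dots> = (\<integral>\<^sup>+y. g (y + of_int (int_decode n)) \<partial>unit_measure)"
      by (rule nn_integral_unit_measure[symmetric]) measurable
    finally show "(\<integral>\<^sup>+x. g x * indicator (A n) x \<partial>lborel) = (\<integral>\<^sup>+y. g (y + of_int (int_decode n)) \<partial>unit_measure)" .
  qed
  also have "\<dots> = (\<integral>\<^sup>+y. (\<Sum>n. g (y + of_int (int_decode n))) \<partial>unit_measure)"
    by (rule nn_integral_suminf[symmetric]) measurable
  finally show ?thesis .
qed

text \<open>For fixed \<open>y\<close> the Zak transform is a Fourier series in \<xi> with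
  coefficients \<open>h (y + of_int q)\<close>; Parseval in \<xi> is followed by gluing the
  translates of the unit interval. With integrals in \<open>ennreal\<close>, square integrability of
  \<open>h\<close> need not be known in advance.\<close>

lemma zak_isometry:
  fixes h :: "real \<Rightarrow> complex"
  assumes [measurable]: "h \<in> borel_measurable borel"
    and h: "\<And>y. summable (\<lambda>n. cmod (h (y + of_int (int_decode n))))"
  shows "(\<integral>\<^sup>+x. ennreal ((cmod (h x))\<^sup>2) \<partial>lborel) = (\<integral>\<^sup>+z. ennreal ((cmod
     (\<Sum>n. fourier_char (int_decode n) (snd z) * h (fst z + of_int (int_decode n))))\<^sup>2) \<partial>unit_square)"
proof -
  have "(\<integral>\<^sup>+x. ennreal ((cmod (h x))\<^sup>2) \<partial>lborel)
     = (\<integral>\<^sup>+y. (\<Sum>n. ennreal ((cmod (h (y + of_int (int_decode n))))\<^sup>2)) \<partial>unit_measure)"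
    by (rule nn_integral_unit_intervals) measurable
  also have "\<dots> = (\<integral>\<^sup>+y. (\<integral>\<^sup>+\<xi>. ennreal ((cmod
     (\<Sum>n. fourier_char (int_decode n) \<xi> * h (y + of_int (int_decode n))))\<^sup>2) \<partial>unit_measure) \<partial>unit_measure)"
  proof (intro nn_integral_cong)
    fix y
    note p = Parseval_absolutely_summable[OF h[of y]]
    have i: "integrable unit_measure (\<lambda>\<xi>. (cmod (\<Sum>n. fourier_char (int_decode n) \<xi> * h (y + of_int (int_decode n))))\<^sup>2)"
    proof (rule unit_measure.integrable_const_bound[where B = "(\<Sum>n. cmod (h (y + of_int (int_decode n))))\<^sup>2"])
      have "cmod (\<Sum>n. fourier_char (int_decode n) \<xi> * h (y + of_int (int_decode n))) \<le> (\<Sum>n. cmod (h (y + of_int (int_decode n))))" for \<xi>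
        using summable_norm[of "\<lambda>n. fourier_char (int_decode n) \<xi> * h (y + of_int (int_decode n))"] h[of y]
        by (simp add: norm_mult)
      then show "AE \<xi> in unit_measure. norm ((cmod (\<Sum>n. fourier_char (int_decode n) \<xi> * h (y + of_int (int_decode n))))\<^sup>2)
        \<le> (\<Sum>n. cmod (h (y + of_int (int_decode n))))\<^sup>2"
        by (intro AE_I2) (simp add: power_mono)
    qed measurable
    have "(\<Sum>n. ennreal ((cmod (h (y + of_int (int_decode n))))\<^sup>2)) = ennreal (\<Sum>n. (cmod (h (y + of_int (int_decode n))))\<^sup>2)"
      using p by (intro suminf_ennreal2) (auto simp: sums_iff)
    also have "\<dots> = (\<integral>\<^sup>+\<xi>. ennreal ((cmod (\<Sum>n. fourier_char (int_decode n) \<xi> * h (y + of_int (int_decode n))))\<^sup>2) \<partial>unit_measure)"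
      using p nn_integral_eq_integral[OF i] by (simp add: sums_iff)
    finally show "(\<Sum>n. ennreal ((cmod (h (y + of_int (int_decode n))))\<^sup>2))
      = (\<integral>\<^sup>+\<xi>. ennreal ((cmod (\<Sum>n. fourier_char (int_decode n) \<xi> * h (y + of_int (int_decode n))))\<^sup>2) \<partial>unit_measure)" .
  qed
  also have "\<dots> = (\<integral>\<^sup>+z. ennreal ((cmod
     (\<Sum>n. fourier_char (int_decode n) (snd z) * h (fst z + of_int (int_decode n))))\<^sup>2) \<partial>unit_square)"
    unfolding unit_square_def
    using unit_measure.nn_integral_fst[of "\<lambda>z. ennreal ((cmod
     (\<Sum>n. fourier_char (int_decode n) (snd z) * h (fst z + of_int (int_decode n))))\<^sup>2)" unit_measure]
    by simp
  finally show ?thesis .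
qed

section \<open>Integrability of the weights\<close>

lemma integrable_lborel_nonneg_on:
  fixes f :: "real \<Rightarrow> real"
  assumes [measurable]: "f \<in> borel_measurable borel" "A \<in> sets borel"
    and "f integrable_on A" "\<And>x. x \<in> A \<Longrightarrow> 0 \<le> f x"
  shows "integrable lborel (\<lambda>x. indicator A x * f x)"
proof -
  have "set_integrable lebesgue A f"
    by (rule nonnegative_absolutely_integrable_1) (use assms in auto)
  then have "integrable (completion lborel) (\<lambda>x. indicator A x * f x)" by (simp add: set_integrable_def)
  then show ?thesis by (subst (asm) integrable_completion) auto
qed

lemma integrable_one_plus_abs_powr:
  assumes s: "s > (1::real)"
  shows "integrable lborel (\<lambda>x::real. (1 + \<bar>x\<bar>) powr (- s))"
proof -
  define g where "g = (\<lambda>x::real. indicator {1..} x * x powr (- s))"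
  have "(\<lambda>x. x powr (- s)) integrable_on {1::real..}"
    using has_integral_powr_to_inf[of "- s" 1] s by (auto simp: integrable_on_def)
  then have g: "integrable lborel g"
    unfolding g_def by (intro integrable_lborel_nonneg_on) auto
  have "integrable lborel (\<lambda>x. g (1 + 1 * x) + g (1 + (-1) * x))"
    by (intro Bochner_Integration.integrable_add lborel_integrable_real_affine g) auto
  then show ?thesis
  proof (rule Bochner_Integration.integrable_bound)
    show "AE x in lborel. norm ((1 + \<bar>x\<bar>) powr (- s)) \<le> norm (g (1 + 1 * x) + g (1 + (-1) * x))"
      by (intro AE_I2) (auto simp: g_def indicator_def abs_if)
  qed measurable
qed

lemma integrable_unit_measure_iff:
  fixes f :: "real \<Rightarrow> real"
  assumes "f \<in> borel_measurable borel"
  shows "integrable unit_measure f \<longleftrightarrow> integrable lborel (\<lambda>x. indicator {0..1} x * f x)"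
  unfolding unit_measure_alt using integrable_density[of f lborel "indicator {0..1}"] assms by simp

lemma integrable_unit_measure_abs_powr:
  assumes g: "0 \<le> g" "g < (1::real)"
  shows "integrable unit_measure (\<lambda>x::real. \<bar>x - 1/2\<bar> powr (- g))"
proof -
  define f where "f = (\<lambda>x::real. indicator {0..1} x * x powr (- g))"
  have "(\<lambda>x. x powr (- g)) integrable_on {0..1::real}"
    using has_integral_powr_from_0[of "- g" 1] g by (auto simp: integrable_on_def)
  then have f: "integrable lborel f"
    unfolding f_def by (intro integrable_lborel_nonneg_on) auto
  have "integrable lborel (\<lambda>x. f (- (1/2) + 1 * x) + f (1/2 + (-1) * x))"
    by (intro Bochner_Integration.integrable_add lborel_integrable_real_affine f) auto
  then have "integrable lborel (\<lambda>x. indicator {0..1} x * \<bar>x - 1/2\<bar> powr (- g))"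
  proof (rule Bochner_Integration.integrable_bound)
    show "AE x in lborel. norm (indicator {0..1} x * \<bar>x - 1/2\<bar> powr (- g)) \<le> norm (f (- (1/2) + 1 * x) + f (1/2 + (-1) * x))"
    proof (rule AE_I2)
      fix x :: real
      consider "x = 1/2" | "x > 1/2" | "x < 1/2" by linarith
      then show "norm (indicator {0..1} x * \<bar>x - 1/2\<bar> powr (- g)) \<le> norm (f (- (1/2) + 1 * x) + f (1/2 + (-1) * x))"
        by cases (auto simp: f_def indicator_def)
    qed
  qed measurable
  then show ?thesis by (subst integrable_unit_measure_iff) auto
qed

text \<open>Half of the exponent is spent on each coordinate, since the norm dominates both; each
  half exceeds 1. This replaces polar coordinates.\<close>

lemma integrable_one_plus_norm_powr:
  assumes b: "\<beta> > (2::real)"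
  shows "integrable lborel (\<lambda>\<mu>::real \<times> real. (1 + norm \<mu>) powr (- \<beta>))"
proof -
  have "integrable (lborel \<Otimes>\<^sub>M lborel) (\<lambda>(p::real, \<theta>::real). (1 + norm (p, \<theta>)) powr (- \<beta>))"
  proof (rule lborel_pair.integrable_dominated_by_product)
    show "integrable lborel (\<lambda>x::real. (1 + \<bar>x\<bar>) powr (- (\<beta> / 2)))"
      "integrable lborel (\<lambda>x::real. (1 + \<bar>x\<bar>) powr (- (\<beta> / 2)))"
      using b by (intro integrable_one_plus_abs_powr; simp)+
    fix p \<theta> :: real
    have n: "\<bar>p\<bar> \<le> norm (p, \<theta>)" "\<bar>\<theta>\<bar> \<le> norm (p, \<theta>)" using norm_fst_le[of p \<theta>] norm_snd_le[of \<theta> p] by auto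
    have "(1 + norm (p, \<theta>)) powr (- \<beta>) = (1 + norm (p, \<theta>)) powr (- (\<beta> / 2)) * (1 + norm (p, \<theta>)) powr (- (\<beta> / 2))"
      by (simp add: powr_add[symmetric])
    also have "\<dots> \<le> (1 + \<bar>p\<bar>) powr (- (\<beta> / 2)) * (1 + \<bar>\<theta>\<bar>) powr (- (\<beta> / 2))"
      using n b by (intro mult_mono powr_mono2') auto
    finally show "norm ((1 + norm (p, \<theta>)) powr (- \<beta>)) \<le> (1 + \<bar>p\<bar>) powr (- (\<beta> / 2)) * (1 + \<bar>\<theta>\<bar>) powr (- (\<beta> / 2))"
      by simp
  qed (simp add: norm_Pair)
  then show ?thesis unfolding lborel_prod by (simp add: case_prod_unfold)
qed

section \<open>The spaces \<open>H_delta\<close>\<close>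

definition weight :: "real \<Rightarrow> real \<times> real \<Rightarrow> real" where
  "weight \<delta> \<mu> = norm \<mu> powr \<delta> + 1"

lemma weight_measurable [measurable]: "weight \<delta> \<in> borel_measurable borel"
  unfolding weight_def by measurable

lemma weight_pos: "weight \<delta> \<mu> > 0" "weight \<delta> \<mu> \<ge> 0" "weight \<delta> \<mu> \<ge> 1"
  using powr_ge_zero[of "norm \<mu>" \<delta>] by (auto simp: weight_def add_pos_nonneg simp del: powr_ge_zero)

lemma H_delta_iff:
  "f \<in> H_delta \<delta> \<longleftrightarrow> f \<in> L2 \<and> integrable lborel (\<lambda>\<mu>. weight \<delta> \<mu> * (cmod (L2_inner f (gabor \<mu>)))\<^sup>2)"
  by (simp add: H_delta_def weight_def)

lemma H_norm_sq:
  "(H_norm \<delta> f)\<^sup>2 = (LINT \<mu>|lborel. weight \<delta> \<mu> * (cmod (L2_inner f (gabor \<mu>)))\<^sup>2)"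
proof -
  have "0 \<le> (LINT \<mu>|lborel. weight \<delta> \<mu> * (cmod (L2_inner f (gabor \<mu>)))\<^sup>2)"
    by (intro Bochner_Integration.integral_nonneg mult_nonneg_nonneg weight_pos) auto
  then show ?thesis by (simp add: H_norm_def weight_def)
qed

lemma H_norm_nonneg: "H_norm \<delta> f \<ge> 0"
  unfolding H_norm_def by (intro real_sqrt_ge_zero Bochner_Integration.integral_nonneg mult_nonneg_nonneg) auto

lemma H_delta_add:
  assumes f: "f \<in> H_delta \<delta>" and g: "g \<in> H_delta \<delta>"
  shows "(\<lambda>x. f x + g x) \<in> H_delta \<delta>"
proof -
  have L: "f \<in> L2" "g \<in> L2" using f g by (auto simp: H_delta_iff)
  have [measurable]: "f \<in> borel_measurable borel" "g \<in> borel_measurable borel"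
    using L by (auto intro: L2_measurable)
  have L2: "(\<lambda>x. f x + g x) \<in> L2" using L by (simp add: L2_iff sq_integrable_add)
  have "integrable lborel (\<lambda>\<mu>. 2 * (weight \<delta> \<mu> * (cmod (L2_inner f (gabor \<mu>)))\<^sup>2) + 2 * (weight \<delta> \<mu> * (cmod (L2_inner g (gabor \<mu>)))\<^sup>2))"
    using f g by (auto simp: H_delta_iff)
  then have "integrable lborel (\<lambda>\<mu>. weight \<delta> \<mu> * (cmod (L2_inner (\<lambda>x. f x + g x) (gabor \<mu>)))\<^sup>2)"
  proof (rule Bochner_Integration.integrable_bound)
    show "AE \<mu> in lborel. norm (weight \<delta> \<mu> * (cmod (L2_inner (\<lambda>x. f x + g x) (gabor \<mu>)))\<^sup>2)
      \<le> norm (2 * (weight \<delta> \<mu> * (cmod (L2_inner f (gabor \<mu>)))\<^sup>2) + 2 * (weight \<delta> \<mu> * (cmod (L2_inner g (gabor \<mu>)))\<^sup>2))"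
    proof (rule AE_I2)
      fix \<mu>
      have "weight \<delta> \<mu> * (cmod (L2_inner (\<lambda>x. f x + g x) (gabor \<mu>)))\<^sup>2
        \<le> weight \<delta> \<mu> * (2 * (cmod (L2_inner f (gabor \<mu>)))\<^sup>2 + 2 * (cmod (L2_inner g (gabor \<mu>)))\<^sup>2)"
        unfolding L2_inner_add[OF L gabor_L2] by (intro mult_left_mono cmod_add_sq_le weight_pos)
      then show "norm (weight \<delta> \<mu> * (cmod (L2_inner (\<lambda>x. f x + g x) (gabor \<mu>)))\<^sup>2)
      \<le> norm (2 * (weight \<delta> \<mu> * (cmod (L2_inner f (gabor \<mu>)))\<^sup>2) + 2 * (weight \<delta> \<mu> * (cmod (L2_inner g (gabor \<mu>)))\<^sup>2))"
        using weight_pos(2)[of \<delta> \<mu>] by (simp add: abs_mult algebra_simps)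
    qed
  qed measurable
  with L2 show ?thesis by (simp add: H_delta_iff)
qed

lemma H_delta_cmult:
  assumes f: "f \<in> H_delta \<delta>"
  shows "(\<lambda>x. c * f x) \<in> H_delta \<delta>"
proof -
  have "integrable lborel (\<lambda>\<mu>. (cmod c)\<^sup>2 * (weight \<delta> \<mu> * (cmod (L2_inner f (gabor \<mu>)))\<^sup>2))"
    using f by (auto simp: H_delta_iff)
  then have "integrable lborel (\<lambda>\<mu>. weight \<delta> \<mu> * (cmod (L2_inner (\<lambda>x. c * f x) (gabor \<mu>)))\<^sup>2)"
    by (simp add: L2_inner_cmult norm_mult power_mult_distrib mult_ac)
  then show ?thesis using f by (simp add: H_delta_iff L2_iff sq_integrable_cmult)
qed

lemma H_delta_diff: "f \<in> H_delta \<delta> \<Longrightarrow> g \<in> H_delta \<delta> \<Longrightarrow> (\<lambda>x. f x - g x) \<in> H_delta \<delta>"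
  using H_delta_add[OF _ H_delta_cmult[of g \<delta> "-1"], of f] by simp

lemma H_delta_mono:
  assumes f: "f \<in> H_delta \<delta>'" and d: "0 \<le> \<delta>" "\<delta> \<le> \<delta>'"
  shows "f \<in> H_delta \<delta>"
proof -
  have L: "f \<in> L2" using f by (auto simp: H_delta_iff)
  have [measurable]: "f \<in> borel_measurable borel" using L by (auto intro: L2_measurable)
  have w: "weight \<delta> \<mu> \<le> 2 * weight \<delta>' \<mu>" for \<mu>
  proof (cases "norm \<mu> \<le> 1")
    case True
    then have "norm \<mu> powr \<delta> \<le> 1 powr \<delta>" using d by (intro powr_mono2) auto
    then have "weight \<delta> \<mu> \<le> 2" by (simp add: weight_def)
    then show ?thesis using weight_pos(3)[of \<delta>' \<mu>] by simp
  next
    case False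
    then have "norm \<mu> powr \<delta> \<le> norm \<mu> powr \<delta>'" using d by (intro powr_mono) auto
    moreover have "x \<le> y \<Longrightarrow> 0 \<le> y \<Longrightarrow> x + 1 \<le> 2 * (y + 1)" for x y :: real by simp
    ultimately show ?thesis unfolding weight_def using powr_ge_zero by blast
  qed
  have "integrable lborel (\<lambda>\<mu>. 2 * (weight \<delta>' \<mu> * (cmod (L2_inner f (gabor \<mu>)))\<^sup>2))"
    using f by (auto simp: H_delta_iff)
  then have "integrable lborel (\<lambda>\<mu>. weight \<delta> \<mu> * (cmod (L2_inner f (gabor \<mu>)))\<^sup>2)"
  proof (rule Bochner_Integration.integrable_bound)
    show "AE \<mu> in lborel. norm (weight \<delta> \<mu> * (cmod (L2_inner f (gabor \<mu>)))\<^sup>2)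
      \<le> norm (2 * (weight \<delta>' \<mu> * (cmod (L2_inner f (gabor \<mu>)))\<^sup>2))"
      using mult_right_mono[OF w] weight_pos(2) by (intro AE_I2) (simp add: abs_mult mult.assoc)
  qed measurable
  with L show ?thesis by (simp add: H_delta_iff)
qed

section \<open>The sharp Poisson functional is unbounded below the critical exponent\<close>

definition gauss_plane :: "real \<times> real \<Rightarrow> real" where
  "gauss_plane \<mu> = exp (- pi / 2 * (fst \<mu>)\<^sup>2) * exp (- pi / 2 * (snd \<mu>)\<^sup>2)"

lemma gauss_plane_nonneg: "0 \<le> gauss_plane \<mu>"
  by (simp add: gauss_plane_def)

lemma gauss_plane_measurable [measurable]: "gauss_plane \<in> borel_measurable borel"
  unfolding gauss_plane_def by measurable

lemma cmod_L2_inner_gabor': "cmod (L2_inner (gabor \<nu>) (gabor \<mu>)) = gauss_plane (\<mu> - \<nu>)"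
  by (simp add: cmod_L2_inner_gabor gauss_plane_def power2_commute)

text \<open>From \<open>1 + x\<^sup>2 \<le> exp (x\<^sup>2)\<close> and pi/2 > 1, the weighted
  Gaussian is still dominated by the Gaussian \<open>exp (- pi * c * x\<^sup>2)\<close> with
  \<open>c = 1/2 - 1/pi\<close>. The constant \<open>A\<close> depends neither on \<open>B\<close>
  nor on \<nu>, both of which will grow with the size of the test functions.\<close>

lemma integral_weighted_gauss_plane:
  obtains A where "A \<ge> 0"
    and "\<And>B \<nu>. B \<ge> 1 \<Longrightarrow> integrable lborel (\<lambda>\<mu>. (B + (norm \<mu>)\<^sup>2) * gauss_plane (\<mu> - \<nu>))"
    and "\<And>B \<nu>. B \<ge> 1 \<Longrightarrow> (LINT \<mu>|lborel. (B + (norm \<mu>)\<^sup>2) * gauss_plane (\<mu> - \<nu>)) \<le> A * (B + 2 * (norm \<nu>)\<^sup>2)"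
proof -
  define c where "c = 1 / 2 - 1 / pi"
  have c: "c > 0" using pi_gt3 by (simp add: c_def field_simps)
  define k where "k = (\<lambda>x::real. exp (- pi * c * x\<^sup>2))"
  define A where "A = 2 / c"
  have ki: "integrable lborel (\<lambda>x. k (x - p))" "(LINT x|lborel. k (x - p)) = 1 / sqrt c" for p
    using lborel_integrable_real_affine[OF gaussian_fourier(1)[OF c], of 1 "- p"]
      lborel_integral_real_affine[of 1 k "- p"] gaussian_integral[OF c] by (simp_all add: k_def)
  have kb: "(1 + x\<^sup>2) * exp (- pi / 2 * x\<^sup>2) \<le> k x" for x
  proof -
    have "(1 + x\<^sup>2) * exp (- pi / 2 * x\<^sup>2) \<le> exp (x\<^sup>2) * exp (- pi / 2 * x\<^sup>2)"
      using exp_ge_add_one_self[of "x\<^sup>2"] by (intro mult_right_mono) auto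
    also have "\<dots> = k x" unfolding exp_add[symmetric] k_def c_def by (simp add: field_simps)
    finally show ?thesis .
  qed
  have bound: "(B + (norm \<mu>)\<^sup>2) * gauss_plane (\<mu> - \<nu>)
      \<le> (2 * (B + 2 * (norm \<nu>)\<^sup>2)) * (k (fst \<mu> - fst \<nu>) * k (snd \<mu> - snd \<nu>))" if B: "B \<ge> 1" for B \<mu> \<nu>
  proof -
    define x y where "x = fst \<mu> - fst \<nu>" and "y = snd \<mu> - snd \<nu>"
    have n: "(norm \<mu>)\<^sup>2 = (fst \<nu> + x)\<^sup>2 + (snd \<nu> + y)\<^sup>2" "(norm \<nu>)\<^sup>2 = (fst \<nu>)\<^sup>2 + (snd \<nu>)\<^sup>2"
      by (simp_all add: x_def y_def norm_prod_def)
    have e: "(a + b)\<^sup>2 \<le> 2 * a\<^sup>2 + 2 * b\<^sup>2" for a b :: real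
      using sum_squares_bound[of a b] by (simp add: power2_sum)
    have "B + (norm \<mu>)\<^sup>2 \<le> B + 2 * (norm \<nu>)\<^sup>2 + 2 * (x\<^sup>2 + y\<^sup>2)"
      unfolding n using e[of "fst \<nu>" x] e[of "snd \<nu>" y] by simp
    also have "\<dots> \<le> 2 * (B + 2 * (norm \<nu>)\<^sup>2) * (1 + (x\<^sup>2 + y\<^sup>2))"
    proof -
      have "b + 2 * r \<le> 2 * b * (1 + r)" if "1 \<le> b" "0 \<le> r" for b r :: real
        using mult_right_mono[OF that] that by (simp add: algebra_simps)
      moreover have "1 \<le> B + 2 * (norm \<nu>)\<^sup>2" using B by (intro add_increasing2) auto
      moreover have "0 \<le> x\<^sup>2 + y\<^sup>2" by simp
      ultimately show ?thesis .
    qed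
    also have "\<dots> \<le> 2 * (B + 2 * (norm \<nu>)\<^sup>2) * ((1 + x\<^sup>2) * (1 + y\<^sup>2))"
      using B by (intro mult_left_mono) (auto simp: algebra_simps)
    finally have "(B + (norm \<mu>)\<^sup>2) * gauss_plane (\<mu> - \<nu>)
      \<le> (2 * (B + 2 * (norm \<nu>)\<^sup>2) * ((1 + x\<^sup>2) * (1 + y\<^sup>2))) * gauss_plane (\<mu> - \<nu>)"
      by (intro mult_right_mono gauss_plane_nonneg)
    also have "\<dots> = 2 * (B + 2 * (norm \<nu>)\<^sup>2) * (((1 + x\<^sup>2) * exp (- pi / 2 * x\<^sup>2)) * ((1 + y\<^sup>2) * exp (- pi / 2 * y\<^sup>2)))"
      by (simp add: gauss_plane_def x_def y_def)
    also have "\<dots> \<le> 2 * (B + 2 * (norm \<nu>)\<^sup>2) * (k x * k y)"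
      using B by (intro mult_left_mono mult_mono kb) (auto simp: k_def)
    finally show ?thesis by (simp add: x_def y_def)
  qed
  have I: "integrable (lborel \<Otimes>\<^sub>M lborel) (\<lambda>(x, y). k (x - p) * k (y - q))" for p q
    by (rule lborel_pair.integrable_dominated_by_product[OF _ ki(1)[of p] ki(1)[of q]]) (auto simp: k_def)
  then have I': "integrable lborel (\<lambda>\<mu>. k (fst \<mu> - p) * k (snd \<mu> - q))" for p q
    unfolding lborel_prod by (simp add: case_prod_unfold)
  have J: "(LINT \<mu>|lborel. k (fst \<mu> - p) * k (snd \<mu> - q)) = 1 / c" for p q
  proof -
    have "(LINT \<mu>|lborel. k (fst \<mu> - p) * k (snd \<mu> - q)) = (LINT x|lborel. LINT y|lborel. k (x - p) * k (y - q))"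
      unfolding lborel_pair.integral_fst[OF I] unfolding lborel_prod by (simp add: case_prod_unfold)
    then show ?thesis using ki c by simp
  qed
  have int: "integrable lborel (\<lambda>\<mu>. (B + (norm \<mu>)\<^sup>2) * gauss_plane (\<mu> - \<nu>))" if B: "B \<ge> 1" for B \<nu>
  proof (rule Bochner_Integration.integrable_bound)
    show "integrable lborel (\<lambda>\<mu>. (2 * (B + 2 * (norm \<nu>)\<^sup>2)) * (k (fst \<mu> - fst \<nu>) * k (snd \<mu> - snd \<nu>)))"
      by (intro integrable_mult_right I')
    show "AE \<mu> in lborel. norm ((B + (norm \<mu>)\<^sup>2) * gauss_plane (\<mu> - \<nu>))
      \<le> norm ((2 * (B + 2 * (norm \<nu>)\<^sup>2)) * (k (fst \<mu> - fst \<nu>) * k (snd \<mu> - snd \<nu>)))"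
    proof (rule AE_I2)
      fix \<mu>
      have "0 \<le> (B + (norm \<mu>)\<^sup>2) * gauss_plane (\<mu> - \<nu>)" using B by (intro mult_nonneg_nonneg gauss_plane_nonneg) auto
      then show "norm ((B + (norm \<mu>)\<^sup>2) * gauss_plane (\<mu> - \<nu>))
        \<le> norm ((2 * (B + 2 * (norm \<nu>)\<^sup>2)) * (k (fst \<mu> - fst \<nu>) * k (snd \<mu> - snd \<nu>)))"
        using order_trans[OF bound[OF B, of \<mu> \<nu>] abs_ge_self] by simp
    qed
  qed measurable
  have "(LINT \<mu>|lborel. (B + (norm \<mu>)\<^sup>2) * gauss_plane (\<mu> - \<nu>)) \<le> A * (B + 2 * (norm \<nu>)\<^sup>2)" if B: "B \<ge> 1" for B \<nu>
  proof -
    have "(LINT \<mu>|lborel. (B + (norm \<mu>)\<^sup>2) * gauss_plane (\<mu> - \<nu>))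
      \<le> (LINT \<mu>|lborel. (2 * (B + 2 * (norm \<nu>)\<^sup>2)) * (k (fst \<mu> - fst \<nu>) * k (snd \<mu> - snd \<nu>)))"
      by (rule integral_mono[OF int[OF B] _ bound[OF B]]) (intro integrable_mult_right I')
    also have "\<dots> = (2 * (B + 2 * (norm \<nu>)\<^sup>2)) * (1 / c)"
      unfolding integral_mult_right_zero J ..
    finally show ?thesis by (simp add: A_def field_simps)
  qed
  then show ?thesis using that[of A] int c by (simp add: A_def)
qed

text \<open>The sum factors over the coordinates, and each factor is a lattice sum bounded uniformly
  in its shift. Thus the Gabor transform of a sum of many Gabor functions with unimodular
  coefficients stays bounded: the summands hardly overlap in the phase plane.\<close>

lemma gauss_plane_lattice_sum_le:
  assumes "finite M" "finite N"
  shows "(\<Sum>i\<in>M \<times> N. gauss_plane (\<mu> - (of_int (fst i) + 1/2, of_int (snd i) + 1/2))) \<le> (exp 1 * lattice_const)\<^sup>2"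
proof -
  have e: "exp (- pi / 2 * t\<^sup>2) \<le> exp 1 * exp (- \<bar>t\<bar>)" for t
  proof -
    have "0 \<le> (\<bar>t\<bar> - 1)\<^sup>2 + t\<^sup>2" by simp
    also have "\<dots> \<le> (pi / 2) * t\<^sup>2 * 2 - 2 * \<bar>t\<bar> + 2"
      using mult_right_mono[of 2 pi "t\<^sup>2"] pi_gt3 by (simp add: power2_diff)
    finally have "- pi / 2 * t\<^sup>2 \<le> 1 + - \<bar>t\<bar>" by simp
    then show ?thesis unfolding exp_add[symmetric] by simp
  qed
  have s: "(\<Sum>m\<in>M. exp (- pi / 2 * (p - (of_int m + 1/2))\<^sup>2)) \<le> exp 1 * lattice_const" if "finite M" for M p
  proof -
    have "(\<Sum>m\<in>M. exp (- pi / 2 * (p - (of_int m + 1/2))\<^sup>2)) \<le> (\<Sum>m\<in>M. exp 1 * exp (- \<bar>(1/2 - p) + of_int m\<bar>))"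
      using e[of "p - (of_int _ + 1/2)"] by (intro sum_mono) (simp add: abs_minus_commute algebra_simps)
    also have "\<dots> \<le> exp 1 * lattice_const"
      unfolding sum_distrib_left[symmetric] by (intro mult_left_mono lattice_sum_le that) auto
    finally show ?thesis .
  qed
  have "(\<Sum>i\<in>M \<times> N. gauss_plane (\<mu> - (of_int (fst i) + 1/2, of_int (snd i) + 1/2)))
     = (\<Sum>m\<in>M. exp (- pi / 2 * (fst \<mu> - (of_int m + 1/2))\<^sup>2)) * (\<Sum>n\<in>N. exp (- pi / 2 * (snd \<mu> - (of_int n + 1/2))\<^sup>2))"
    unfolding sum_product sum.cartesian_product by (intro sum.cong) (auto simp: gauss_plane_def)
  also have "\<dots> \<le> (exp 1 * lattice_const) * (exp 1 * lattice_const)"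
    using lattice_const_pos by (intro mult_mono s assms sum_nonneg) auto
  finally show ?thesis by (simp add: power2_eq_square)
qed

lemma zak_eq:
  assumes "continuous_rep f g"
  shows "zak f y \<xi> = (\<Sum>\<^sub>\<infinity>q. fourier_char q \<xi> * g (y + of_int q))"
  unfolding zak_def cont_rep_eqI[OF assms]
  by (intro infsum_cong) (simp add: fourier_char_def cis_conv_exp mult_ac)

lemma continuous_rep_gabor: "continuous_rep (gabor \<mu>) (gabor \<mu>)"
  unfolding continuous_rep_def
  using continuous_on_gabor[OF continuous_on_const continuous_on_id, of UNIV \<mu>] by simp

lemma sharp_poisson_gabor_half:
  "sharp_poisson (gabor (of_int m + 1/2, of_int n + 1/2)) = (-1) powi n"
  unfolding sharp_poisson_def zak_eq[OF continuous_rep_gabor]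
  using zak_gabor_half[of m n] Theta_0_nz unfolding zak_gabor_def by simp

text \<open>Below the radius \<open>N\<close>, \<open>norm \<mu> powr \<delta>\<close> is at most
  \<open>N powr \<delta>\<close>; beyond it, the non-positive power \<delta> - 2 is largest at
  \<open>N\<close>. A quadratic weight results, at the price of the small factor
  \<open>N powr (\<delta> - 2)\<close> on which the counterexample rests.\<close>

lemma weight_le:
  assumes d: "0 \<le> \<delta>" "\<delta> \<le> 2" and N: "N \<ge> 1"
  shows "weight \<delta> \<mu> \<le> N powr (\<delta> - 2) * (2 * N\<^sup>2 + (norm \<mu>)\<^sup>2)"
proof -
  have sq: "x powr 2 = x\<^sup>2" if "x > 0" for x :: real using powr_realpow[OF that, of 2] by simp
  have Nd: "N powr \<delta> = N powr (\<delta> - 2) * N\<^sup>2"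
    using N sq[of N] powr_add[of N "\<delta> - 2" 2] by simp
  have "1 \<le> N powr \<delta>" using N d by (intro ge_one_powr_ge_zero) auto
  moreover have "norm \<mu> powr \<delta> \<le> N powr (\<delta> - 2) * N\<^sup>2 + N powr (\<delta> - 2) * (norm \<mu>)\<^sup>2"
  proof (cases "norm \<mu> \<le> N")
    case True
    then have "norm \<mu> powr \<delta> \<le> N powr \<delta>" using d by (intro powr_mono2) auto
    moreover have "0 \<le> N powr (\<delta> - 2) * (norm \<mu>)\<^sup>2" by simp
    ultimately show ?thesis unfolding Nd by linarith
  next
    case False
    then have p: "norm \<mu> > 0" using N by linarith
    have "norm \<mu> powr \<delta> = norm \<mu> powr (\<delta> - 2) * (norm \<mu>)\<^sup>2"
      using p sq[OF p] powr_add[of "norm \<mu>" "\<delta> - 2" 2] by simp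
    also have "\<dots> \<le> N powr (\<delta> - 2) * (norm \<mu>)\<^sup>2"
      using False N d by (intro mult_right_mono powr_mono2') auto
    moreover have "0 \<le> N powr (\<delta> - 2) * N\<^sup>2" by simp
    ultimately show ?thesis by linarith
  qed
  ultimately show ?thesis unfolding weight_def Nd by (simp add: algebra_simps)
qed

text \<open>The kernel \<open>gauss_plane\<close> is at most 1, so its square is at most itself and
  the first-power Gaussian integral suffices.\<close>

lemma gabor_H_delta:
  assumes d: "0 \<le> \<delta>" "\<delta> \<le> 2"
  shows "gabor \<nu> \<in> H_delta \<delta>"
proof -
  obtain A where A: "\<And>B \<nu>. B \<ge> 1 \<Longrightarrow> integrable lborel (\<lambda>\<mu>. (B + (norm \<mu>)\<^sup>2) * gauss_plane (\<mu> - \<nu>))"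
    using integral_weighted_gauss_plane by metis
  have "integrable lborel (\<lambda>\<mu>. weight \<delta> \<mu> * (cmod (L2_inner (gabor \<nu>) (gabor \<mu>)))\<^sup>2)"
  proof (rule Bochner_Integration.integrable_bound)
    show "integrable lborel (\<lambda>\<mu>. (2 + (norm \<mu>)\<^sup>2) * gauss_plane (\<mu> - \<nu>))" by (rule A) simp
    show "AE \<mu> in lborel. norm (weight \<delta> \<mu> * (cmod (L2_inner (gabor \<nu>) (gabor \<mu>)))\<^sup>2)
      \<le> norm ((2 + (norm \<mu>)\<^sup>2) * gauss_plane (\<mu> - \<nu>))"
    proof (rule AE_I2)
      fix \<mu>
      have g: "gauss_plane (\<mu> - \<nu>) \<le> 1"
        unfolding gauss_plane_def by (intro mult_le_one) auto
      have "(gauss_plane (\<mu> - \<nu>))\<^sup>2 \<le> gauss_plane (\<mu> - \<nu>)"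
        unfolding power2_eq_square using mult_left_mono[OF g gauss_plane_nonneg[of "\<mu> - \<nu>"]] by simp
      then have "weight \<delta> \<mu> * (gauss_plane (\<mu> - \<nu>))\<^sup>2 \<le> (2 + (norm \<mu>)\<^sup>2) * gauss_plane (\<mu> - \<nu>)"
        using weight_le[OF d, of 1 \<mu>] weight_pos(2)[of \<delta> \<mu>] by (intro mult_mono) auto
      then show "norm (weight \<delta> \<mu> * (cmod (L2_inner (gabor \<nu>) (gabor \<mu>)))\<^sup>2) \<le> norm ((2 + (norm \<mu>)\<^sup>2) * gauss_plane (\<mu> - \<nu>))"
        unfolding cmod_L2_inner_gabor' using weight_pos(2)[of \<delta> \<mu>] gauss_plane_nonneg[of "\<mu> - \<nu>"] by (simp add: abs_mult)
    qed
  qed measurable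
  then show ?thesis by (simp add: H_delta_iff)
qed

lemma gabor_sum_H_delta:
  assumes d: "0 \<le> \<delta>" "\<delta> \<le> 2" and B: "finite B"
  shows "(\<lambda>x. \<Sum>i\<in>B. c i * gabor (\<nu> i) x) \<in> H_delta \<delta>"
  using B
proof (induction B)
  case empty
  have "(\<lambda>x. 0 * gabor 0 x) \<in> H_delta \<delta>" by (intro H_delta_cmult gabor_H_delta d)
  then show ?case by simp
next
  case (insert i B)
  then show ?case by (simp add: H_delta_add H_delta_cmult gabor_H_delta d)
qed

lemma L2_inner_gabor_sum:
  assumes B: "finite B"
  shows "L2_inner (\<lambda>x. \<Sum>i\<in>B. c i * gabor (\<nu> i) x) (gabor \<mu>) = (\<Sum>i\<in>B. c i * L2_inner (gabor (\<nu> i)) (gabor \<mu>))"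
  using B
proof (induction B)
  case empty
  then show ?case by (simp add: L2_inner_def)
next
  case (insert i B)
  \<comment> \<open>The exponent 1 is arbitrary; only membership in \<open>L2\<close> is
    extracted.\<close>
  have L: "(\<lambda>x. \<Sum>i\<in>B. c i * gabor (\<nu> i) x) \<in> L2"
    using gabor_sum_H_delta[of 1 B c \<nu>] insert by (simp add: H_delta_iff)
  have L': "(\<lambda>x. c i * gabor (\<nu> i) x) \<in> L2"
    using H_delta_cmult[OF gabor_H_delta[of 1]] by (simp add: H_delta_iff)
  show ?case using insert L2_inner_add[OF L' L gabor_L2] by (simp add: L2_inner_cmult)
qed

text \<open>The average of \<open>(-1)\<^sup>n e\<close> over the points \<open>(m + 1/2, n + 1/2)\<close>, \<open>0 \<le> m, n < N\<close>, is mapped to \<open>1\<close>,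
  while the square of its norm is of order \<open>N powr (\<delta> - 2)\<close>.\<close>

lemma sharp_poisson_not_continuous:
  assumes a: "0 \<le> a" "a < 2" and cont: "continuous_functional a sharp_poisson"
  shows False
proof -
  \<comment> \<open>The midpoint lies strictly between \<open>a\<close>, so that continuity on
    \<open>H_delta \<delta>\<close> is part of the assumption, and 2, so that
    \<open>real N powr (\<delta> - 2)\<close> tends to 0.\<close>
  define \<delta> where "\<delta> = (a + 2) / 2"
  have d: "a < \<delta>" "0 \<le> \<delta>" "\<delta> \<le> 2" "\<delta> < 2" using a by (auto simp: \<delta>_def)
  have sub: "f \<in> H_space a" if "f \<in> H_delta \<delta>" for f using that d by (auto simp: H_space_def)
  have lin_add: "sharp_poisson (\<lambda>x. f x + g x) = sharp_poisson f + sharp_poisson g"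
    and lin_mult: "sharp_poisson (\<lambda>x. c * f x) = c * sharp_poisson f"
    if "f \<in> H_delta \<delta>" "g \<in> H_delta \<delta>" for f g c
    using cont sub that unfolding continuous_functional_def linear_functional_on_def by blast+
  have zero: "(\<lambda>x. 0) \<in> H_delta \<delta>" using gabor_sum_H_delta[OF d(2,3), of "{}"] by simp
  have sp0: "sharp_poisson (\<lambda>x. 0) = 0" using lin_mult[OF zero zero, of 0] by simp
  define \<nu> where "\<nu> = (\<lambda>i::int \<times> int. (real_of_int (fst i) + 1/2, real_of_int (snd i) + 1/2))"
  have sp_sum: "sharp_poisson (\<lambda>x. \<Sum>i\<in>B. c i * gabor (\<nu> i) x) = (\<Sum>i\<in>B. c i * (-1) powi (snd i))" if "finite B" for B c
    using that
  proof (induction B)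
    case (insert i B)
    have "sharp_poisson (\<lambda>x. c i * gabor (\<nu> i) x) = c i * (-1) powi (snd i)"
      using lin_mult[OF gabor_H_delta[OF d(2,3)] zero] sharp_poisson_gabor_half by (simp add: \<nu>_def)
    moreover have "sharp_poisson (\<lambda>x. c i * gabor (\<nu> i) x + (\<Sum>i\<in>B. c i * gabor (\<nu> i) x))
      = sharp_poisson (\<lambda>x. c i * gabor (\<nu> i) x) + sharp_poisson (\<lambda>x. \<Sum>i\<in>B. c i * gabor (\<nu> i) x)"
      by (rule lin_add[OF H_delta_cmult[OF gabor_H_delta[OF d(2,3)]] gabor_sum_H_delta[OF d(2,3) insert(1)]])
    ultimately show ?case using insert by simp
  qed (use sp0 in simp)
  obtain A where A: "A \<ge> 0" "\<And>B \<nu>. B \<ge> 1 \<Longrightarrow> integrable lborel (\<lambda>\<mu>. (B + (norm \<mu>)\<^sup>2) * gauss_plane (\<mu> - \<nu>))"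
    "\<And>B \<nu>. B \<ge> 1 \<Longrightarrow> (LINT \<mu>|lborel. (B + (norm \<mu>)\<^sup>2) * gauss_plane (\<mu> - \<nu>)) \<le> A * (B + 2 * (norm \<nu>)\<^sup>2)"
    by (rule integral_weighted_gauss_plane, rule that)
  define K where "K = (exp 1 * lattice_const)\<^sup>2"
  define Q where "Q = (\<lambda>N::nat. {0..<int N} \<times> {0..<int N})"
  define g where "g = (\<lambda>(N::nat) x. \<Sum>i\<in>Q N. (of_real (1 / (real N)\<^sup>2) * (-1) powi (snd i)) * gabor (\<nu> i) x)"
  have fin: "finite (Q N)" for N by (simp add: Q_def)
  have card: "card (Q N) = N\<^sup>2" for N by (simp add: Q_def power2_eq_square)
  have gH: "g N \<in> H_delta \<delta>" for N unfolding g_def by (rule gabor_sum_H_delta[OF d(2,3) fin])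
  have sp: "sharp_poisson (g N) = 1" if N: "N \<ge> 1" for N
  proof -
    have "sharp_poisson (g N) = (\<Sum>i\<in>Q N. (of_real (1 / (real N)\<^sup>2) * (-1) powi (snd i)) * (-1) powi (snd i))"
      unfolding g_def by (rule sp_sum[OF fin])
    also have "\<dots> = (\<Sum>i\<in>Q N. of_real (1 / (real N)\<^sup>2))"
    proof (intro sum.cong refl)
      fix i :: "int \<times> int"
      have "((-1) powi (snd i) * (-1) powi (snd i) :: complex) = 1"
        by (simp add: power_int_mult_distrib[symmetric])
      then show "(of_real (1 / (real N)\<^sup>2) * (-1) powi (snd i)) * (-1) powi (snd i) = complex_of_real (1 / (real N)\<^sup>2)"
        by (simp only: mult.assoc mult_1_right)
    qed
    also have "\<dots> = 1" using N by (simp add: card)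
    finally show ?thesis .
  qed
  \<comment> \<open>In the square of the transform one factor \<open>S\<close> is bounded by
    \<open>K\<close> and the other is integrated. The \<open>N\<^sup>2\<close> integrals are at most
    \<open>A * (6 * (real N)\<^sup>2)\<close> each, and \<open>c\<^sup>2\<close>, the inverse fourth
    power of \<open>N\<close>, cancels them up to the factor from \<open>weight_le\<close>.\<close>
  have norm_le: "(H_norm \<delta> (g N))\<^sup>2 \<le> 6 * A * K * real N powr (\<delta> - 2)" if N: "N \<ge> 1" for N
  proof -
    define c where "c = 1 / (real N)\<^sup>2"
    define S where "S = (\<lambda>\<mu>. \<Sum>i\<in>Q N. gauss_plane (\<mu> - \<nu> i))"
    have S: "0 \<le> S \<mu>" "S \<mu> \<le> K" for \<mu>
      using gauss_plane_lattice_sum_le[of "{0..<int N}" "{0..<int N}" \<mu>]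
      by (auto simp: S_def K_def \<nu>_def Q_def intro!: sum_nonneg gauss_plane_nonneg)
    have V: "cmod (L2_inner (g N) (gabor \<mu>)) \<le> c * S \<mu>" for \<mu>
    proof -
      have "cmod (L2_inner (g N) (gabor \<mu>)) \<le> (\<Sum>i\<in>Q N. c * gauss_plane (\<mu> - \<nu> i))"
        unfolding g_def L2_inner_gabor_sum[OF fin]
        by (rule order_trans[OF norm_sum], rule sum_mono)
           (simp add: norm_mult norm_power norm_power_int cmod_L2_inner_gabor' c_def norm_divide)
      then show ?thesis by (simp add: S_def sum_distrib_left)
    qed
    have N1: "2 * (real N)\<^sup>2 \<ge> 1" using one_le_power[of "real N" 2] N by linarith
    have nu: "(norm (\<nu> i))\<^sup>2 \<le> 2 * (real N)\<^sup>2" if "i \<in> Q N" for i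
    proof -
      have b: "real_of_int (fst i) + 1/2 \<le> real N" "real_of_int (snd i) + 1/2 \<le> real N"
        "0 \<le> real_of_int (fst i) + 1/2" "0 \<le> real_of_int (snd i) + 1/2"
        using that by (auto simp: Q_def)
      have "(norm (\<nu> i))\<^sup>2 = (real_of_int (fst i) + 1/2)\<^sup>2 + (real_of_int (snd i) + 1/2)\<^sup>2"
        by (simp add: \<nu>_def norm_prod_def)
      also have "\<dots> \<le> (real N)\<^sup>2 + (real N)\<^sup>2" by (intro add_mono power_mono b)
      finally show ?thesis by simp
    qed
    have intg: "integrable lborel (\<lambda>\<mu>. real N powr (\<delta> - 2) * c\<^sup>2 * K * ((2 * (real N)\<^sup>2 + (norm \<mu>)\<^sup>2) * S \<mu>))"
      unfolding S_def sum_distrib_left[of _ _ "Q N"]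
      by (intro Bochner_Integration.integrable_sum integrable_mult_right A(2) N1)
    have "(H_norm \<delta> (g N))\<^sup>2 \<le> (LINT \<mu>|lborel. real N powr (\<delta> - 2) * c\<^sup>2 * K * ((2 * (real N)\<^sup>2 + (norm \<mu>)\<^sup>2) * S \<mu>))"
      unfolding H_norm_sq
    proof (rule integral_mono[OF _ intg])
      show "integrable lborel (\<lambda>\<mu>. weight \<delta> \<mu> * (cmod (L2_inner (g N) (gabor \<mu>)))\<^sup>2)"
        using gH[of N] by (simp add: H_delta_iff)
      fix \<mu>
      have "(cmod (L2_inner (g N) (gabor \<mu>)))\<^sup>2 \<le> (c * S \<mu>)\<^sup>2" using V by (intro power_mono) auto
      also have "\<dots> = c\<^sup>2 * (S \<mu> * S \<mu>)" by (simp add: power2_eq_square mult_ac)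
      also have "\<dots> \<le> c\<^sup>2 * (K * S \<mu>)" using S by (intro mult_left_mono mult_right_mono) auto
      finally have "weight \<delta> \<mu> * (cmod (L2_inner (g N) (gabor \<mu>)))\<^sup>2
        \<le> (real N powr (\<delta> - 2) * (2 * (real N)\<^sup>2 + (norm \<mu>)\<^sup>2)) * (c\<^sup>2 * (K * S \<mu>))"
        using weight_le[OF d(2,3), of "real N" \<mu>] N weight_pos(2)[of \<delta> \<mu>] by (intro mult_mono) auto
      then show "weight \<delta> \<mu> * (cmod (L2_inner (g N) (gabor \<mu>)))\<^sup>2
        \<le> real N powr (\<delta> - 2) * c\<^sup>2 * K * ((2 * (real N)\<^sup>2 + (norm \<mu>)\<^sup>2) * S \<mu>)"
        by (simp add: mult_ac)
    qed
    also have "\<dots> = real N powr (\<delta> - 2) * c\<^sup>2 * K * (\<Sum>i\<in>Q N. LINT \<mu>|lborel. (2 * (real N)\<^sup>2 + (norm \<mu>)\<^sup>2) * gauss_plane (\<mu> - \<nu> i))"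
      unfolding integral_mult_right_zero S_def sum_distrib_left[of _ _ "Q N"]
      by (subst Bochner_Integration.integral_sum) (auto simp: sum_distrib_left intro: A(2) N1)
    also have "\<dots> \<le> real N powr (\<delta> - 2) * c\<^sup>2 * K * (\<Sum>i\<in>Q N. A * (6 * (real N)\<^sup>2))"
    proof (intro mult_left_mono sum_mono)
      fix i assume i: "i \<in> Q N"
      have "(LINT \<mu>|lborel. (2 * (real N)\<^sup>2 + (norm \<mu>)\<^sup>2) * gauss_plane (\<mu> - \<nu> i)) \<le> A * (2 * (real N)\<^sup>2 + 2 * (norm (\<nu> i))\<^sup>2)"
        by (rule A(3)[OF N1])
      also have "\<dots> \<le> A * (6 * (real N)\<^sup>2)" using nu[OF i] A(1) by (intro mult_left_mono) auto
      finally show "(LINT \<mu>|lborel. (2 * (real N)\<^sup>2 + (norm \<mu>)\<^sup>2) * gauss_plane (\<mu> - \<nu> i)) \<le> A * (6 * (real N)\<^sup>2)" .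
    qed (auto simp: K_def)
    also have "\<dots> = 6 * A * K * real N powr (\<delta> - 2)"
      using N by (simp add: card c_def power2_eq_square field_simps)
    finally show ?thesis .
  qed
  have "(\<lambda>N. 6 * A * K * real N powr (\<delta> - 2)) \<longlonglongrightarrow> 6 * A * K * 0"
    using d by (intro tendsto_intros tendsto_neg_powr filterlim_real_sequentially) auto
  then have lim: "(\<lambda>N. 6 * A * K * real N powr (\<delta> - 2)) \<longlonglongrightarrow> 0" by simp
  have "continuous_on_H_delta \<delta> sharp_poisson" using cont d by (simp add: continuous_functional_def)
  from spec[OF bspec[OF this[unfolded continuous_on_H_delta_def] zero], of 1]
  obtain \<eta> where \<eta>: "\<eta> > 0" "\<And>g. g \<in> H_delta \<delta> \<Longrightarrow> H_norm \<delta> (\<lambda>x. g x - 0) < \<eta> \<Longrightarrow>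
      cmod (sharp_poisson g - sharp_poisson (\<lambda>x. 0)) < 1"
    by auto
  have "eventually (\<lambda>N. 6 * A * K * real N powr (\<delta> - 2) < \<eta>\<^sup>2) sequentially"
    using lim by (rule order_tendstoD(2)) (use \<eta> in simp)
  then have "eventually (\<lambda>N. 6 * A * K * real N powr (\<delta> - 2) < \<eta>\<^sup>2 \<and> N \<ge> 1) sequentially"
    by (intro eventually_conj eventually_ge_at_top)
  then obtain N where N: "6 * A * K * real N powr (\<delta> - 2) < \<eta>\<^sup>2" "N \<ge> 1"
    by (auto simp: eventually_sequentially)
  have "(H_norm \<delta> (g N))\<^sup>2 < \<eta>\<^sup>2" using norm_le[OF N(2)] N(1) by simp
  then have "H_norm \<delta> (g N) < \<eta>" by (rule power2_less_imp_less) (use \<eta>(1) in auto)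
  then have "cmod (sharp_poisson (g N) - sharp_poisson (\<lambda>x. 0)) < 1" using \<eta>(2)[OF gH[of N]] by simp
  then show False using sp[OF N(2)] sp0 by simp
qed

section \<open>The expansion above the critical exponent\<close>

definition Hoelder_exp :: "real \<Rightarrow> real" where
  "Hoelder_exp \<delta> = min 1 ((\<delta> - 2) / 4)"

text \<open>With (\<delta> - 2) / 4, at most half of the surplus over 2 is spent, since the exponent
  enters doubled after squaring; what is left keeps \<delta> - 2 \<alpha> above the dimension 2 of
  the phase plane.\<close>

lemma Hoelder_exp:
  assumes "\<delta> > 2"
  shows "0 < Hoelder_exp \<delta>" "Hoelder_exp \<delta> \<le> 1" "\<delta> - 2 * Hoelder_exp \<delta> > 2"
  using assms by (auto simp: Hoelder_exp_def min_def field_simps)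

text \<open>Cauchy-Schwarz between the square root of the weight times the Gabor transform, whose
  norm is \<open>H_norm \<delta> f\<close>, and \<open>G\<close>, whose square decays like the power
  - (\<delta> - 2 \<alpha>) of \<open>1 + norm \<mu>\<close>, which is integrable over the
  plane.\<close>

lemma H_delta_weighted_integrable:
  assumes d: "\<delta> > 2"
  obtains K where "K \<ge> 0"
    and "\<And>f. f \<in> H_delta \<delta> \<Longrightarrow> integrable lborel (\<lambda>\<mu>. cmod (L2_inner f (gabor \<mu>)) * (1 + norm \<mu>) powr Hoelder_exp \<delta>)"
    and "\<And>f. f \<in> H_delta \<delta> \<Longrightarrow>
      (LINT \<mu>|lborel. cmod (L2_inner f (gabor \<mu>)) * (1 + norm \<mu>) powr Hoelder_exp \<delta>) \<le> K * H_norm \<delta> f"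
proof -
  let ?\<alpha> = "Hoelder_exp \<delta>"
  note \<alpha> = Hoelder_exp[OF d]
  define G where "G = (\<lambda>\<mu>::real \<times> real. (1 + norm \<mu>) powr ?\<alpha> / sqrt (weight \<delta> \<mu>))"
  have [measurable]: "G \<in> borel_measurable borel" unfolding G_def by measurable
  have w: "(1 + norm \<mu>) powr \<delta> \<le> 2 powr \<delta> * weight \<delta> \<mu>" for \<mu> :: "real \<times> real"
  proof (cases "norm \<mu> \<le> 1")
    case True
    then have "(1 + norm \<mu>) powr \<delta> \<le> 2 powr \<delta>" using d by (intro powr_mono2) auto
    also have "\<dots> \<le> 2 powr \<delta> * weight \<delta> \<mu>" using weight_pos(3)[of \<delta> \<mu>] by simp
    finally show ?thesis .
  next
    case False
    then have "(1 + norm \<mu>) powr \<delta> \<le> (2 * norm \<mu>) powr \<delta>" using d by (intro powr_mono2) auto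
    also have "\<dots> = 2 powr \<delta> * norm \<mu> powr \<delta>" by (simp add: powr_mult)
    also have "\<dots> \<le> 2 powr \<delta> * weight \<delta> \<mu>" by (intro mult_left_mono) (auto simp: weight_def)
    finally show ?thesis .
  qed
  have G2: "integrable lborel (\<lambda>\<mu>. (G \<mu>)\<^sup>2)"
  proof (rule Bochner_Integration.integrable_bound)
    show "integrable lborel (\<lambda>\<mu>::real \<times> real. 2 powr \<delta> * (1 + norm \<mu>) powr (- (\<delta> - 2 * ?\<alpha>)))"
      using \<alpha> by (intro integrable_mult_right integrable_one_plus_norm_powr)
    show "AE \<mu> in lborel. norm ((G \<mu>)\<^sup>2) \<le> norm (2 powr \<delta> * (1 + norm \<mu>) powr (- (\<delta> - 2 * ?\<alpha>)))"
    proof (rule AE_I2)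
      fix \<mu> :: "real \<times> real"
      have p: "1 + norm \<mu> > 0" by (simp add: add_pos_nonneg)
      have "(G \<mu>)\<^sup>2 = (1 + norm \<mu>) powr (2 * ?\<alpha>) / weight \<delta> \<mu>"
        using weight_pos(2)[of \<delta> \<mu>] unfolding G_def power_divide
        by (simp add: power2_eq_square powr_add[symmetric])
      also have "(1 + norm \<mu>) powr (2 * ?\<alpha>) = (1 + norm \<mu>) powr (- (\<delta> - 2 * ?\<alpha>)) * (1 + norm \<mu>) powr \<delta>"
        unfolding powr_add[symmetric] by simp
      also have "\<dots> / weight \<delta> \<mu> \<le> (1 + norm \<mu>) powr (- (\<delta> - 2 * ?\<alpha>)) * (2 powr \<delta> * weight \<delta> \<mu>) / weight \<delta> \<mu>"
        using weight_pos(2)[of \<delta> \<mu>] w by (intro divide_right_mono mult_left_mono) auto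
      also have "\<dots> = 2 powr \<delta> * (1 + norm \<mu>) powr (- (\<delta> - 2 * ?\<alpha>))"
        using weight_pos(1)[of \<delta> \<mu>] by simp
      finally show "norm ((G \<mu>)\<^sup>2) \<le> norm (2 powr \<delta> * (1 + norm \<mu>) powr (- (\<delta> - 2 * ?\<alpha>)))" by simp
    qed
  qed measurable
  define K where "K = sqrt (LINT \<mu>|lborel. (G \<mu>)\<^sup>2)"
  have main: "integrable lborel (\<lambda>\<mu>. cmod (L2_inner f (gabor \<mu>)) * (1 + norm \<mu>) powr ?\<alpha>) \<and>
      (LINT \<mu>|lborel. cmod (L2_inner f (gabor \<mu>)) * (1 + norm \<mu>) powr ?\<alpha>) \<le> K * H_norm \<delta> f"
    if f: "f \<in> H_delta \<delta>" for f
  proof -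
    define F where "F = (\<lambda>\<mu>. sqrt (weight \<delta> \<mu>) * cmod (L2_inner f (gabor \<mu>)))"
    have [measurable]: "f \<in> borel_measurable borel" using f by (auto simp: H_delta_iff intro: L2_measurable)
    have Fm: "F \<in> borel_measurable lborel" unfolding F_def by measurable
    have F2: "(\<lambda>\<mu>. (F \<mu>)\<^sup>2) = (\<lambda>\<mu>. weight \<delta> \<mu> * (cmod (L2_inner f (gabor \<mu>)))\<^sup>2)"
      using weight_pos(2) by (simp add: F_def power_mult_distrib)
    have Fi: "integrable lborel (\<lambda>\<mu>. (F \<mu>)\<^sup>2)" unfolding F2 using f by (simp add: H_delta_iff)
    have FG: "F \<mu> * G \<mu> = cmod (L2_inner f (gabor \<mu>)) * (1 + norm \<mu>) powr ?\<alpha>" for \<mu>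
      using weight_pos(1)[of \<delta> \<mu>] by (simp add: F_def G_def)
    have Gm: "G \<in> borel_measurable lborel" by simp
    have i: "integrable lborel (\<lambda>\<mu>. F \<mu> * G \<mu>)" and
      b: "(LINT \<mu>|lborel. \<bar>F \<mu> * G \<mu>\<bar>)\<^sup>2 \<le> (LINT \<mu>|lborel. (F \<mu>)\<^sup>2) * (LINT \<mu>|lborel. (G \<mu>)\<^sup>2)"
      by (rule Cauchy_Schwarz_integral[OF Fm Gm Fi G2])+
    have "(LINT \<mu>|lborel. cmod (L2_inner f (gabor \<mu>)) * (1 + norm \<mu>) powr ?\<alpha>)\<^sup>2 \<le> (K * H_norm \<delta> f)\<^sup>2"
      using b unfolding FG F2 H_norm_sq[symmetric] K_def by (simp add: abs_mult power_mult_distrib mult.commute)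
    then have "(LINT \<mu>|lborel. cmod (L2_inner f (gabor \<mu>)) * (1 + norm \<mu>) powr ?\<alpha>) \<le> K * H_norm \<delta> f"
      by (rule power2_le_imp_le) (simp add: K_def H_norm_nonneg)
    then show ?thesis using i unfolding FG by simp
  qed
  show ?thesis by (rule that[of K]) (use main in \<open>auto simp: K_def\<close>)
qed

lemma one_le_one_plus_norm_powr:
  fixes \<mu> :: "'a::real_normed_vector"
  assumes "\<alpha> \<ge> 0"
  shows "1 \<le> (1 + norm \<mu>) powr \<alpha>"
  using assms by (intro ge_one_powr_ge_zero) auto

lemma H_delta_gabor_integrable:
  assumes d: "\<delta> > 2" and f: "f \<in> H_delta \<delta>"
  shows "integrable lborel (\<lambda>\<mu>. L2_inner f (gabor \<mu>))"
proof -
  obtain K where K: "integrable lborel (\<lambda>\<mu>. cmod (L2_inner f (gabor \<mu>)) * (1 + norm \<mu>) powr Hoelder_exp \<delta>)"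
    using H_delta_weighted_integrable[OF d] f by metis
  have [measurable]: "f \<in> borel_measurable borel" using f by (auto simp: H_delta_iff intro: L2_measurable)
  show ?thesis
  proof (rule Bochner_Integration.integrable_bound[OF K])
    show "AE \<mu> in lborel. norm (L2_inner f (gabor \<mu>)) \<le> norm (cmod (L2_inner f (gabor \<mu>)) * (1 + norm \<mu>) powr Hoelder_exp \<delta>)"
    proof (rule AE_I2)
      fix \<mu> :: "real \<times> real"
      have "cmod (L2_inner f (gabor \<mu>)) * 1 \<le> cmod (L2_inner f (gabor \<mu>)) * (1 + norm \<mu>) powr Hoelder_exp \<delta>"
        using Hoelder_exp[OF d] by (intro mult_left_mono one_le_one_plus_norm_powr) auto
      then show "norm (L2_inner f (gabor \<mu>)) \<le> norm (cmod (L2_inner f (gabor \<mu>)) * (1 + norm \<mu>) powr Hoelder_exp \<delta>)"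
        by simp
    qed
  qed measurable
qed

text \<open>For \<delta> > 2 this is the Zak transform of the element \<open>f\<close> of
  \<open>H_delta \<delta>\<close>. As an integral over the phase plane it inherits measurability,
  linearity and Hoelder continuity from \<open>zak_gabor\<close>, with no reference to continuous
  representatives.\<close>

definition zak_synthesis :: "(real \<Rightarrow> complex) \<Rightarrow> real \<Rightarrow> real \<Rightarrow> complex" where
  "zak_synthesis f y \<xi> = (LINT \<mu>|lborel. L2_inner f (gabor \<mu>) * zak_gabor \<mu> y \<xi>)"

lemma zak_synthesis_measurable [measurable (raw)]:
  assumes [measurable]: "f \<in> borel_measurable borel" "g \<in> borel_measurable M" "h \<in> borel_measurable M"
  shows "(\<lambda>x. zak_synthesis f (g x) (h x)) \<in> borel_measurable M"
  unfolding zak_synthesis_def by measurable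

lemma zak_synthesis_integrable:
  assumes V: "integrable lborel (\<lambda>\<mu>. L2_inner f (gabor \<mu>))"
  shows "integrable lborel (\<lambda>\<mu>. L2_inner f (gabor \<mu>) * zak_gabor \<mu> y \<xi>)"
proof (rule Bochner_Integration.integrable_bound)
  have [measurable]: "(\<lambda>\<mu>. L2_inner f (gabor \<mu>)) \<in> borel_measurable borel" using V by auto
  show "integrable lborel (\<lambda>\<mu>. of_real (2 * exp 1 * lattice_const) * L2_inner f (gabor \<mu>))" using V by simp
  show "(\<lambda>\<mu>. L2_inner f (gabor \<mu>) * zak_gabor \<mu> y \<xi>) \<in> borel_measurable lborel" by measurable
  show "AE \<mu> in lborel. norm (L2_inner f (gabor \<mu>) * zak_gabor \<mu> y \<xi>)
    \<le> norm (of_real (2 * exp 1 * lattice_const) * L2_inner f (gabor \<mu>))"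
  proof (rule AE_I2)
    fix \<mu>
    have "cmod (zak_gabor \<mu> y \<xi>) * cmod (L2_inner f (gabor \<mu>)) \<le> (2 * exp 1 * lattice_const) * cmod (L2_inner f (gabor \<mu>))"
      by (intro mult_right_mono cmod_zak_gabor_le) auto
    then show "norm (L2_inner f (gabor \<mu>) * zak_gabor \<mu> y \<xi>)
      \<le> norm (of_real (2 * exp 1 * lattice_const) * L2_inner f (gabor \<mu>))"
      using lattice_const_pos unfolding norm_mult norm_of_real by (simp add: mult.commute)
  qed
qed

text \<open>The sum of \<open>cmod (gabor \<mu> (y + of_int q))\<close> over \<open>q\<close> is
  bounded uniformly in \<mu> and \<open>y\<close>, so integrability of the Gabor transform alone
  justifies exchanging the sum over \<open>q\<close> with the integral over the phase plane.\<close>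

lemma gabor_synthesis_summable:
  assumes V: "integrable lborel (\<lambda>\<mu>. L2_inner f (gabor \<mu>))"
  shows "(\<lambda>q. cmod (gabor_synthesis f (y + of_int q))) summable_on UNIV"
    and "zak_synthesis f y \<xi> = (\<Sum>n. fourier_char (int_decode n) \<xi> * gabor_synthesis f (y + of_int (int_decode n)))"
proof -
  have [measurable]: "(\<lambda>\<mu>. L2_inner f (gabor \<mu>)) \<in> borel_measurable borel" using V by auto
  define C where "C = (LINT \<mu>|lborel. cmod (L2_inner f (gabor \<mu>)) * (2 * exp 1 * lattice_const))"
  have ti: "integrable lborel (\<lambda>\<mu>. L2_inner f (gabor \<mu>) * gabor \<mu> x)" for x
  proof (rule Bochner_Integration.integrable_bound)
    show "integrable lborel (\<lambda>\<mu>. 2 * L2_inner f (gabor \<mu>))" using V by simp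
    show "AE \<mu> in lborel. norm (L2_inner f (gabor \<mu>) * gabor \<mu> x) \<le> norm (2 * L2_inner f (gabor \<mu>))"
      using gauss_window_le by (auto simp: norm_mult cmod_gabor mult.commute[of 2] intro!: AE_I2 mult_left_mono)
  qed measurable
  have fin: "(\<Sum>q\<in>A. LINT \<mu>|lborel. cmod (L2_inner f (gabor \<mu>) * gabor \<mu> (y + of_int q))) \<le> C" if A: "finite A" for A
  proof -
    have "(\<Sum>q\<in>A. LINT \<mu>|lborel. cmod (L2_inner f (gabor \<mu>) * gabor \<mu> (y + of_int q)))
      = (LINT \<mu>|lborel. (\<Sum>q\<in>A. cmod (L2_inner f (gabor \<mu>) * gabor \<mu> (y + of_int q))))"
      by (rule Bochner_Integration.integral_sum[symmetric]) (use ti in auto)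
    also have "\<dots> \<le> C" unfolding C_def
    proof (rule integral_mono)
      show "integrable lborel (\<lambda>\<mu>. \<Sum>q\<in>A. cmod (L2_inner f (gabor \<mu>) * gabor \<mu> (y + of_int q)))"
        using ti by (intro Bochner_Integration.integrable_sum) auto
      fix \<mu>
      have "(\<Sum>q\<in>A. cmod (gabor \<mu> (y + of_int q))) \<le> (\<Sum>q\<in>A. (2 * exp 1) * exp (- \<bar>(y - fst \<mu>) + of_int q\<bar>))"
        by (intro sum_mono gabor_term_le)
      also have "\<dots> \<le> 2 * exp 1 * lattice_const"
        unfolding sum_distrib_left[symmetric] by (intro mult_left_mono lattice_sum_le A) auto
      finally show "(\<Sum>q\<in>A. cmod (L2_inner f (gabor \<mu>) * gabor \<mu> (y + of_int q))) \<le> cmod (L2_inner f (gabor \<mu>)) * (2 * exp 1 * lattice_const)"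
        unfolding norm_mult sum_distrib_left[symmetric] by (intro mult_left_mono) auto
    qed (use V in auto)
    finally show ?thesis .
  qed
  show s: "(\<lambda>q. cmod (gabor_synthesis f (y + of_int q))) summable_on UNIV"
  proof (rule nonneg_bounded_partial_sums_imp_summable_on)
    have "(\<Sum>q\<in>A. cmod (gabor_synthesis f (y + of_int q))) \<le> C" if "finite A" for A
      unfolding gabor_synthesis_def by (rule order_trans[OF sum_mono[OF integral_norm_bound] fin[OF that]])
    then show "\<forall>\<^sub>F A in finite_subsets_at_top UNIV. (\<Sum>q\<in>A. cmod (gabor_synthesis f (y + of_int q))) \<le> C"
      by (auto intro!: eventually_finite_subsets_at_top_weakI)
  qed auto
  let ?T = "\<lambda>n \<mu>. fourier_char (int_decode n) \<xi> * (L2_inner f (gabor \<mu>) * gabor \<mu> (y + of_int (int_decode n)))"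
  have sm: "summable (\<lambda>n. cmod (gabor \<mu> (y + of_int (int_decode n))))"
    "zak_gabor \<mu> y \<xi> = (\<Sum>n. fourier_char (int_decode n) \<xi> * gabor \<mu> (y + of_int (int_decode n)))" for \<mu>
    using int_decode_sums(1)[OF lattice_summable(1)[OF gabor_term_le[of \<mu> y]]]
      int_decode_sums(2)[OF lattice_summable(1)[OF zak_gabor_term_le[of _ \<xi> \<mu> y]]] by (simp_all add: zak_gabor_def)
  have swap: "(LINT \<mu>|lborel. (\<Sum>n. ?T n \<mu>)) = (\<Sum>n. LINT \<mu>|lborel. ?T n \<mu>)"
  proof (rule integral_suminf)
    show "integrable lborel (?T n)" for n using ti by simp
    show "AE \<mu> in lborel. summable (\<lambda>n. norm (?T n \<mu>))"
      using sm(1) by (simp add: norm_mult summable_mult)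
    show "summable (\<lambda>n. LINT \<mu>|lborel. norm (?T n \<mu>))"
    proof (rule summableI_nonneg_bounded)
      fix N
      have "(\<Sum>n<N. LINT \<mu>|lborel. norm (?T n \<mu>)) = (\<Sum>q\<in>int_decode ` {..<N}. LINT \<mu>|lborel. cmod (L2_inner f (gabor \<mu>) * gabor \<mu> (y + of_int q)))"
        by (subst sum.reindex) (auto simp: inj_int_decode norm_mult)
      then show "(\<Sum>n<N. LINT \<mu>|lborel. norm (?T n \<mu>)) \<le> C" using fin by simp
    qed simp
  qed
  have T: "(\<Sum>n. ?T n \<mu>) = L2_inner f (gabor \<mu>) * zak_gabor \<mu> y \<xi>" for \<mu>
  proof -
    have "summable (\<lambda>n. fourier_char (int_decode n) \<xi> * gabor \<mu> (y + of_int (int_decode n)))"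
      by (rule summable_norm_cancel) (use sm(1)[of \<mu>] in \<open>simp add: norm_mult\<close>)
    from suminf_mult[OF this, of "L2_inner f (gabor \<mu>)"]
    show ?thesis
      unfolding sm(2)[of \<mu>] by (simp only: mult.left_commute)
  qed
  show "zak_synthesis f y \<xi> = (\<Sum>n. fourier_char (int_decode n) \<xi> * gabor_synthesis f (y + of_int (int_decode n)))"
    using swap unfolding T zak_synthesis_def gabor_synthesis_def by simp
qed

lemma zak_eq_zak_synthesis:
  assumes f: "f \<in> L2" and V: "integrable lborel (\<lambda>\<mu>. L2_inner f (gabor \<mu>))"
  shows "zak f y \<xi> = zak_synthesis f y \<xi>"
  unfolding zak_eq[OF cont_rep_gabor_synthesis[OF f V]] gabor_synthesis_summable(2)[OF V]
  by (rule int_decode_sums(2)) (use gabor_synthesis_summable(1)[OF V] in \<open>simp add: norm_mult\<close>)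

lemma zak_synthesis_add:
  assumes "f \<in> L2" "g \<in> L2"
    and "integrable lborel (\<lambda>\<mu>. L2_inner f (gabor \<mu>))" "integrable lborel (\<lambda>\<mu>. L2_inner g (gabor \<mu>))"
  shows "zak_synthesis (\<lambda>x. f x + g x) y \<xi> = zak_synthesis f y \<xi> + zak_synthesis g y \<xi>"
  unfolding zak_synthesis_def L2_inner_add[OF assms(1,2) gabor_L2] distrib_right
  by (intro Bochner_Integration.integral_add zak_synthesis_integrable assms)

lemma zak_synthesis_cmult: "zak_synthesis (\<lambda>x. c * f x) y \<xi> = c * zak_synthesis f y \<xi>"
  unfolding zak_synthesis_def L2_inner_cmult by (simp add: mult.assoc)

section \<open>The quotient by the Zak transform of the Gaussian\<close>

lemma zak_gabor_sharp: "zak_gabor sharp (1/2) (1/2) = \<i> * Theta 0"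
  using zak_gabor_half[of 0 0] by (simp add: sharp_def)

text \<open>The value 0 is prescribed on two lines, a null set that contains the zero of the
  denominator in the unit square; off them both coordinate distances from the centre are positive,
  as needed for a bound by a product of negative powers.\<close>

definition zak_quotient :: "(real \<Rightarrow> complex) \<Rightarrow> real \<times> real \<Rightarrow> complex" where
  "zak_quotient f z = (if fst z = 1/2 \<or> snd z = 1/2 then 0 else
     (zak_synthesis f (fst z) (snd z) - zak_synthesis f (1/2) (1/2) / (\<i> * Theta 0) * zak_gabor sharp (fst z) (snd z))
       / zak_gabor 0 (fst z) (snd z))"

lemma zak_quotient_measurable [measurable]:
  assumes [measurable]: "f \<in> borel_measurable borel"
  shows "zak_quotient f \<in> borel_measurable (borel \<Otimes>\<^sub>M borel)"
  unfolding zak_quotient_def[abs_def] by measurable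

lemma AE_unit_square:
  "AE z in unit_square. fst z \<in> {0..1} \<and> snd z \<in> {0..1} \<and> fst z \<noteq> 1/2 \<and> snd z \<noteq> 1/2"
  unfolding unit_square_def
proof (rule unit_square.AE_pair_measure)
  have "AE x in unit_measure. x \<noteq> 1/2" using AE_lborel_singleton[of "1/2::real"] by (auto simp: AE_unit_measure)
  with AE_unit_measure_mem have a: "AE x in unit_measure. x \<in> {0..1} \<and> x \<noteq> 1/2" by eventually_elim auto
  then show "AE x in unit_measure. AE y in unit_measure. fst (x, y) \<in> {0..1} \<and> snd (x, y) \<in> {0..1} \<and> fst (x, y) \<noteq> 1/2 \<and> snd (x, y) \<noteq> 1/2"
  proof eventually_elim
    case (elim x)
    show ?case using a by eventually_elim (use elim in auto)
  qed
qed measurable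

text \<open>The numerator of the quotient vanishes at \<open>(1/2, 1/2)\<close> and is Hoelder continuous there, while the
  denominator vanishes to first order only.\<close>

lemma zak_quotient_bound:
  assumes d: "\<delta> > 2"
  obtains C where "C \<ge> 0"
    and "\<And>f. f \<in> H_delta \<delta> \<Longrightarrow> cmod (zak_synthesis f (1/2) (1/2) / (\<i> * Theta 0)) \<le> C * H_norm \<delta> f"
    and "\<And>f. f \<in> H_delta \<delta> \<Longrightarrow> sq_integrable unit_square (zak_quotient f)"
    and "\<And>f. f \<in> H_delta \<delta> \<Longrightarrow> (LINT z|unit_square. (cmod (zak_quotient f z))\<^sup>2) \<le> (C * H_norm \<delta> f)\<^sup>2"
proof -
  let ?\<alpha> = "Hoelder_exp \<delta>"
  note \<alpha> = Hoelder_exp[OF d]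
  obtain K where K: "K \<ge> 0"
    "\<And>f. f \<in> H_delta \<delta> \<Longrightarrow> integrable lborel (\<lambda>\<mu>. cmod (L2_inner f (gabor \<mu>)) * (1 + norm \<mu>) powr ?\<alpha>)"
    "\<And>f. f \<in> H_delta \<delta> \<Longrightarrow> (LINT \<mu>|lborel. cmod (L2_inner f (gabor \<mu>)) * (1 + norm \<mu>) powr ?\<alpha>) \<le> K * H_norm \<delta> f"
    by (rule H_delta_weighted_integrable[OF d], rule that)
  define L where "L = 2 * exp 1 * lattice_const"
  define M where "M = (8 * pi * exp 1 + 4 * pi * exp 2 + 4 * exp 1) * lattice_const"
  define T where "T = cmod (Theta 0)"
  have LM: "L > 0" "M > 0" "T > 0" using lattice_const_pos Theta_0_nz by (auto simp: L_def M_def T_def intro!: mult_pos_pos add_pos_pos)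
  define S where "S = L * K / T"
  have S: "S \<ge> 0" using LM K by (simp add: S_def)
  define B where "B = M * K + S * (M * (1 + norm sharp) powr ?\<alpha>)"
  have B: "B \<ge> 0" using LM K S by (simp add: B_def)
  define c where "c = (2/5) * exp (- 2 * pi)"
  have c: "c > 0" by (simp add: c_def)
  \<comment> \<open>Splits \<open>r powr (?\<alpha> - 1)\<close> evenly over the two coordinates.
    The square of each factor has exponent - 2 g = \<alpha> - 1, greater than -1 and therefore
    integrable on the interval.\<close>
  define g where "g = (1 - ?\<alpha>) / 2"
  have g: "0 \<le> g" "g \<le> 1" "0 \<le> 2 * g" "2 * g < 1" using \<alpha> by (auto simp: g_def)
  define I where "I = (LINT x|unit_measure. \<bar>x - 1/2\<bar> powr (- (2 * g)))"
  have Ii: "integrable unit_measure (\<lambda>x. \<bar>x - 1/2\<bar> powr (- (2 * g)))" using g by (intro integrable_unit_measure_abs_powr)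
  have I0: "I \<ge> 0" unfolding I_def by simp
  define C where "C = max S (B / c * I)"
  have C: "C \<ge> 0" "S \<le> C" "B / c * I \<le> C" using S by (auto simp: C_def)
  have sharp: "cmod (zak_synthesis f (1/2) (1/2) / (\<i> * Theta 0)) \<le> S * H_norm \<delta> f" if f: "f \<in> H_delta \<delta>" for f
  proof -
    note V = H_delta_gabor_integrable[OF d f]
    have "cmod (zak_synthesis f (1/2) (1/2)) \<le> (LINT \<mu>|lborel. cmod (L2_inner f (gabor \<mu>) * zak_gabor \<mu> (1/2) (1/2)))"
      unfolding zak_synthesis_def by (rule integral_norm_bound)
    also have "\<dots> \<le> (LINT \<mu>|lborel. L * (cmod (L2_inner f (gabor \<mu>)) * (1 + norm \<mu>) powr ?\<alpha>))"
    proof (rule integral_mono)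
      fix \<mu>
      have "cmod (zak_gabor \<mu> (1/2) (1/2)) \<le> L" unfolding L_def by (rule cmod_zak_gabor_le)
      also have "\<dots> \<le> L * (1 + norm \<mu>) powr ?\<alpha>"
        using one_le_one_plus_norm_powr[of ?\<alpha> \<mu>] \<alpha> LM by simp
      finally have "cmod (L2_inner f (gabor \<mu>)) * cmod (zak_gabor \<mu> (1/2) (1/2)) \<le> cmod (L2_inner f (gabor \<mu>)) * (L * (1 + norm \<mu>) powr ?\<alpha>)"
        by (intro mult_left_mono) auto
      then show "cmod (L2_inner f (gabor \<mu>) * zak_gabor \<mu> (1/2) (1/2)) \<le> L * (cmod (L2_inner f (gabor \<mu>)) * (1 + norm \<mu>) powr ?\<alpha>)"
        by (simp add: norm_mult mult_ac)
    qed (use zak_synthesis_integrable[OF V] K(2)[OF f] in auto)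
    also have "\<dots> \<le> L * (K * H_norm \<delta> f)" using K(3)[OF f] LM by simp
    finally show ?thesis using LM by (simp add: norm_mult norm_divide S_def T_def[symmetric] divide_right_mono mult.assoc)
  qed
  have bound: "cmod (zak_quotient f z) \<le> B / c * H_norm \<delta> f * (\<bar>fst z - 1/2\<bar> powr (- g) * \<bar>snd z - 1/2\<bar> powr (- g))"
    if f: "f \<in> H_delta \<delta>" and z: "fst z \<in> {0..1}" "snd z \<in> {0..1}" "fst z \<noteq> 1/2" "snd z \<noteq> 1/2" for f z
  proof -
    define y \<xi> where "y = fst z" and "\<xi> = snd z"
    define r where "r = norm (y - 1/2, \<xi> - 1/2)"
    define s where "s = zak_synthesis f (1/2) (1/2) / (\<i> * Theta 0)"
    note V = H_delta_gabor_integrable[OF d f]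
    have yx: "y \<in> {0..1}" "\<xi> \<in> {0..1}" using z by (auto simp: y_def \<xi>_def)
    have r: "r > 0" using z by (simp add: r_def y_def zero_prod_def)
    have s0: "zak_synthesis f (1/2) (1/2) = s * zak_gabor sharp (1/2) (1/2)"
      using Theta_0_nz by (simp add: s_def zak_gabor_sharp)
    have Hoe: "cmod (zak_gabor \<mu> y \<xi> - zak_gabor \<mu> (1/2) (1/2)) \<le> M * ((1 + norm \<mu>) powr ?\<alpha> * r powr ?\<alpha>)" for \<mu>
      unfolding M_def r_def using \<alpha> yx by (intro zak_gabor_Hoelder) auto
    have "cmod (zak_synthesis f y \<xi> - zak_synthesis f (1/2) (1/2))
       = cmod (LINT \<mu>|lborel. L2_inner f (gabor \<mu>) * (zak_gabor \<mu> y \<xi> - zak_gabor \<mu> (1/2) (1/2)))"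
      unfolding zak_synthesis_def right_diff_distrib
      by (subst Bochner_Integration.integral_diff) (auto intro: zak_synthesis_integrable[OF V])
    also have "\<dots> \<le> (LINT \<mu>|lborel. cmod (L2_inner f (gabor \<mu>) * (zak_gabor \<mu> y \<xi> - zak_gabor \<mu> (1/2) (1/2))))"
      by (rule integral_norm_bound)
    also have "\<dots> \<le> (LINT \<mu>|lborel. (M * r powr ?\<alpha>) * (cmod (L2_inner f (gabor \<mu>)) * (1 + norm \<mu>) powr ?\<alpha>))"
    proof (rule integral_mono)
      show "integrable lborel (\<lambda>\<mu>. cmod (L2_inner f (gabor \<mu>) * (zak_gabor \<mu> y \<xi> - zak_gabor \<mu> (1/2) (1/2))))"
        unfolding right_diff_distrib by (intro integrable_norm Bochner_Integration.integrable_diff zak_synthesis_integrable V)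
      fix \<mu>
      show "cmod (L2_inner f (gabor \<mu>) * (zak_gabor \<mu> y \<xi> - zak_gabor \<mu> (1/2) (1/2)))
         \<le> (M * r powr ?\<alpha>) * (cmod (L2_inner f (gabor \<mu>)) * (1 + norm \<mu>) powr ?\<alpha>)"
        using mult_left_mono[OF Hoe[of \<mu>], of "cmod (L2_inner f (gabor \<mu>))"] by (simp add: norm_mult mult_ac)
    qed (use K(2)[OF f] in simp)
    also have "\<dots> = (M * r powr ?\<alpha>) * (LINT \<mu>|lborel. cmod (L2_inner f (gabor \<mu>)) * (1 + norm \<mu>) powr ?\<alpha>)"
      by (rule integral_mult_right_zero)
    also have "\<dots> \<le> (M * r powr ?\<alpha>) * (K * H_norm \<delta> f)"
      using K(3)[OF f] LM by (intro mult_left_mono) auto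
    finally have 1: "cmod (zak_synthesis f y \<xi> - zak_synthesis f (1/2) (1/2)) \<le> (M * r powr ?\<alpha>) * (K * H_norm \<delta> f)" .
    have 2: "cmod (s * (zak_gabor sharp y \<xi> - zak_gabor sharp (1/2) (1/2))) \<le> (S * H_norm \<delta> f) * (M * ((1 + norm sharp) powr ?\<alpha> * r powr ?\<alpha>))"
      unfolding norm_mult using sharp[OF f] S H_norm_nonneg[of \<delta> f] by (intro mult_mono Hoe) (auto simp: s_def)
    have "cmod (zak_synthesis f y \<xi> - s * zak_gabor sharp y \<xi>)
       = cmod ((zak_synthesis f y \<xi> - zak_synthesis f (1/2) (1/2)) - s * (zak_gabor sharp y \<xi> - zak_gabor sharp (1/2) (1/2)))"
      using s0 by (simp add: algebra_simps)
    also have "\<dots> \<le> (M * r powr ?\<alpha>) * (K * H_norm \<delta> f) + (S * H_norm \<delta> f) * (M * ((1 + norm sharp) powr ?\<alpha> * r powr ?\<alpha>))"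
      by (rule order_trans[OF norm_triangle_ineq4 add_mono[OF 1 2]])
    also have "\<dots> = B * H_norm \<delta> f * r powr ?\<alpha>" by (simp add: B_def algebra_simps)
    finally have num: "cmod (zak_synthesis f y \<xi> - s * zak_gabor sharp y \<xi>) \<le> B * H_norm \<delta> f * r powr ?\<alpha>" .
    have den: "c * r \<le> cmod (zak_gabor 0 y \<xi>)" unfolding c_def r_def by (rule zak_gabor_zero_ge[OF yx])
    have "cmod (zak_quotient f z) = cmod (zak_synthesis f y \<xi> - s * zak_gabor sharp y \<xi>) / cmod (zak_gabor 0 y \<xi>)"
      using z by (simp add: zak_quotient_def y_def \<xi>_def s_def norm_divide)
    also have "\<dots> \<le> (B * H_norm \<delta> f * r powr ?\<alpha>) / (c * r)"
      using num den c r B H_norm_nonneg[of \<delta> f] by (intro frac_le) auto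
    also have "\<dots> = B / c * H_norm \<delta> f * (r powr ?\<alpha> / r powr 1)" using r by simp
    also have "\<dots> \<le> B / c * H_norm \<delta> f * (\<bar>y - 1/2\<bar> powr (- g) * \<bar>\<xi> - 1/2\<bar> powr (- g))"
    proof (rule mult_left_mono)
      have "?\<alpha> - 1 = - g + - g" by (simp add: g_def field_simps)
      then have "r powr ?\<alpha> / r powr 1 = r powr (- g) * r powr (- g)"
        by (simp only: powr_diff[symmetric] powr_add[symmetric])
      also have "\<dots> \<le> \<bar>y - 1/2\<bar> powr (- g) * \<bar>\<xi> - 1/2\<bar> powr (- g)"
        using g z norm_fst_le[of "y - 1/2" "\<xi> - 1/2"] norm_snd_le[of "\<xi> - 1/2" "y - 1/2"]
        by (intro mult_mono powr_mono2') (auto simp: r_def y_def \<xi>_def)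
      finally show "r powr ?\<alpha> / r powr 1 \<le> \<bar>y - 1/2\<bar> powr (- g) * \<bar>\<xi> - 1/2\<bar> powr (- g)" .
    qed (use B c H_norm_nonneg[of \<delta> f] in simp)
    finally show ?thesis by (simp only: y_def \<xi>_def)
  qed
  have sq: "sq_integrable unit_square (zak_quotient f) \<and>
      (LINT z|unit_square. (cmod (zak_quotient f z))\<^sup>2) \<le> (C * H_norm \<delta> f)\<^sup>2" if f: "f \<in> H_delta \<delta>" for f
  proof -
    have [measurable]: "f \<in> borel_measurable borel" using f by (auto simp: H_delta_iff intro: L2_measurable)
    define w where "w = (\<lambda>z::real \<times> real. (B / c * H_norm \<delta> f)\<^sup>2 * (\<bar>fst z - 1/2\<bar> powr (- (2 * g)) * \<bar>snd z - 1/2\<bar> powr (- (2 * g))))"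
    have wi: "integrable unit_square w"
      unfolding w_def by (intro integrable_mult_right integral_unit_square_mult(1)[OF Ii Ii])
    have wI: "(LINT z|unit_square. w z) = (B / c * H_norm \<delta> f)\<^sup>2 * (I * I)"
      unfolding w_def integral_mult_right_zero integral_unit_square_mult(2)[OF Ii Ii] I_def ..
    have b: "AE z in unit_square. (cmod (zak_quotient f z))\<^sup>2 \<le> w z"
      using AE_unit_square
    proof eventually_elim
      case (elim z)
      have e: "(x powr (- g))\<^sup>2 = x powr (- (2 * g))" for x :: real
        by (simp add: power2_eq_square powr_add[symmetric])
      have "(cmod (zak_quotient f z))\<^sup>2 \<le> (B / c * H_norm \<delta> f * (\<bar>fst z - 1/2\<bar> powr (- g) * \<bar>snd z - 1/2\<bar> powr (- g)))\<^sup>2"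
        using bound[OF f, of z] elim by (intro power_mono) auto
      also have "\<dots> = w z" unfolding w_def power_mult_distrib e ..
      finally show ?case .
    qed
    have i: "integrable unit_square (\<lambda>z. (cmod (zak_quotient f z))\<^sup>2)"
    proof (rule Bochner_Integration.integrable_bound[OF wi])
      show "AE z in unit_square. norm ((cmod (zak_quotient f z))\<^sup>2) \<le> norm (w z)"
        using b by eventually_elim auto
    qed measurable
    have "(LINT z|unit_square. (cmod (zak_quotient f z))\<^sup>2) \<le> (LINT z|unit_square. w z)"
      by (rule integral_mono_AE[OF i wi b])
    also have "\<dots> = (B / c * I * H_norm \<delta> f)\<^sup>2" unfolding wI by (simp add: power2_eq_square)
    also have "\<dots> \<le> (C * H_norm \<delta> f)\<^sup>2"
      using C H_norm_nonneg[of \<delta> f] B c I0 by (intro power_mono mult_right_mono mult_nonneg_nonneg) auto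
    finally show ?thesis using i by (simp add: sq_integrable_def)
  qed
  show ?thesis
  proof (rule that[of C])
    fix f assume f: "f \<in> H_delta \<delta>"
    show "cmod (zak_synthesis f (1/2) (1/2) / (\<i> * Theta 0)) \<le> C * H_norm \<delta> f"
      using sharp[OF f] mult_right_mono[OF C(2) H_norm_nonneg[of \<delta> f]] by linarith
  qed (use C sq in auto)
qed

section \<open>The functionals and the convergence of the series\<close>

lemma sharp_notin_Lambda: "sharp \<notin> Lambda"
proof
  assume "sharp \<in> Lambda"
  then obtain m :: int where "1/2 = real_of_int m" by (auto simp: Lambda_def sharp_def)
  then have "real_of_int (2 * m) = real_of_int 1" by simp
  then have "2 * m = 1" by (simp only: of_int_eq_iff)
  then show False by presburger
qed

definition lattice_index :: "real \<times> real \<Rightarrow> int \<times> int" where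
  "lattice_index l = (\<lfloor>fst l\<rfloor>, \<lfloor>snd l\<rfloor>)"

lemma lattice_index_inverse:
  "l \<in> Lambda \<Longrightarrow> (of_int (fst (lattice_index l)), of_int (snd (lattice_index l))) = l"
  by (auto simp: Lambda_def lattice_index_def)

lemma inj_on_lattice_index: "inj_on lattice_index Lambda"
  by (rule inj_onI) (metis lattice_index_inverse)

definition gabor_functional :: "real \<times> real \<Rightarrow> (real \<Rightarrow> complex) \<Rightarrow> complex" where
  "gabor_functional l f =
     (if l = sharp then sharp_poisson f else torus.coef (zak_quotient f) (lattice_index l))"

lemma sharp_poisson_eq_zak_synthesis:
  assumes "\<delta> > 2" "f \<in> H_delta \<delta>"
  shows "sharp_poisson f = zak_synthesis f (1/2) (1/2) / (\<i> * Theta 0)"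
  unfolding sharp_poisson_def
  using assms by (subst zak_eq_zak_synthesis) (auto intro: H_delta_gabor_integrable simp: H_delta_iff)

lemma zak_quotient_add:
  assumes d: "\<delta> > 2" and f: "f \<in> H_delta \<delta>" and g: "g \<in> H_delta \<delta>"
  shows "zak_quotient (\<lambda>x. f x + g x) z = zak_quotient f z + zak_quotient g z"
proof -
  have "zak_synthesis (\<lambda>x. f x + g x) y \<xi> = zak_synthesis f y \<xi> + zak_synthesis g y \<xi>" for y \<xi>
    using f g by (intro zak_synthesis_add H_delta_gabor_integrable[OF d]) (auto simp: H_delta_iff)
  then show ?thesis
    by (simp add: zak_quotient_def add_divide_distrib diff_divide_distrib distrib_right)
qed

lemma zak_quotient_cmult: "zak_quotient (\<lambda>x. c * f x) z = c * zak_quotient f z"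
  by (simp add: zak_quotient_def zak_synthesis_cmult right_diff_distrib mult.assoc)

lemma H_spaceE:
  assumes "f \<in> H_space a" "b \<le> a"
  obtains d where "d > b" "f \<in> H_delta d"
proof -
  obtain d where "d > a" "f \<in> H_delta d" using assms(1) by (auto simp: H_space_def)
  then show ?thesis using assms(2) by (intro that[of d]) linarith
qed

lemma gabor_functional_linear:
  assumes a: "a \<ge> 2" and l: "l \<in> Lambda"
  shows "linear_functional_on (H_space a) (gabor_functional l)"
  unfolding linear_functional_on_def
proof (intro conjI ballI allI)
  have l': "l \<noteq> sharp" using l sharp_notin_Lambda by auto
  have sq: "integrable unit_square (\<lambda>z. zak_quotient f z * cnj (torus_char i z))"
    if d: "\<delta> > 2" and f: "f \<in> H_delta \<delta>" for \<delta> f i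
  proof -
    obtain C where "sq_integrable unit_square (zak_quotient f)"
      using zak_quotient_bound[OF d] f by metis
    then show ?thesis by (intro sq_integrable_mult_cnj torus.sq_integrable_phi)
  qed
  fix f assume f: "f \<in> H_space a"
  then obtain d where d: "d > 2" "f \<in> H_delta d" using a by (rule H_spaceE)
  show "gabor_functional l (\<lambda>x. c * f x) = c * gabor_functional l f" for c
    using l' by (simp add: gabor_functional_def torus.coef_def zak_quotient_cmult mult.assoc)
  fix g assume "g \<in> H_space a"
  then obtain e where e: "e > 2" "g \<in> H_delta e" using a by (rule H_spaceE)
  \<comment> \<open>The spaces shrink as the exponent grows, so the smaller exponent accommodates
    both functions, and it still exceeds 2.\<close>
  define m where "m = min d e"
  have m: "m > 2" "f \<in> H_delta m" "g \<in> H_delta m"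
    using d e by (auto simp: m_def intro: H_delta_mono)
  show "gabor_functional l (\<lambda>x. f x + g x) = gabor_functional l f + gabor_functional l g"
    using l' sq[OF m(1,2)] sq[OF m(1,3)]
    by (simp add: gabor_functional_def torus.coef_def zak_quotient_add[OF m] distrib_right)
qed

text \<open>Bessel's inequality for the quotient bounds the lattice coefficients, and the sharp
  coefficient is bounded separately; \<open>sqrt 2\<close> accounts for the two equal contributions.
  Finite partial sums suffice for both continuity and summability.\<close>

lemma gabor_functional_bound:
  assumes d: "\<delta> > 2"
  obtains C where "C \<ge> 0"
    and "\<And>f F. f \<in> H_delta \<delta> \<Longrightarrow> finite F \<Longrightarrow> F \<subseteq> Lambda_sharp \<Longrightarrow>
      (\<Sum>l\<in>F. (cmod (gabor_functional l f))\<^sup>2) \<le> (C * H_norm \<delta> f)\<^sup>2"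
proof -
  obtain C where C: "C \<ge> 0"
    "\<And>f. f \<in> H_delta \<delta> \<Longrightarrow> cmod (zak_synthesis f (1/2) (1/2) / (\<i> * Theta 0)) \<le> C * H_norm \<delta> f"
    "\<And>f. f \<in> H_delta \<delta> \<Longrightarrow> sq_integrable unit_square (zak_quotient f)"
    "\<And>f. f \<in> H_delta \<delta> \<Longrightarrow> (LINT z|unit_square. (cmod (zak_quotient f z))\<^sup>2) \<le> (C * H_norm \<delta> f)\<^sup>2"
    by (rule zak_quotient_bound[OF d], rule that)
  show ?thesis
  proof (rule that[of "sqrt 2 * C"])
    fix f F assume f: "f \<in> H_delta \<delta>" and F: "finite F" "F \<subseteq> Lambda_sharp"
    let ?g = "\<lambda>l. (cmod (gabor_functional l f))\<^sup>2"
    have sub: "F - {sharp} \<subseteq> Lambda" using F by (auto simp: Lambda_sharp_def)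
    have "(\<Sum>l\<in>F. ?g l) \<le> (\<Sum>l\<in>insert sharp (F - {sharp}). ?g l)"
      using F by (intro sum_mono2) auto
    also have "\<dots> = ?g sharp + (\<Sum>l\<in>F - {sharp}. ?g l)"
      using F by (subst sum.insert) auto
    also have "(\<Sum>l\<in>F - {sharp}. ?g l) = (\<Sum>l\<in>F - {sharp}. (cmod (torus.coef (zak_quotient f) (lattice_index l)))\<^sup>2)"
      by (intro sum.cong) (auto simp: gabor_functional_def)
    also have "\<dots> = (\<Sum>i\<in>lattice_index ` (F - {sharp}). (cmod (torus.coef (zak_quotient f) i))\<^sup>2)"
      by (subst sum.reindex) (auto intro: inj_on_subset[OF inj_on_lattice_index sub])
    also have "\<dots> \<le> (LINT z|unit_square. (cmod (zak_quotient f z))\<^sup>2)"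
      using F by (intro torus.Bessel C f) auto
    also have "\<dots> \<le> (C * H_norm \<delta> f)\<^sup>2" by (rule C(4)[OF f])
    also have "?g sharp \<le> (C * H_norm \<delta> f)\<^sup>2"
      using C(2)[OF f] by (intro power_mono) (auto simp: gabor_functional_def sharp_poisson_eq_zak_synthesis[OF d f])
    finally show "(\<Sum>l\<in>F. ?g l) \<le> (sqrt 2 * C * H_norm \<delta> f)\<^sup>2" by (simp add: power_mult_distrib)
  qed (use C in simp)
qed

lemma gabor_functional_continuous:
  assumes a: "a \<ge> 2" and l: "l \<in> Lambda"
  shows "continuous_functional a (gabor_functional l)"
  unfolding continuous_functional_def
proof (intro conjI allI impI)
  show lin: "linear_functional_on (H_space a) (gabor_functional l)" by (rule gabor_functional_linear[OF a l])
  fix \<delta> :: real assume da: "a < \<delta>"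
  then have d: "\<delta> > 2" using a by simp
  obtain C where C: "C \<ge> 0" "\<And>f F. f \<in> H_delta \<delta> \<Longrightarrow> finite F \<Longrightarrow> F \<subseteq> Lambda_sharp \<Longrightarrow>
      (\<Sum>l\<in>F. (cmod (gabor_functional l f))\<^sup>2) \<le> (C * H_norm \<delta> f)\<^sup>2"
    by (rule gabor_functional_bound[OF d], rule that)
  have b: "cmod (gabor_functional l f) \<le> C * H_norm \<delta> f" if f: "f \<in> H_delta \<delta>" for f
  proof (rule power2_le_imp_le)
    show "(cmod (gabor_functional l f))\<^sup>2 \<le> (C * H_norm \<delta> f)\<^sup>2"
      using C(2)[OF f, of "{l}"] l by (simp add: Lambda_sharp_def)
  qed (use C(1) H_norm_nonneg in simp)
  have sub: "f \<in> H_space a" if "f \<in> H_delta \<delta>" for f using that da by (auto simp: H_space_def)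
  show "continuous_on_H_delta \<delta> (gabor_functional l)"
    unfolding continuous_on_H_delta_def
  proof (intro ballI allI impI)
    fix f and \<epsilon> :: real assume f: "f \<in> H_delta \<delta>" and \<epsilon>: "\<epsilon> > 0"
    have "cmod (gabor_functional l g - gabor_functional l f) < \<epsilon>"
      \<comment> \<open>The radius has \<open>C + 1\<close> in the denominator because
        \<open>C\<close> may be 0.\<close>
      if g: "g \<in> H_delta \<delta>" and n: "H_norm \<delta> (\<lambda>x. g x - f x) < \<epsilon> / (C + 1)" for g
    proof -
      have h: "(\<lambda>x. g x - f x) \<in> H_delta \<delta>" by (rule H_delta_diff[OF g f])
      have "gabor_functional l (\<lambda>x. (g x - f x) + f x) = gabor_functional l (\<lambda>x. g x - f x) + gabor_functional l f"
        using lin unfolding linear_functional_on_def by (elim conjE) (rule bspec[OF bspec[OF _ sub[OF h]] sub[OF f]])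
      then have "gabor_functional l g - gabor_functional l f = gabor_functional l (\<lambda>x. g x - f x)" by simp
      also have "cmod \<dots> \<le> (C + 1) * H_norm \<delta> (\<lambda>x. g x - f x)"
        using b[OF h] H_norm_nonneg[of \<delta> "\<lambda>x. g x - f x"] by (simp add: distrib_right)
      also have "\<dots> < \<epsilon>" using n C(1) by (simp add: pos_less_divide_eq mult.commute)
      finally show ?thesis .
    qed
    then show "\<exists>\<eta>>0. \<forall>g\<in>H_delta \<delta>. H_norm \<delta> (\<lambda>x. g x - f x) < \<eta> \<longrightarrow>
        cmod (gabor_functional l g - gabor_functional l f) < \<epsilon>"
      using \<epsilon> C(1) by (intro exI[of _ "\<epsilon> / (C + 1)"]) auto
  qed
qed

lemma gabor_zak_sums:
  shows "summable (\<lambda>n. cmod (fourier_char (int_decode n) \<xi> * gabor \<mu> (y + of_int (int_decode n))))"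
    and "zak_gabor \<mu> y \<xi> = (\<Sum>n. fourier_char (int_decode n) \<xi> * gabor \<mu> (y + of_int (int_decode n)))"
  unfolding zak_gabor_def by (rule int_decode_sums lattice_summable(1)[OF zak_gabor_term_le])+

text \<open>The Zak transform of the remainder of the series is the Zak transform of the Gaussian times the
  remainder of the Fourier series of the quotient.\<close>

lemma gabor_remainder_le:
  assumes d: "\<delta> > 2" and f: "f \<in> H_delta \<delta>" and F: "finite F" "F \<subseteq> Lambda"
  shows "(\<integral>\<^sup>+x. ennreal ((cmod (f x - (\<Sum>l\<in>insert sharp F. gabor_functional l f * gabor l x)))\<^sup>2) \<partial>lborel)
    \<le> ennreal ((2 * exp 1 * lattice_const)\<^sup>2 * (LINT z|unit_square. (cmod (zak_quotient f z
        - (\<Sum>i\<in>lattice_index ` F. torus.coef (zak_quotient f) i * torus_char i z)))\<^sup>2))"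
proof -
  have L2: "f \<in> L2" using f by (simp add: H_delta_iff)
  have [measurable]: "f \<in> borel_measurable borel" using L2 by (rule L2_measurable)
  have V: "integrable lborel (\<lambda>\<mu>. L2_inner f (gabor \<mu>))" by (rule H_delta_gabor_integrable[OF d f])
  define u where "u = zak_quotient f"
  have u: "sq_integrable unit_square u"
    unfolding u_def by (rule zak_quotient_bound[OF d]) (use f in blast)
  define G where "G = gabor_synthesis f"
  define c where "c = (\<lambda>l. gabor_functional l f)"
  define A where "A = insert sharp F"
  have A: "finite A" using F by (simp add: A_def)
  define L where "L = 2 * exp 1 * lattice_const"
  have L: "L \<ge> 0" using lattice_const_pos by (simp add: L_def)
  define h where "h = (\<lambda>x. G x - (\<Sum>l\<in>A. c l * gabor l x))"
  define R where "R = (\<lambda>z. u z - (\<Sum>i\<in>lattice_index ` F. torus.coef u i * torus_char i z))"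
  have cG: "continuous_on UNIV G" and aeG: "AE x in lborel. G x = f x"
    using cont_rep_gabor_synthesis[OF L2 V] by (auto simp: continuous_rep_def G_def)
  have [measurable]: "G \<in> borel_measurable borel" using cG by (rule borel_measurable_continuous_onI)
  have hm: "h \<in> borel_measurable borel" unfolding h_def by measurable
  have sG: "summable (\<lambda>n. cmod (G (y + of_int (int_decode n))))" for y
    unfolding G_def by (rule int_decode_sums(1)[OF gabor_synthesis_summable(1)[OF V]])
  have sg: "summable (\<lambda>n. cmod (gabor l (y + of_int (int_decode n))))" for l y
    using gabor_zak_sums(1)[of 0 l y] by (simp add: norm_mult)
  have sh: "summable (\<lambda>n. cmod (h (y + of_int (int_decode n))))" for y
  proof (rule summable_comparison_test'[of _ 0])
    show "summable (\<lambda>n. cmod (G (y + of_int (int_decode n))) + (\<Sum>l\<in>A. cmod (c l) * cmod (gabor l (y + of_int (int_decode n)))))"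
      by (intro summable_add sG summable_sum summable_mult sg)
    show "norm (cmod (h (y + of_int (int_decode n)))) \<le>
        cmod (G (y + of_int (int_decode n))) + (\<Sum>l\<in>A. cmod (c l) * cmod (gabor l (y + of_int (int_decode n))))" for n
      unfolding h_def real_norm_def abs_norm_cancel norm_mult[symmetric]
      by (rule order_trans[OF norm_triangle_ineq4 add_left_mono[OF norm_sum]])
  qed
  have zh: "(\<Sum>n. fourier_char (int_decode n) \<xi> * h (y + of_int (int_decode n)))
      = zak_synthesis f y \<xi> - (\<Sum>l\<in>A. c l * zak_gabor l y \<xi>)" for y \<xi>
  proof -
    have s1: "summable (\<lambda>n. fourier_char (int_decode n) \<xi> * G (y + of_int (int_decode n)))"
      by (rule summable_norm_cancel) (use sG[of y] in \<open>simp add: norm_mult\<close>)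
    have s2: "summable (\<lambda>n. c l * (fourier_char (int_decode n) \<xi> * gabor l (y + of_int (int_decode n))))" for l
      by (rule summable_mult, rule summable_norm_cancel, rule gabor_zak_sums(1))
    have "(\<Sum>n. fourier_char (int_decode n) \<xi> * h (y + of_int (int_decode n)))
      = (\<Sum>n. fourier_char (int_decode n) \<xi> * G (y + of_int (int_decode n))
          - (\<Sum>l\<in>A. c l * (fourier_char (int_decode n) \<xi> * gabor l (y + of_int (int_decode n)))))"
      unfolding h_def right_diff_distrib sum_distrib_left by (simp only: mult.left_commute)
    also have "\<dots> = (\<Sum>n. fourier_char (int_decode n) \<xi> * G (y + of_int (int_decode n)))
        - (\<Sum>n. \<Sum>l\<in>A. c l * (fourier_char (int_decode n) \<xi> * gabor l (y + of_int (int_decode n))))"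
      by (rule suminf_diff[OF s1 summable_sum[OF s2], symmetric])
    also have "(\<Sum>n. \<Sum>l\<in>A. c l * (fourier_char (int_decode n) \<xi> * gabor l (y + of_int (int_decode n))))
        = (\<Sum>l\<in>A. \<Sum>n. c l * (fourier_char (int_decode n) \<xi> * gabor l (y + of_int (int_decode n))))"
      by (rule suminf_sum[OF s2])
    also have "\<dots> = (\<Sum>l\<in>A. c l * zak_gabor l y \<xi>)"
      by (intro sum.cong refl) (simp only: gabor_zak_sums(2) suminf_mult[OF summable_norm_cancel[OF gabor_zak_sums(1)]])
    finally show ?thesis unfolding G_def gabor_synthesis_summable(2)[OF V, symmetric] .
  qed
  have key: "AE z in unit_square. zak_synthesis f (fst z) (snd z) - (\<Sum>l\<in>A. c l * zak_gabor l (fst z) (snd z))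
      = zak_gabor 0 (fst z) (snd z) * R z"
    using AE_unit_square
  proof eventually_elim
    case (elim z)
    define y \<xi> where "y = fst z" and "\<xi> = snd z"
    have yx: "y \<in> {0..1}" "\<xi> \<in> {0..1}" using elim by (auto simp: y_def \<xi>_def)
    have "norm (y - 1/2, \<xi> - 1/2) > 0" using elim by (simp add: y_def zero_prod_def)
    then have "0 < (2/5) * exp (- 2 * pi) * norm (y - 1/2, \<xi> - 1/2)" by simp
    also have "\<dots> \<le> cmod (zak_gabor 0 y \<xi>)" by (rule zak_gabor_zero_ge[OF yx])
    finally have E0: "zak_gabor 0 y \<xi> \<noteq> 0" by auto
    have cs: "c sharp = zak_synthesis f (1/2) (1/2) / (\<i> * Theta 0)"
      by (simp add: c_def gabor_functional_def sharp_poisson_eq_zak_synthesis[OF d f])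
    have "u z = (zak_synthesis f y \<xi> - c sharp * zak_gabor sharp y \<xi>) / zak_gabor 0 y \<xi>"
      using elim unfolding u_def zak_quotient_def cs by (simp add: y_def \<xi>_def)
    then have 1: "zak_synthesis f y \<xi> - c sharp * zak_gabor sharp y \<xi> = zak_gabor 0 y \<xi> * u z"
      using E0 by simp
    have "(\<Sum>l\<in>F. c l * zak_gabor l y \<xi>) = (\<Sum>l\<in>F. zak_gabor 0 y \<xi> * (torus.coef u (lattice_index l) * torus_char (lattice_index l) z))"
    proof (intro sum.cong refl)
      fix l assume l: "l \<in> F"
      then have "l \<in> Lambda" "l \<noteq> sharp" using F sharp_notin_Lambda by auto
      have "zak_gabor l y \<xi> = torus_char (lattice_index l) z * zak_gabor 0 y \<xi>"
        using zak_gabor_lattice[of "fst (lattice_index l)" "snd (lattice_index l)" y \<xi>]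
        unfolding lattice_index_inverse[OF \<open>l \<in> Lambda\<close>] by (simp add: y_def \<xi>_def)
      then show "c l * zak_gabor l y \<xi> = zak_gabor 0 y \<xi> * (torus.coef u (lattice_index l) * torus_char (lattice_index l) z)"
        using \<open>l \<noteq> sharp\<close> by (simp add: c_def gabor_functional_def u_def)
    qed
    also have "\<dots> = zak_gabor 0 y \<xi> * (\<Sum>i\<in>lattice_index ` F. torus.coef u i * torus_char i z)"
      by (subst sum.reindex) (auto simp: sum_distrib_left intro: inj_on_subset[OF inj_on_lattice_index F(2)])
    finally have 2: "(\<Sum>l\<in>F. c l * zak_gabor l y \<xi>) = zak_gabor 0 y \<xi> * (\<Sum>i\<in>lattice_index ` F. torus.coef u i * torus_char i z)" .
    have "sharp \<notin> F" using F sharp_notin_Lambda by auto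
    then have "zak_synthesis f y \<xi> - (\<Sum>l\<in>A. c l * zak_gabor l y \<xi>)
       = (zak_synthesis f y \<xi> - c sharp * zak_gabor sharp y \<xi>) - (\<Sum>l\<in>F. c l * zak_gabor l y \<xi>)"
      using F(1) by (simp add: A_def)
    also have "\<dots> = zak_gabor 0 y \<xi> * R z" unfolding 1 2 R_def by (simp add: right_diff_distrib)
    finally show ?case by (simp add: y_def \<xi>_def)
  qed
  have R: "sq_integrable unit_square R"
    unfolding R_def by (intro sq_integrable_diff u torus.sq_integrable_phi_sum)
  \<comment> \<open>The given \<open>f\<close> is only an almost-everywhere representative; the
    isometry needs absolutely summable translates at every \<open>y\<close>, which the continuous
    representative \<open>G\<close> provides.\<close>
  have "(\<integral>\<^sup>+x. ennreal ((cmod (f x - (\<Sum>l\<in>A. c l * gabor l x)))\<^sup>2) \<partial>lborel) = (\<integral>\<^sup>+x. ennreal ((cmod (h x))\<^sup>2) \<partial>lborel)"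
    by (rule nn_integral_cong_AE) (use aeG in \<open>eventually_elim, simp add: h_def\<close>)
  also have "\<dots> = (\<integral>\<^sup>+z. ennreal ((cmod (zak_synthesis f (fst z) (snd z) - (\<Sum>l\<in>A. c l * zak_gabor l (fst z) (snd z))))\<^sup>2) \<partial>unit_square)"
    unfolding zak_isometry[OF hm sh] zh ..
  also have "\<dots> \<le> (\<integral>\<^sup>+z. ennreal (L\<^sup>2 * (cmod (R z))\<^sup>2) \<partial>unit_square)"
  proof (rule nn_integral_mono_AE)
    show "AE z in unit_square. ennreal ((cmod (zak_synthesis f (fst z) (snd z) - (\<Sum>l\<in>A. c l * zak_gabor l (fst z) (snd z))))\<^sup>2)
      \<le> ennreal (L\<^sup>2 * (cmod (R z))\<^sup>2)"
      using key
    proof eventually_elim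
      case (elim z)
      have "(cmod (zak_gabor 0 (fst z) (snd z) * R z))\<^sup>2 \<le> (L * cmod (R z))\<^sup>2"
        unfolding norm_mult L_def using cmod_zak_gabor_le by (intro power_mono mult_right_mono) auto
      then show ?case unfolding elim by (intro ennreal_leI) (simp add: power_mult_distrib)
    qed
  qed
  also have "\<dots> = ennreal (L\<^sup>2 * (LINT z|unit_square. (cmod (R z))\<^sup>2))"
    using R by (subst nn_integral_eq_integral) (auto simp: sq_integrable_def)
  finally show ?thesis unfolding A_def c_def L_def R_def u_def .
qed

lemma gabor_expansion:
  assumes a: "a \<ge> 2" and f: "f \<in> H_space a"
  shows "L2_has_sum (\<lambda>l x. gabor_functional l f * gabor l x) f Lambda_sharp"
  unfolding L2_has_sum_def
proof (rule tendstoI)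
  fix \<epsilon> :: real assume \<epsilon>: "\<epsilon> > 0"
  obtain \<delta> where d: "\<delta> > 2" and fd: "f \<in> H_delta \<delta>" using f a by (rule H_spaceE)
  have [measurable]: "f \<in> borel_measurable borel" using fd by (auto simp: H_delta_iff intro: L2_measurable)
  define L where "L = 2 * exp 1 * lattice_const"
  have L: "L > 0" using lattice_const_pos by (simp add: L_def)
  have u: "sq_integrable unit_square (zak_quotient f)"
    by (rule zak_quotient_bound[OF d]) (use fd in blast)
  have "\<epsilon>\<^sup>2 / L\<^sup>2 > 0" using \<epsilon> L by simp
  from torus.approximable_expansion[OF torus_complete[OF u] this]
  obtain B where B: "finite B" "\<And>F. finite F \<Longrightarrow> B \<subseteq> F \<Longrightarrow>
      (LINT z|unit_square. (cmod (zak_quotient f z - (\<Sum>i\<in>F. torus.coef (zak_quotient f) i * torus_char i z)))\<^sup>2) < \<epsilon>\<^sup>2 / L\<^sup>2"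
    by blast
  \<comment> \<open>Every finite set of the net beyond \<open>X\<close> contains the sharp point, so
    the corrected numerator, and not the Zak transform of \<open>f\<close> itself, is what the
    lattice terms have to expand.\<close>
  define X where "X = insert sharp ((\<lambda>i. (of_int (fst i), of_int (snd i))) ` B)"
  have X: "finite X" "X \<subseteq> Lambda_sharp" using B(1) by (auto simp: X_def Lambda_sharp_def Lambda_def)
  have "dist (L2_norm (\<lambda>x. f x - (\<Sum>l\<in>Y. gabor_functional l f * gabor l x))) 0 < \<epsilon>"
    if Y: "finite Y" "X \<subseteq> Y" "Y \<subseteq> Lambda_sharp" for Y
  proof -
    define F where "F = Y - {sharp}"
    have F: "finite F" "F \<subseteq> Lambda" "insert sharp F = Y"
      using Y by (auto simp: F_def Lambda_sharp_def X_def)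
    have "B \<subseteq> lattice_index ` F"
    proof
      fix i assume i: "i \<in> B"
      define l where "l = (real_of_int (fst i), real_of_int (snd i))"
      have "l \<in> Lambda" by (auto simp: l_def Lambda_def)
      moreover have "l \<in> Y" using i Y(2) by (auto simp: X_def l_def)
      ultimately have "l \<in> F" using sharp_notin_Lambda by (auto simp: F_def)
      moreover have "lattice_index l = i" by (simp add: l_def lattice_index_def)
      ultimately show "i \<in> lattice_index ` F" by blast
    qed
    then have I: "(LINT z|unit_square. (cmod (zak_quotient f z - (\<Sum>i\<in>lattice_index ` F. torus.coef (zak_quotient f) i * torus_char i z)))\<^sup>2) < \<epsilon>\<^sup>2 / L\<^sup>2"
      using F(1) by (intro B(2)) auto
    let ?r = "\<lambda>x. f x - (\<Sum>l\<in>Y. gabor_functional l f * gabor l x)"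
    have "(LINT x|lborel. (cmod (?r x))\<^sup>2) = enn2real (\<integral>\<^sup>+x. ennreal ((cmod (?r x))\<^sup>2) \<partial>lborel)"
      by (rule integral_eq_nn_integral) auto
    also have "\<dots> \<le> L\<^sup>2 * (LINT z|unit_square. (cmod (zak_quotient f z - (\<Sum>i\<in>lattice_index ` F. torus.coef (zak_quotient f) i * torus_char i z)))\<^sup>2)"
      using gabor_remainder_le[OF d fd F(1,2)] unfolding F(3) L_def[symmetric]
      by (intro enn2real_leI) auto
    also have "\<dots> < \<epsilon>\<^sup>2" using I L by (simp add: pos_less_divide_eq mult.commute)
    finally have "sqrt (LINT x|lborel. (cmod (?r x))\<^sup>2) < sqrt (\<epsilon>\<^sup>2)" by (rule real_sqrt_less_mono)
    then show ?thesis using \<epsilon> by (simp add: L2_norm_def)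
  qed
  then show "eventually (\<lambda>Y. dist (L2_norm (\<lambda>x. f x - (\<Sum>l\<in>Y. gabor_functional l f * gabor l x))) 0 < \<epsilon>)
      (finite_subsets_at_top Lambda_sharp)"
    unfolding eventually_finite_subsets_at_top using X by (intro exI[of _ X]) auto
qed

lemma gabor_functional_summable:
  assumes d: "\<delta> > 2"
  shows "\<exists>C. \<forall>f\<in>H_delta \<delta>. (\<lambda>l. (cmod (gabor_functional l f))\<^sup>2) summable_on Lambda_sharp \<and>
         (\<Sum>\<^sub>\<infinity>l\<in>Lambda_sharp. (cmod (gabor_functional l f))\<^sup>2) \<le> C * (H_norm \<delta> f)\<^sup>2"
proof -
  obtain C where C: "C \<ge> 0" "\<And>f F. f \<in> H_delta \<delta> \<Longrightarrow> finite F \<Longrightarrow> F \<subseteq> Lambda_sharp \<Longrightarrow>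
      (\<Sum>l\<in>F. (cmod (gabor_functional l f))\<^sup>2) \<le> (C * H_norm \<delta> f)\<^sup>2"
    by (rule gabor_functional_bound[OF d], rule that)
  have "(\<lambda>l. (cmod (gabor_functional l f))\<^sup>2) summable_on Lambda_sharp \<and>
         (\<Sum>\<^sub>\<infinity>l\<in>Lambda_sharp. (cmod (gabor_functional l f))\<^sup>2) \<le> C\<^sup>2 * (H_norm \<delta> f)\<^sup>2"
    if f: "f \<in> H_delta \<delta>" for f
  proof
    show s: "(\<lambda>l. (cmod (gabor_functional l f))\<^sup>2) summable_on Lambda_sharp"
      by (rule nonneg_bounded_partial_sums_imp_summable_on[where C = "(C * H_norm \<delta> f)\<^sup>2"])
         (use C(2)[OF f] in \<open>auto intro!: eventually_finite_subsets_at_top_weakI\<close>)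
    show "(\<Sum>\<^sub>\<infinity>l\<in>Lambda_sharp. (cmod (gabor_functional l f))\<^sup>2) \<le> C\<^sup>2 * (H_norm \<delta> f)\<^sup>2"
      unfolding power_mult_distrib[symmetric] by (rule infsum_le_finite_sums[OF s]) (use C(2)[OF f] in auto)
  qed
  then show ?thesis by blast
qed

theorem theorem6p1:
  fixes a :: real
  assumes "a \<ge> 1"
    and "\<And>f. f \<in> H_space a \<Longrightarrow> sharp_poisson_defined f"
    and "continuous_functional a sharp_poisson"
  shows "\<exists>\<gamma> :: real \<times> real \<Rightarrow> (real \<Rightarrow> complex) \<Rightarrow> complex.
      \<gamma> sharp = sharp_poisson \<and>
      (\<forall>l\<in>Lambda. continuous_functional a (\<gamma> l)) \<and>
      (\<forall>f\<in>H_space a. L2_has_sum (\<lambda>l x. \<gamma> l f * gabor l x) f Lambda_sharp) \<and>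
      (\<forall>\<delta>>a. \<exists>C. \<forall>f\<in>H_delta \<delta>.
         (\<lambda>l. (cmod (\<gamma> l f))\<^sup>2) summable_on Lambda_sharp \<and>
         (\<Sum>\<^sub>\<infinity>l\<in>Lambda_sharp. (cmod (\<gamma> l f))\<^sup>2) \<le> C * (H_norm \<delta> f)\<^sup>2)"
proof -
  have a: "a \<ge> 2"
    using sharp_poisson_not_continuous[of a] assms(1,3) by (cases "a \<ge> 2") auto
  show ?thesis
  proof (intro exI[of _ gabor_functional] conjI ballI allI impI)
    show "gabor_functional sharp = sharp_poisson" by (rule ext) (simp add: gabor_functional_def)
    fix \<delta> assume "\<delta> > a"
    then show "\<exists>C. \<forall>f\<in>H_delta \<delta>.
         (\<lambda>l. (cmod (gabor_functional l f))\<^sup>2) summable_on Lambda_sharp \<and>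
         (\<Sum>\<^sub>\<infinity>l\<in>Lambda_sharp. (cmod (gabor_functional l f))\<^sup>2) \<le> C * (H_norm \<delta> f)\<^sup>2"
      using a by (intro gabor_functional_summable) simp
  qed (use gabor_functional_continuous[OF a] gabor_expansion[OF a] in auto)
qed

end
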